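(* The groups $T\mathcal{A}$ and $V\!\mathcal{A}$ are simple.
   Context: Thompson's group $T$ is the group of all piecewise-linear homeomorphisms of $S^1=\mathbb{R}/\mathbb{Z}$ whose breakpoints are dyadic and whose linear segments all have the form $t\mapsto 2^nt+b$ with $n\in\mathbb{Z}$, $b\in\mathbb{Z}[\tfrac12]$. For $f\in\mathrm{Homeo}(S^1)$, let $\mathrm{sing}(f)$ be the set of points $p\in S^1$ such that $f$ does not agree with any element of $T$ on any neighborhood of $p$. $T\mathcal{A}$ is the group of all $f\in\mathrm{Homeo}(S^1)$ such that: (1) $\mathrm{sing}(f)$ is a finite set of dyadic points; (2) if $p\in\mathrm{sing}(f)$, then $L_{f(p)}\circ f$ agrees with $f\circ L_p$ in some neighborhood of $p$, where $L_p$ denotes the linear map in a neighborhood of $p$ that fixes $p$ and has slope $2$. Let $\mathfrak{C}_2=\{0,1\}^\omega$ be the Cantor set, ordered lexicographically. Thompson's group $V$ is the group of homeomorphisms $f$ of $\mathfrak{C}_2$ such that for every $p\in\mathfrak{C}_2$ there are finite prefixes $\alpha,\beta$ of $p$ and $f(p)$, respectively, so that $f$ agrees with the prefix replacement $\alpha\psi\mapsto\beta\psi$ in a neighborhood of $p$. For $f\in\mathrm{Homeo}(\mathfrak{C}_2)$, let $\mathrm{sing}(f)$ be the set of points $p$ such that $f$ does not agree with any element of $V$ on any neighborhood of $p$. Write $\overline{0}=000\cdots$ and $\overline{1}=111\cdots$. $V\!\mathcal{A}$ is the group of all $f\in\mathrm{Homeo}(\mathfrak{C}_2)$ such that: (1)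 $\mathrm{sing}(f)$ is finite, and each point of $\mathrm{sing}(f)$ ends in either $\overline{0}$ or $\overline{1}$; (2) if $p\in\mathrm{sing}(f)$, there is a neighborhood of $p$ on which $f$ is order-preserving and $L_{f(p)}\circ f$ agrees with $f\circ L_p$, where $L_p$ denotes the prefix replacement $\alpha0\psi\mapsto\alpha\psi$ if $p=\alpha\overline{0}$, or $\alpha1\psi\mapsto\alpha\psi$ if $p=\alpha\overline{1}$. *)

theory Defs
  imports
    "HOL-Analysis.Analysis"
    "HOL-Algebra.Coset"
    "HOL-Library.Omega_Words_Fun"
    "HOL-Library.Fun_Lexorder"
begin

section \<open>Simple groups\<close>

text \<open>
  The locale \<open>simple_group\<close> of HOL-Algebra demands \<open>order G > 1\<close>, where \<open>order\<close> is the
  natural-number cardinality of the carrier and hence \<open>0\<close> for infinite groups; no infinite group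
  satisfies it. Here nontriviality is stated directly.
\<close>

definition is_simple_group :: "('a, 'b) monoid_scheme \<Rightarrow> bool" where
  "is_simple_group G \<longleftrightarrow>
     group G \<and> carrier G \<noteq> {\<one>\<^bsub>G\<^esub>} \<and> (\<forall>N. N \<lhd> G \<longrightarrow> N = {\<one>\<^bsub>G\<^esub>} \<or> N = carrier G)"

definition Homeo :: "('a::topological_space \<Rightarrow> 'a) set" where
  "Homeo = {f. \<exists>g. homeomorphism UNIV UNIV f g}"

definition comp_group :: "('a \<Rightarrow> 'a) set \<Rightarrow> ('a \<Rightarrow> 'a) monoid" where
  "comp_group X = \<lparr>carrier = X, mult = (\<circ>), one = id\<rparr>"

definition germ_eq :: "'a::topological_space \<Rightarrow> ('a \<Rightarrow> 'b) \<Rightarrow> ('a \<Rightarrow> 'b) \<Rightarrow> bool" where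
  "germ_eq p f g \<longleftrightarrow> (\<forall>\<^sub>F x in nhds p. f x = g x)"

definition sing :: "('a::topological_space \<Rightarrow> 'a) set \<Rightarrow> ('a \<Rightarrow> 'a) \<Rightarrow> 'a set" where
  "sing G f = {p. \<not> (\<exists>g\<in>G. germ_eq p f g)}"


section \<open>The circle \<open>\<real>/\<int>\<close> and the group \<open>TA\<close>\<close>

quotient_type circle = real / "\<lambda>x y. x - y \<in> \<int>"
  morphisms rep_circle circle_of
proof (rule equivpI)
  show "reflp (\<lambda>x y::real. x - y \<in> \<int>)" by (simp add: reflp_def)
  show "symp (\<lambda>x y::real. x - y \<in> \<int>)"
    by (metis (no_types, lifting) Ints_minus minus_diff_eq sympI)
  show "transp (\<lambda>x y::real. x - y \<in> \<int>)"
    by (rule transpI) (metis Ints_add diff_add_cancel add_diff_eq)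
qed

text \<open>The quotient topology.\<close>

instantiation circle :: topological_space
begin

definition open_circle :: "circle set \<Rightarrow> bool" where
  "open_circle U \<longleftrightarrow> open (circle_of -` U)"

instance
proof
  show "open (UNIV :: circle set)" by (simp add: open_circle_def)
next
  fix S T :: "circle set"
  assume "open S" "open T"
  then show "open (S \<inter> T)" by (simp add: open_circle_def vimage_Int open_Int)
next
  fix K :: "circle set set"
  assume "\<forall>S\<in>K. open S"
  then show "open (\<Union>K)" by (auto simp: open_circle_def vimage_Union)
qed

end

definition dyadic :: "real \<Rightarrow> bool" where
  "dyadic x \<longleftrightarrow> (\<exists>(a::int) (k::nat). x = of_int a / 2 ^ k)"

text \<open>
  \<open>B\<close> contains the breakpoints. Between consecutive points of \<open>B\<close>, and on any arc that avoids \<open>B\<close>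
  in its interior, \<open>f\<close> lifts to a single linear segment.
\<close>

definition ThompsonT :: "(circle \<Rightarrow> circle) set" where
  "ThompsonT = {f \<in> Homeo. \<exists>B. finite B \<and> B \<subseteq> circle_of ` Collect dyadic \<and>
     (\<forall>s t. s < t \<and> circle_of ` {s<..<t} \<inter> B = {} \<longrightarrow>
        (\<exists>(n::int) b. dyadic b \<and> (\<forall>x\<in>{s..t}. f (circle_of x) = circle_of (2 powi n * x + b))))}"

text \<open>
  The map \<open>L\<^sub>p\<close> is only needed as a germ at \<open>p\<close>; the doubling map of the circle centred at \<open>p\<close>
  represents it.
\<close>

lift_definition circle_L :: "circle \<Rightarrow> circle \<Rightarrow> circle" is "\<lambda>p x. p + 2 * (x - p)"
proof -
  fix p p' x x' :: real
  assume "p - p' \<in> \<int>" "x - x' \<in> \<int>"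
  then have "2 * (x - x') - (p - p') \<in> \<int>"
    by (metis Ints_diff Ints_mult Ints_numeral)
  then show "p + 2 * (x - p) - (p' + 2 * (x' - p')) \<in> \<int>" by (simp add: algebra_simps)
qed

lemma circle_L_circle_of: "circle_L (circle_of a) (circle_of (a + s)) = circle_of (a + 2 * s)"
  by (simp add: circle_L.abs_eq)

definition TA :: "(circle \<Rightarrow> circle) set" where
  "TA = {f \<in> Homeo.
     finite (sing ThompsonT f) \<and> sing ThompsonT f \<subseteq> circle_of ` Collect dyadic \<and>
     (\<forall>p\<in>sing ThompsonT f. germ_eq p (circle_L (f p) \<circ> f) (f \<circ> circle_L p))}"


section \<open>The Cantor set and the group \<open>VA\<close>\<close>

text \<open>
  Infinite words over \<open>bool\<close>, with \<open>False\<close> and \<open>True\<close> as the letters 0 and 1. The topology is the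
  product topology; the lexicographic order is \<open>less_fun\<close>, because \<open>(<)\<close> on functions is
  pointwise.
\<close>

type_synonym cantor = "bool word"

text \<open>
  The prefix replacement \<open>\<alpha>\<psi> \<mapsto> \<beta>\<psi>\<close>. Its values outside the clopen cone of words with prefix
  \<open>\<alpha>\<close> are junk; it is only used near points inside that cone.
\<close>

definition prefix_repl :: "bool list \<Rightarrow> bool list \<Rightarrow> cantor \<Rightarrow> cantor" where
  "prefix_repl \<alpha> \<beta> x = \<beta> \<frown> suffix (length \<alpha>) x"

lemma prefix_repl_conc: "prefix_repl \<alpha> \<beta> (\<alpha> \<frown> \<psi>) = \<beta> \<frown> \<psi>"
  by (simp add: prefix_repl_def)

definition ThompsonV :: "(cantor \<Rightarrow> cantor) set" where
  "ThompsonV = {f \<in> Homeo. \<forall>p. \<exists>\<alpha> \<beta>. p \<in> range ((\<frown>) \<alpha>) \<and> f p \<in> range ((\<frown>) \<beta>) \<and>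
     germ_eq p f (prefix_repl \<alpha> \<beta>)}"

text \<open>
  \<open>tail_L p L\<close> says that \<open>L\<close> represents the germ \<open>L\<^sub>p\<close>. Different choices of \<open>\<alpha>\<close> for the same
  \<open>p\<close> give the same germ at \<open>p\<close>. No \<open>L\<close> qualifies if \<open>p\<close> is not eventually constant.
\<close>

definition tail_L :: "cantor \<Rightarrow> (cantor \<Rightarrow> cantor) \<Rightarrow> bool" where
  "tail_L p L \<longleftrightarrow> (\<exists>\<alpha> a. p = \<alpha> \<frown> [a]\<^sup>\<omega> \<and> L = prefix_repl (\<alpha> @ [a]) \<alpha>)"

definition VA :: "(cantor \<Rightarrow> cantor) set" where
  "VA = {f \<in> Homeo.
     finite (sing ThompsonV f) \<and>
     (\<forall>p\<in>sing ThompsonV f. \<exists>\<alpha> a. p = \<alpha> \<frown> [a]\<^sup>\<omega>) \<and>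
     (\<forall>p\<in>sing ThompsonV f.
        (\<exists>U. open U \<and> p \<in> U \<and> monotone_on U less_fun less_fun f) \<and>
        (\<exists>L L'. tail_L p L \<and> tail_L (f p) L' \<and> germ_eq p (L' \<circ> f) (f \<circ> L)))}"

end

theory Submission imports Defs begin

text \<open>
  The circle and the Cantor set are treated together. Both are the disjoint union of two copies of
  themselves, so a finite word \<open>w\<close> of bits names a cone, and a map \<^emph>\<open>carries\<close> \<open>a\<close> to \<open>b\<close> if it replaces
  the prefix \<open>a\<close> by \<open>b\<close>. Elements of \<open>T\<close> carry the leaves of one finite binary tree to a cyclic
  rotation of the leaves of another; for \<open>V\<close> the leaves may be permuted arbitrarily. Let \<open>G\<close> be one
  of \<open>TA\<close>, \<open>VA\<close> and let \<open>N\<close> be a normal subgroup of \<open>G\<close> with an element other than the identity.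
  The proof shows \<open>N = G\<close> in four steps.

  \<^item> \<^emph>\<open>Small commutators.\<close> A nontrivial element of \<open>N\<close> displaces some cone. The double commutator trick
    then puts \<open>[g, h]\<close> into \<open>N\<close> for all \<open>g, h\<close> supported in that cone, and, because \<open>G\<close> can
    squeeze the complement of any cone into any other cone, for all \<open>g, h\<close> that fix one common cone
    pointwise (\<open>small_commutator\<close>).

  \<^item> \<^emph>\<open>Generators.\<close> For neighbouring cones \<open>c\<close>, \<open>d\<close> the rebracketing map \<open>x\<^sub>c\<^sub>d\<close> carries the list
    \<open>c0, c1, d\<close> to \<open>c, d0, d1\<close>. For four consecutive cones \<open>b, c, d, e\<close> the pentagon identity
    \<open>x\<^sub>c\<^sub>d x\<^sub>d\<^sub>e x\<^sub>b\<^sub>c x\<^sub>c\<^sub>d = x\<^sub>d\<^sub>e x\<^sub>c\<^sub>d x\<^sub>b\<^sub>c\<close> says that \<open>x\<^sub>c\<^sub>d\<close> is the conjugate by \<open>x\<^sub>d\<^sub>e\<close> of the commutator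
    \<open>[x\<^sub>c\<^sub>d, x\<^sub>b\<^sub>c]\<close>, whose two entries fix a common cone as soon as there is room for it. So
    every rebracketing map lies in \<open>N\<close>. These maps lead from any leaf list to any other of the
    same length (at least four), up to rotation, and hence generate \<open>T\<close> (\<open>cyc_N\<close>).

  \<^item> \<^emph>\<open>Singular germs.\<close> The cone of \<open>0\<^sup>m\<close>, which is a neighbourhood of the base point \<open>000...\<close> on its right
    side, is the disjoint union of this point and the blocks \<open>0\<^sup>i1\<close> with \<open>i \<ge> m\<close>, and doubling maps
    each block onto the next larger one. An element \<open>g\<close> that fixes the
    base point commutes with doubling near it, so its germ there is determined by its effect on
    one block; closing the block up to a circle turns this effect into an element of \<open>T\<close>.
    Performing a rebracketing in all blocks at once (\<open>spread\<close>) gives elements of \<open>G\<close>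
    that satisfy the same pentagon identity, so they are in \<open>N\<close> too. They generate enough to make
    \<open>n \<circ> g\<close> a prefix replacement near the base point, on its right side, for some \<open>n \<in> N\<close>
    (\<open>end_reduction\<close>).

  \<^item> \<^emph>\<open>Induction on the number of singular points.\<close> Elements of \<open>T\<close> or \<open>V\<close>, known to be in \<open>N\<close>, move a
    singular point and its image to the base point, where the previous step removes the
    singularity. On the circle the left side is treated by conjugating with the
    reflection \<open>x \<mapsto> -x\<close>, and on the Cantor set points with tail \<open>111...\<close> are treated by conjugating
    with the exchange of the letters. Elements without singular points lie in \<open>T\<close> or \<open>V\<close>. For
    \<open>V\<close> the transpositions of two cones are needed in addition; each is a commutator of two
    involutions that fix a common cone (\<open>swap_N\<close>).
\<close>

section \<open>Leaf lists of finite binary trees\<close>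

text \<open>
  The addresses of the leaves of a finite binary tree, from left to right.
\<close>

inductive leaf :: "bool list list \<Rightarrow> bool" where
  leaf_root: "leaf [[]]"
| leaf_node: "leaf P \<Longrightarrow> leaf Q \<Longrightarrow> leaf (map ((#) False) P @ map ((#) True) Q)"

text \<open>
  The word \<open>b\<close> follows \<open>a\<close> immediately from the left to the right: below the node \<open>u\<close> where they
  separate, \<open>a\<close> is on the rightmost path of the left subtree and \<open>b\<close> on the leftmost path of the
  right one.
\<close>

definition adj :: "bool list \<Rightarrow> bool list \<Rightarrow> bool" where
  "adj a b \<longleftrightarrow> (\<exists>u i j. a = u @ False # replicate i True \<and> b = u @ True # replicate j False)"

definition cyc :: "bool list list \<Rightarrow> bool" where
  "cyc P \<longleftrightarrow> (\<exists>s. leaf (rotate s P))"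

lemma leaf_nonempty: "leaf P \<Longrightarrow> P \<noteq> []"
  by (induction rule: leaf.induct) auto

lemma leaf_hd: "leaf P \<Longrightarrow> \<exists>l. hd P = replicate l False"
proof (induction rule: leaf.induct)
  case leaf_root
  show ?case by (auto intro: exI[of _ 0])
next
  case (leaf_node P Q)
  then obtain l where "hd P = replicate l False" by blast
  then have "hd (map ((#) False) P @ map ((#) True) Q) = replicate (Suc l) False"
    using leaf_nonempty[OF leaf_node(1)] by (simp add: hd_append hd_map)
  then show ?case by blast
qed

lemma leaf_last: "leaf P \<Longrightarrow> \<exists>l. last P = replicate l True"
proof (induction rule: leaf.induct)
  case leaf_root
  show ?case by (auto intro: exI[of _ 0])
next
  case (leaf_node P Q)
  then obtain l where "last Q = replicate l True" by blast
  then have "last (map ((#) False) P @ map ((#) True) Q) = replicate (Suc l) True"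
    using leaf_nonempty[OF leaf_node(2)] by (simp add: last_append last_map)
  then show ?case by blast
qed

lemma adj_Cons: "adj a b \<Longrightarrow> adj (t # a) (t # b)"
  unfolding adj_def by (metis append_Cons)

lemma adj_append: "adj a b \<Longrightarrow> adj (u @ a) (u @ b)"
  by (induction u) (auto intro: adj_Cons)

lemma successively_adj_map: "successively adj P \<Longrightarrow> successively adj (map ((#) t) P)"
  by (auto simp: successively_map intro: successively_mono adj_Cons)

lemma leaf_successively_adj: "leaf P \<Longrightarrow> successively adj P"
proof (induction rule: leaf.induct)
  case leaf_root
  show ?case by simp
next
  case (leaf_node P Q)
  obtain l where l: "last P = replicate l True" using leaf_last[OF leaf_node(1)] by blast
  obtain m where m: "hd Q = replicate m False" using leaf_hd[OF leaf_node(2)] by blast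
  have "adj (False # replicate l True) (True # replicate m False)"
    unfolding adj_def by (metis append_Nil)
  then show ?case
    using leaf_node leaf_nonempty[OF leaf_node(1)] leaf_nonempty[OF leaf_node(2)] l m
    by (auto simp: successively_append_iff successively_adj_map last_map hd_map)
qed

lemma leaf_adjD: "leaf (A @ a # b # B) \<Longrightarrow> adj a b"
  using leaf_successively_adj[of "A @ a # b # B"] by (simp add: successively_append_iff)

lemma leaf_distinct: "leaf P \<Longrightarrow> distinct P"
  by (induction rule: leaf.induct) (auto simp: distinct_map)

lemma leaf_antichain: "leaf P \<Longrightarrow> a \<in> set P \<Longrightarrow> a @ v \<in> set P \<Longrightarrow> v = []"
  by (induction arbitrary: a rule: leaf.induct) auto

text \<open>
  Grafting a tree at every leaf; splitting one leaf and passing to a common refinement are special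
  cases.
\<close>

lemma leaf_refine:
  "leaf P \<Longrightarrow> (\<And>w. w \<in> set P \<Longrightarrow> leaf (F w)) \<Longrightarrow>
     leaf (concat (map (\<lambda>w. map ((@) w) (F w)) P))"
proof (induction arbitrary: F rule: leaf.induct)
  case leaf_root
  then show ?case by (simp add: map_idI)
next
  case (leaf_node P Q)
  have 1: "leaf (concat (map (\<lambda>w. map ((@) w) (F (False # w))) P))"
    by (rule leaf_node(3)) (simp add: leaf_node(5))
  have 2: "leaf (concat (map (\<lambda>w. map ((@) w) (F (True # w))) Q))"
    by (rule leaf_node(4)) (simp add: leaf_node(5))
  have e: "(\<lambda>xa. t # x @ xa) = (@) (t # x)" for t x by auto
  show ?case using leaf.leaf_node[OF 1 2] unfolding e[symmetric] by (simp add: map_concat comp_def e)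
qed

lemma cyc_leaf: "leaf P \<Longrightarrow> cyc P"
  unfolding cyc_def by (metis rotate0 id_apply)

lemma cyc_swap: "cyc (x @ y) \<Longrightarrow> cyc (y @ x)"
  unfolding cyc_def
  by (metis rotate_append rotate_rotate)

lemma cycE:
  assumes "cyc P" obtains A B where "leaf (A @ B)" "P = B @ A"
proof -
  obtain s where s: "leaf (rotate s P)" using assms unfolding cyc_def by blast
  show ?thesis
    by (rule that[of "drop (s mod length P) P" "take (s mod length P) P"])
      (use s in \<open>simp_all add: rotate_drop_take\<close>)
qed

lemma cyc_rotate: "cyc P \<Longrightarrow> cyc (rotate s P)"
  by (metis append_take_drop_id cyc_swap rotate_drop_take)

lemma cyc_distinct: "cyc P \<Longrightarrow> distinct P"
  by (erule cycE) (drule leaf_distinct, auto)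

lemma cyc_nonempty: "cyc P \<Longrightarrow> P \<noteq> []"
  unfolding cyc_def using leaf_nonempty by fastforce

lemma cyc_refine:
  assumes "cyc P" "\<And>w. w \<in> set P \<Longrightarrow> leaf (F w)"
  shows "cyc (concat (map (\<lambda>w. map ((@) w) (F w)) P))"
proof -
  obtain A B where AB: "leaf (A @ B)" "P = B @ A" using cycE[OF assms(1)] .
  have "leaf (concat (map (\<lambda>w. map ((@) w) (F w)) (A @ B)))"
    by (rule leaf_refine) (use AB assms in auto)
  then show ?thesis unfolding AB(2)
    by (simp add: cyc_leaf cyc_swap)
qed

lemma concat_graft:
  assumes "u \<notin> set A"
  shows "concat (map (\<lambda>w. map ((@) w) (if w = u then Q else [[]])) A) = A"
  using assms by (induction A) auto

lemma leaf_graft: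
  assumes "leaf (A @ u # B)" "leaf Q"
  shows "leaf (A @ map ((@) u) Q @ B)"
proof -
  have "u \<notin> set A" "u \<notin> set B" using leaf_distinct[OF assms(1)] by auto
  then show ?thesis
    using leaf_refine[OF assms(1), of "\<lambda>w. if w = u then Q else [[]]"] assms(2)
    by (simp add: concat_graft leaf_root)
qed

lemma cyc_graft:
  assumes "cyc (A @ u # B)" "leaf Q"
  shows "cyc (A @ map ((@) u) Q @ B)"
proof -
  have "u \<notin> set A" "u \<notin> set B" using cyc_distinct[OF assms(1)] by auto
  then show ?thesis
    using cyc_refine[OF assms(1), of "\<lambda>w. if w = u then Q else [[]]"] assms(2)
    by (simp add: concat_graft leaf_root)
qed

lemma leaf_caret: "leaf [[False], [True]]"
  using leaf_node[OF leaf_root leaf_root] by simp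

lemma leaf_split: "leaf (A @ c # B) \<Longrightarrow> leaf (A @ (c @ [False]) # (c @ [True]) # B)"
  using leaf_graft[OF _ leaf_caret] by simp

lemma cyc_split: "cyc (A @ c # B) \<Longrightarrow> cyc (A @ (c @ [False]) # (c @ [True]) # B)"
  using cyc_graft[OF _ leaf_caret] by simp

lemma leaf_length_1: "leaf P \<Longrightarrow> length P = 1 \<Longrightarrow> P = [[]]"
proof (induction rule: leaf.induct)
  case (leaf_node P Q)
  have "length P > 0" "length Q > 0"
    using leaf_nonempty[OF leaf_node(1)] leaf_nonempty[OF leaf_node(2)] by auto
  with leaf_node(5) show ?case by simp
qed simp

text \<open>
  A tree with at least two leaves has a caret, that is, an inner node whose children are both leaves. It
  is what inductions on the number of leaves remove.
\<close>

lemma leaf_unsplit: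
  "leaf P \<Longrightarrow> 2 \<le> length P \<Longrightarrow>
    \<exists>A c B. P = A @ (c @ [False]) # (c @ [True]) # B \<and> leaf (A @ c # B)"
proof (induction rule: leaf.induct)
  case leaf_root
  then show ?case by simp
next
  case (leaf_node P Q)
  consider "2 \<le> length P" | "2 \<le> length Q" | "length P = 1" "length Q = 1"
    using leaf_nonempty[OF leaf_node(1)] leaf_nonempty[OF leaf_node(2)]
    by (cases P; cases Q) (auto simp: Suc_le_eq)
  then show ?case
  proof cases
    case 1
    then obtain A c B where h: "P = A @ (c @ [False]) # (c @ [True]) # B" "leaf (A @ c # B)"
      using leaf_node by blast
    show ?thesis
      apply (rule exI[of _ "map ((#) False) A"], rule exI[of _ "False # c"],
          rule exI[of _ "map ((#) False) B @ map ((#) True) Q"])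
      using leaf.leaf_node[OF h(2) leaf_node(2)] h(1) by simp
  next
    case 2
    then obtain A c B where h: "Q = A @ (c @ [False]) # (c @ [True]) # B" "leaf (A @ c # B)"
      using leaf_node by blast
    show ?thesis
      apply (rule exI[of _ "map ((#) False) P @ map ((#) True) A"], rule exI[of _ "True # c"],
          rule exI[of _ "map ((#) True) B"])
      using leaf.leaf_node[OF leaf_node(1) h(2)] h(1) by simp
  next
    case 3
    have "P = [[]]" "Q = [[]]" using leaf_length_1[OF leaf_node(1) 3(1)] leaf_length_1[OF leaf_node(2) 3(2)] .
    then show ?thesis using leaf_root
      by (intro exI[of _ "[]"]) simp
  qed
qed

lemma leaf_spine_True: "\<exists>A. leaf (A @ [replicate i True])"
proof (induction i)
  case 0
  then show ?case using leaf_root by (auto intro: exI[of _ "[]"])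
next
  case (Suc i)
  then obtain A where "leaf (A @ [replicate i True])" by blast
  from leaf_node[OF leaf_root this]
  show ?case by (intro exI[of _ "[False] # map ((#) True) A"]) simp
qed

lemma leaf_spine_False: "\<exists>A. leaf (replicate i False # A)"
proof (induction i)
  case 0
  then show ?case using leaf_root by (auto intro: exI[of _ "[]"])
next
  case (Suc i)
  then obtain A where "leaf (replicate i False # A)" by blast
  from leaf_node[OF this leaf_root] show ?case by auto
qed

lemma leaf_contains: "\<exists>A B. leaf (A @ u # B)"
proof (induction u)
  case Nil
  show ?case using leaf_root by (intro exI[of _ "[]"]) simp
next
  case (Cons t u)
  then obtain A B where *: "leaf (A @ u # B)" by blast
  show ?case
  proof (cases t)
    case True
    with leaf_node[OF leaf_root *] show ?thesis
      by (intro exI[of _ "[False] # map ((#) True) A"] exI[of _ "map ((#) True) B"]) simp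
  next
    case False
    with leaf_node[OF * leaf_root] show ?thesis
      by (intro exI[of _ "map ((#) False) A"] exI[of _ "map ((#) False) B @ [[True]]"]) simp
  qed
qed

text \<open>
  The tree is the path to the common node with a left spine and a right spine below it.
\<close>

lemma adj_leaf:
  assumes "adj a b" shows "\<exists>A B. leaf (A @ a # b # B)"
proof -
  obtain u i j where ab: "a = u @ False # replicate i True" "b = u @ True # replicate j False"
    using assms unfolding adj_def by blast
  obtain A where A: "leaf (A @ [replicate i True])" using leaf_spine_True by blast
  obtain B where B: "leaf (replicate j False # B)" using leaf_spine_False by blast
  obtain C D where "leaf (C @ u # D)" using leaf_contains by blast
  from leaf_graft[OF this leaf_node[OF A B]]
  show ?thesis unfolding ab
    apply (rule_tac exI[of _ "C @ map ((@) u) (map ((#) False) A)"])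
    apply (rule_tac exI[of _ "map ((@) u) (map ((#) True) B) @ D"])
    by simp
qed

text \<open>
  Two cyclic leaf lists with prescribed initial parts can be brought to the same length by splitting
  entries of the remaining parts; then some element of \<open>T\<close> carries one to the other.
\<close>

lemma cyc_extend:
  assumes "cyc (B @ A)" "A \<noteq> []" "length A \<le> n"
  shows "\<exists>A'. cyc (B @ A') \<and> length A' = n"
  using assms(3)
proof (induction n rule: dec_induct)
  case base
  then show ?case using assms by blast
next
  case (step n)
  then obtain A' where A': "cyc (B @ A')" "length A' = n" by blast
  with step assms(2) obtain c A'' where "A' = c # A''" by (cases A') auto
  with A' cyc_split[of B c "A''"] show ?case
    by (intro exI[of _ "(c @ [False]) # (c @ [True]) # A''"]) simp
qed

lemma cyc_contains:
  assumes "u \<noteq> []" shows "\<exists>n0. \<forall>n\<ge>n0. \<exists>A. cyc (u # A) \<and> length A = n"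
proof -
  obtain A B where *: "leaf (A @ u # B)" using leaf_contains by blast
  have ne: "B @ A \<noteq> []"
  proof
    assume "B @ A = []"
    with * have "leaf [u]" by simp
    then have "u = []" using leaf_length_1 by fastforce
    with assms show False by simp
  qed
  have "cyc ([u] @ (B @ A))" using cyc_swap[OF cyc_leaf[OF *]] by simp
  then show ?thesis using cyc_extend[OF _ ne, of "[u]"] by (metis append_Cons append_Nil)
qed

fun unif :: "nat \<Rightarrow> bool list list" where
  "unif 0 = [[]]"
| "unif (Suc n) = map ((#) False) (unif n) @ map ((#) True) (unif n)"

lemma leaf_unif: "leaf (unif n)"
  by (induction n) (auto intro: leaf.intros)

lemma set_unif: "set (unif n) = {w. length w = n}"
proof (induction n)
  case (Suc n)
  show ?case
  proof (rule Set.set_eqI)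
    fix w show "w \<in> set (unif (Suc n)) \<longleftrightarrow> w \<in> {w. length w = Suc n}" using Suc by (cases w; cases "hd w") auto
  qed
qed auto

lemma length_unif: "length (unif n) = 2 ^ n"
  by (induction n) auto

text \<open>
  The word \<open>a\<close> determines the node where a right neighbour branches off, so right neighbours differ
  only in the number of trailing zeros. In an antichain the right neighbour is therefore unique.
\<close>

lemma adj_det:
  assumes "adj a b" "adj a b'"
  shows "(\<exists>v. b' = b @ v) \<or> (\<exists>v. b = b' @ v)"
proof -
  obtain u i j where 1: "a = u @ False # replicate i True" "b = u @ True # replicate j False"
    using assms(1) unfolding adj_def by blast
  obtain u' i' j' where 2: "a = u' @ False # replicate i' True" "b' = u' @ True # replicate j' False"
    using assms(2) unfolding adj_def by blast
  have *: "u @ False # replicate i True = u' @ False # replicate i' True \<Longrightarrow> u = u'" for u i u' i'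
  proof -
    have r: "rev (u @ False # replicate i True) = replicate i True @ False # rev u" for u i by simp
    have t: "takeWhile id (rev (u @ False # replicate i True)) = replicate i True" for u i
      unfolding r by (induction i) auto
    assume "u @ False # replicate i True = u' @ False # replicate i' True"
    then have "replicate i True = replicate i' True" "length u + i = length u' + i'"
      by (metis t, simp add: list_eq_iff_nth_eq)
    then have "length u = length u'" by (metis add_right_cancel length_replicate)
    then show "u = u'" using \<open>u @ _ = _\<close> by simp
  qed
  have "u = u'" using * 1 2 by metis
  moreover have "replicate j False = replicate j' False @ replicate (j - j') False" if "j' \<le> j" for j j'
    using that by (simp flip: replicate_add)
  ultimately show ?thesis using 1 2 by (metis append_Cons append_assoc nle_le)
qed

lemma adj_not_replicate_True: "\<not> adj (replicate k True) b"
  unfolding adj_def by (metis append_Cons in_set_conv_decomp in_set_replicate)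

text \<open>
  The words \<open>0\<^sup>i1\<close> are the addresses of the dyadic blocks around the point \<open>000...\<close>; \<open>at_scale i a\<close>
  is the place that \<open>a\<close> takes inside the block at scale \<open>i\<close>.
\<close>

definition at_scale :: "nat \<Rightarrow> bool list \<Rightarrow> bool list" where
  "at_scale i a = replicate i False @ True # a"

text \<open>
  The second alternative is the passage from the end of one block to the start of the next larger
  one. Forgetting the scales turns it into the passage from the last leaf of a tree to the first
  one, which is why leaf lists up to rotation describe what happens near the base point.
\<close>

lemma adj_at_scale_cases:
  assumes "adj (at_scale i a) (at_scale j b)"
  shows "(i = j \<and> adj a b) \<or> (i = Suc j \<and> (\<exists>k. a = replicate k True) \<and> (\<exists>k. b = replicate k False))"
proof -
  obtain u k l where u: "at_scale i a = u @ False # replicate k True" "at_scale j b = u @ True # replicate l False"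
    using assms unfolding adj_def by blast
  have "at_scale i a = u @ False # replicate k True \<Longrightarrow> at_scale j b = u @ True # replicate l False \<Longrightarrow> ?thesis"
  proof (induction u arbitrary: i j)
    case Nil
    have "replicate n False @ True # a = replicate k True \<Longrightarrow> n = 0 \<and> (\<exists>k. a = replicate k True)" for n
      by (cases n; cases k) auto
    with Nil show ?case by (cases i; cases j) (auto simp: at_scale_def)
  next
    case (Cons t u)
    then show ?case by (cases i; cases j) (auto simp: at_scale_def adj_def)
  qed
  then show ?thesis using u by blast
qed

section \<open>Self-similar sets and prefix replacement\<close>

abbreviation finv :: "('a \<Rightarrow> 'b) \<Rightarrow> 'b \<Rightarrow> 'a" where
  "finv f \<equiv> inv_into UNIV f"

text \<open>
  A set that is the disjoint union of two copies of itself. The image of \<open>W w\<close> is the cone of \<open>w\<close>.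
\<close>

locale dyad =
  fixes y :: "bool \<Rightarrow> 'x \<Rightarrow> 'x"
  assumes y_inj: "y a x = y b z \<Longrightarrow> a = b \<and> x = z"
    and y_surj: "\<exists>a z. x = y a z"
begin

fun W :: "bool list \<Rightarrow> 'x \<Rightarrow> 'x" where
  "W [] x = x"
| "W (a # w) x = y a (W w x)"

lemma y_eq_iff [simp]: "y a x = y b z \<longleftrightarrow> a = b \<and> x = z"
  using y_inj by blast

lemma W_append [simp]: "W (u @ v) x = W u (W v x)"
  by (induction u) auto

lemma W_eq_iff [simp]: "W u x = W u z \<longleftrightarrow> x = z"
  by (induction u) auto

lemma W_eqD: "W a x = W b z \<Longrightarrow> (\<exists>v. b = a @ v \<and> x = W v z) \<or> (\<exists>v. a = b @ v \<and> z = W v x)"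
proof (induction a arbitrary: b)
  case (Cons t a)
  then show ?case by (cases b) auto
qed auto

definition disj :: "bool list \<Rightarrow> bool list \<Rightarrow> bool" where
  "disj a b \<longleftrightarrow> range (W a) \<inter> range (W b) = {}"

lemma disj_sym: "disj a b \<Longrightarrow> disj b a"
  unfolding disj_def by auto

lemma disjD: "disj a b \<Longrightarrow> W a x \<noteq> W b z"
  unfolding disj_def by auto

lemma disj_iff: "disj a b \<longleftrightarrow> (\<nexists>v. b = a @ v) \<and> (\<nexists>v. a = b @ v)"
proof
  assume "disj a b"
  then show "(\<nexists>v. b = a @ v) \<and> (\<nexists>v. a = b @ v)"
    by (metis W_append disjD)
next
  assume "(\<nexists>v. b = a @ v) \<and> (\<nexists>v. a = b @ v)"
  then show "disj a b" unfolding disj_def using W_eqD by blast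
qed

lemma disj_append: "disj a b \<Longrightarrow> disj (a @ u) (b @ v)"
  unfolding disj_def by (auto simp: disjoint_iff)

lemma disj_Cons_same [simp]: "disj (t # a) (t # b) \<longleftrightarrow> disj a b"
  by (simp add: disj_iff)

text \<open>
  Stated with \<open>sorted_wrt\<close> so that a word occurring twice is excluded.
\<close>

definition tiling :: "bool list list \<Rightarrow> bool" where
  "tiling P \<longleftrightarrow> sorted_wrt disj P \<and> (\<forall>x. \<exists>w\<in>set P. x \<in> range (W w))"

lemma y_range: "\<exists>z. x = y False z \<or> x = y True z"
  using y_surj[of x] by (metis (full_types))

lemma leaf_tiling: "leaf P \<Longrightarrow> tiling P"
proof (induction rule: leaf.induct)
  case leaf_root
  then show ?case by (simp add: tiling_def)
next
  case (leaf_node P Q)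
  show ?case unfolding tiling_def
  proof (intro conjI allI)
    show "sorted_wrt disj (map ((#) False) P @ map ((#) True) Q)"
      using leaf_node unfolding tiling_def
      by (auto simp: sorted_wrt_append sorted_wrt_map) (auto simp: disj_iff)
    fix x
    from y_range[of x] show "\<exists>w\<in>set (map ((#) False) P @ map ((#) True) Q). x \<in> range (W w)"
    proof (elim exE disjE)
      fix z assume "x = y False z"
      moreover obtain w v where "w \<in> set P" "z = W w v" using leaf_node(3) unfolding tiling_def by blast
      ultimately show ?thesis by (intro bexI[of _ "False # w"]) auto
    next
      fix z assume "x = y True z"
      moreover obtain w v where "w \<in> set Q" "z = W w v" using leaf_node(4) unfolding tiling_def by blast
      ultimately show ?thesis by (intro bexI[of _ "True # w"]) auto
    qed
  qed
qed

lemma tiling_disj_nth: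
  "tiling P \<Longrightarrow> i < length P \<Longrightarrow> j < length P \<Longrightarrow> i \<noteq> j \<Longrightarrow> disj (P ! i) (P ! j)"
  unfolding tiling_def by (metis disj_sym linorder_neqE_nat sorted_wrt_nth_less)

lemma tiling_disj: "tiling P \<Longrightarrow> a \<in> set P \<Longrightarrow> b \<in> set P \<Longrightarrow> a \<noteq> b \<Longrightarrow> disj a b"
  by (metis in_set_conv_nth tiling_disj_nth)

lemma not_disj_self [simp]: "\<not> disj a a"
  by (simp add: disj_iff)

lemma tiling_distinct: "tiling P \<Longrightarrow> distinct P"
  unfolding distinct_conv_nth by (metis not_disj_self tiling_disj_nth)

lemma tiling_swap: "tiling (A @ B) \<Longrightarrow> tiling (B @ A)"
  unfolding tiling_def by (auto simp: sorted_wrt_append intro: disj_sym) (metis Un_iff)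

lemma cyc_tiling: "cyc P \<Longrightarrow> tiling P"
  by (erule cycE) (simp add: leaf_tiling tiling_swap)

text \<open>
  Unless the partition is the trivial one, it restricts to partitions of both halves, and the trees
  obtained for these are joined at a new root.
\<close>

lemma finite_code_leaf:
  assumes "finite S" "\<And>w. w \<in> S \<Longrightarrow> length w \<le> n"
    and "\<And>a b. a \<in> S \<Longrightarrow> b \<in> S \<Longrightarrow> a \<noteq> b \<Longrightarrow> disj a b"
    and "\<And>x. \<exists>w\<in>S. x \<in> range (W w)"
  shows "\<exists>P. leaf P \<and> set P = S"
  using assms
proof (induction n arbitrary: S)
  case 0
  then have "S \<noteq> {}" by auto
  with 0 have "S = {[]}" by auto
  then show ?case using leaf_root by (intro exI[of _ "[[]]"]) auto
next
  case (Suc n)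
  show ?case
  proof (cases "[] \<in> S")
    case True
    have "w = []" if "w \<in> S" for w
      using Suc(4)[OF True that] by (auto simp: disj_iff)
    with True have "S = {[]}" by blast
    then show ?thesis using leaf_root by (intro exI[of _ "[[]]"]) auto
  next
    case False
    have ex: "\<exists>P. leaf P \<and> set P = {w. t # w \<in> S}" for t
    proof (rule Suc(1))
      show "finite {w. t # w \<in> S}"
        using finite_vimageI[OF Suc(2), of "(#) t"] by (simp add: vimage_def)
      show "length w \<le> n" if "w \<in> {w. t # w \<in> S}" for w using Suc(3)[of "t # w"] that by auto
      show "disj a b" if "a \<in> {w. t # w \<in> S}" "b \<in> {w. t # w \<in> S}" "a \<noteq> b" for a b
        using Suc(4)[of "t # a" "t # b"] that by simp
      show "\<exists>w\<in>{w. t # w \<in> S}. x \<in> range (W w)" for x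
      proof -
        obtain w z where w: "w \<in> S" "y t x = W w z" using Suc(5)[of "y t x"] by blast
        with False obtain s v where "w = s # v" by (cases w) auto
        with w show ?thesis by (auto intro!: bexI[of _ v])
      qed
    qed
    obtain P Q where PQ: "leaf P" "set P = {w. False # w \<in> S}" "leaf Q" "set Q = {w. True # w \<in> S}"
      using ex[of False] ex[of True] by blast
    have "set (map ((#) False) P @ map ((#) True) Q) = S"
    proof (rule Set.set_eqI)
      fix w show "w \<in> set (map ((#) False) P @ map ((#) True) Q) \<longleftrightarrow> w \<in> S"
        using False PQ by (cases w; cases "hd w") auto
    qed
    then show ?thesis using leaf_node[OF PQ(1,3)] by blast
  qed
qed

lemma tiling_mset:
  assumes "tiling P" "mset P = mset Q" shows "tiling Q"
proof -
  have d: "distinct Q" using assms tiling_distinct by (metis mset_eq_imp_distinct_iff)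
  have s: "set P = set Q" using assms(2) by (metis set_mset_mset)
  show ?thesis unfolding tiling_def
  proof
    show "sorted_wrt disj Q" unfolding sorted_wrt_iff_nth_less
      by (metis assms(1) d nat_neq_iff nth_eq_iff_index_eq nth_mem order.strict_trans s tiling_disj)
    show "\<forall>x. \<exists>w\<in>set Q. x \<in> range (W w)" using assms(1) s unfolding tiling_def by simp
  qed
qed

text \<open>
  Prefix replacement on the cone of \<open>a\<close>.
\<close>

definition carries :: "('x \<Rightarrow> 'x) \<Rightarrow> bool list \<Rightarrow> bool list \<Rightarrow> bool" where
  "carries f a b \<longleftrightarrow> (\<forall>x. f (W a x) = W b x)"

lemma carries_append: "carries f a b \<Longrightarrow> carries f (a @ u) (b @ u)"
  by (simp add: carries_def)

lemma carries_comp: "carries f a b \<Longrightarrow> carries g b c \<Longrightarrow> carries (g \<circ> f) a c"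
  by (simp add: carries_def)

lemma carries_inv: "bij f \<Longrightarrow> carries f a b \<Longrightarrow> carries (finv f) b a"
  unfolding carries_def by (metis bij_inv_eq_iff)

lemma carries_id: "carries id a a" by (simp add: carries_def)

lemma list_all2_carries_inv: "bij f \<Longrightarrow> list_all2 (carries f) P Q \<Longrightarrow> list_all2 (carries (finv f)) Q P"
  by (auto simp: list_all2_conv_all_nth carries_inv)

lemma list_all2_carries_comp: "list_all2 (carries f) P Q \<Longrightarrow> list_all2 (carries g) Q R \<Longrightarrow> list_all2 (carries (g \<circ> f)) P R"
  unfolding list_all2_conv_all_nth using carries_comp by metis

lemma tiling_cover:
  assumes "tiling P" obtains i z where "i < length P" "x = W (P ! i) z"
  using assms unfolding tiling_def by (metis imageE in_set_conv_nth)

lemma tiling_uniq: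
  assumes "tiling P" "i < length P" "j < length P" "W (P ! i) x = W (P ! j) z"
  shows "i = j \<and> x = z"
proof -
  have "i = j" using tiling_disj_nth[OF assms(1-3)] disjD assms(4) by blast
  with assms(4) show ?thesis by simp
qed

lemma realization_exists:
  assumes "tiling P" "length P = length Q"
  shows "\<exists>f. list_all2 (carries f) P Q"
proof -
  define f where "f x = (SOME r. \<exists>i z. i < length P \<and> x = W (P ! i) z \<and> r = W (Q ! i) z)" for x
  have "f (W (P ! i) z) = W (Q ! i) z" if "i < length P" for i z
    unfolding f_def
    by (rule some_equality) (use that tiling_uniq[OF assms(1)] in blast)+
  then show ?thesis
    by (intro exI[of _ f]) (auto simp: list_all2_conv_all_nth assms carries_def)
qed

lemma realization_bij:
  assumes "tiling P" "tiling Q" "list_all2 (carries f) P Q"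
  shows "bij f"
proof -
  have len: "length P = length Q" using assms(3) by (simp add: list_all2_lengthD)
  have f: "f (W (P ! i) z) = W (Q ! i) z" if "i < length P" for i z
    using assms(3) that by (auto simp: list_all2_conv_all_nth carries_def)
  have "inj f"
  proof (rule injI)
    fix x x' assume e: "f x = f x'"
    obtain i z where i: "i < length P" "x = W (P ! i) z" using tiling_cover[OF assms(1)] .
    obtain j w where j: "j < length P" "x' = W (P ! j) w" using tiling_cover[OF assms(1)] .
    have "W (Q ! i) z = W (Q ! j) w" using e f i j by metis
    then show "x = x'" using tiling_uniq[OF assms(2)] i j len by metis
  qed
  moreover have "surj f"
  proof (unfold surj_def, rule allI)
    fix x obtain i z where "i < length Q" "x = W (Q ! i) z" using tiling_cover[OF assms(2)] .
    then show "\<exists>u. x = f u" using f len by metis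
  qed
  ultimately show ?thesis by (simp add: bij_def)
qed

lemma tiling_image:
  assumes "tiling P" "list_all2 (carries f) P Q" "bij f"
  shows "tiling Q"
proof -
  have len: "length P = length Q" using assms(2) by (simp add: list_all2_lengthD)
  have f: "f (W (P ! i) z) = W (Q ! i) z" if "i < length P" for i z
    using assms(2) that by (auto simp: list_all2_conv_all_nth carries_def)
  show ?thesis unfolding tiling_def
  proof (intro conjI allI)
    show "sorted_wrt disj Q" unfolding sorted_wrt_iff_nth_less
    proof (intro allI impI)
      fix i j assume ij: "i < j" "j < length Q"
      have "W (Q ! i) x \<noteq> W (Q ! j) z" for x z
      proof
        assume "W (Q ! i) x = W (Q ! j) z"
        then have "f (W (P ! i) x) = f (W (P ! j) z)" using f ij len by simp
        then have "W (P ! i) x = W (P ! j) z" using assms(3) by (simp add: bij_is_inj inj_eq)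
        then show False using tiling_uniq[OF assms(1)] ij len by (metis less_trans nat_neq_iff)
      qed
      then show "disj (Q ! i) (Q ! j)" unfolding disj_def by auto
    qed
    fix x
    obtain i z where i: "i < length P" "finv f x = W (P ! i) z" using tiling_cover[OF assms(1)] .
    then have "x = W (Q ! i) z" using f assms(3) by (metis bij_inv_eq_iff)
    then show "\<exists>w\<in>set Q. x \<in> range (W w)" using i len by (metis nth_mem rangeI)
  qed
qed

lemma tiling_leaf:
  assumes "tiling P" shows "\<exists>Q. leaf Q \<and> mset Q = mset P"
proof -
  have "\<exists>Q. leaf Q \<and> set Q = set P"
  proof (rule finite_code_leaf)
    show "length w \<le> Max (length ` set P)" if "w \<in> set P" for w using that by simp
    show "disj a b" if "a \<in> set P" "b \<in> set P" "a \<noteq> b" for a b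
      using assms that tiling_disj by blast
    show "\<exists>w\<in>set P. x \<in> range (W w)" for x using assms unfolding tiling_def by blast
  qed simp
  then show ?thesis using leaf_distinct tiling_distinct[OF assms]
    by (metis set_eq_iff_mset_eq_distinct)
qed

lemma word_transitive_list:
  assumes "a \<noteq> []" "b \<noteq> []"
  shows "\<exists>f P Q. cyc P \<and> cyc Q \<and> list_all2 (carries f) P Q \<and> carries f a b"
proof -
  obtain n A B where *: "cyc (a # A)" "cyc (b # B)" "length A = n" "length B = n"
    using cyc_contains[OF assms(1)] cyc_contains[OF assms(2)] by (metis nle_le)
  have "length (a # A) = length (b # B)" using * by simp
  then obtain f where f: "list_all2 (carries f) (a # A) (b # B)"
    using realization_exists[OF cyc_tiling[OF *(1)], of "b # B"] by blast
  then show ?thesis using *(1,2) by (intro exI[of _ f] exI[of _ "a # A"] exI[of _ "b # B"]) simp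
qed

end

section \<open>Rebracketing maps and the pentagon identity\<close>

text \<open>
  A generator of Thompson's group \<open>F\<close>: with \<open>C0\<close>, \<open>C1\<close> the halves of the piece \<open>C\<close>, it takes the
  list of pieces \<open>C0, C1, D\<close> to \<open>C, D0, D1\<close>. The parametrizations \<open>C\<close>, \<open>D\<close> and the halving \<open>s\<close> are
  arbitrary, because the map is used both for single cones and for families of cones, one
  at every scale.
\<close>

definition rebracket :: "(bool \<Rightarrow> 'z \<Rightarrow> 'z) \<Rightarrow> ('z \<Rightarrow> 'x) \<Rightarrow> ('z \<Rightarrow> 'x) \<Rightarrow> ('x \<Rightarrow> 'x) \<Rightarrow> bool" where
  "rebracket s C D a \<longleftrightarrow>
     (\<forall>z. a (C (s False z)) = C z \<and> a (C (s True z)) = D (s False z) \<and> a (D z) = D (s True z)) \<and>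
     (\<forall>x. x \<notin> range C \<longrightarrow> x \<notin> range D \<longrightarrow> a x = x)"

lemma rebracket_exists:
  assumes s: "\<And>a b x z. s a x = s b z \<Longrightarrow> a = b \<and> x = z"
    and C: "inj C" and D: "inj D" and CD: "range C \<inter> range D = {}"
  shows "\<exists>a. rebracket s C D a"
proof -
  define \<Phi> where "\<Phi> x r \<longleftrightarrow> (\<exists>z. x = C (s False z) \<and> r = C z) \<or>
    (\<exists>z. x = C (s True z) \<and> r = D (s False z)) \<or> (\<exists>z. x = D z \<and> r = D (s True z)) \<or>
    (x \<notin> range C \<and> x \<notin> range D \<and> r = x)" for x r
  define a where "a x = (SOME r. \<Phi> x r)" for x
  have cd: "C z \<noteq> D w" "D w \<noteq> C z" for z w using CD by auto
  have CC: "C z = C w \<longleftrightarrow> z = w" "D z = D w \<longleftrightarrow> z = w" for z w using C D by (auto simp: inj_eq)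
  have ss: "s t z = s t' w \<longleftrightarrow> t = t' \<and> z = w" for t t' z w using s by blast
  have uniq: "a x = r" if "\<Phi> x r" for x r
    unfolding a_def
  proof (rule some_equality[of "\<Phi> x", OF that])
    show "r' = r" if "\<Phi> x r'" for r'
      using \<open>\<Phi> x r\<close> that unfolding \<Phi>_def by (auto simp: cd CC ss)
  qed
  have "rebracket s C D a" unfolding rebracket_def
    by (intro conjI allI impI; rule uniq; unfold \<Phi>_def; blast)
  then show ?thesis by blast
qed

text \<open>
  Read from right to left, the inverse is again a rebracketing map, with the two pieces and the
  two halves exchanged.
\<close>

lemma rebracket_flip_inverse:
  assumes surj: "\<And>z. \<exists>t z'. z = s t z'"
    and a: "rebracket s C D a" and b: "rebracket (\<lambda>t. s (\<not> t)) D C b"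
  shows "b (a x) = x"
proof -
  have "b (a (C z)) = C z" for z
  proof -
    obtain t z' where "z = s t z'" using surj by blast
    then show ?thesis using a b unfolding rebracket_def by (cases t) auto
  qed
  moreover have "b (a (D z)) = D z" for z using a b unfolding rebracket_def by auto
  moreover have "b (a x) = x" if "x \<notin> range C" "x \<notin> range D" using a b that unfolding rebracket_def by auto
  ultimately show ?thesis by blast
qed

lemma rebracket_bij:
  assumes s: "\<And>a b x z. s a x = s b z \<Longrightarrow> a = b \<and> x = z" and surj: "\<And>z. \<exists>t z'. z = s t z'"
    and C: "inj C" and D: "inj D" and CD: "range C \<inter> range D = {}" and a: "rebracket s C D a"
  shows "bij a"
proof -
  obtain b where b: "rebracket (\<lambda>t. s (\<not> t)) D C b"
    using rebracket_exists[of "\<lambda>t. s (\<not> t)" D C] s D C CD by blast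
  have surj': "\<exists>t z'. z = s (\<not> t) z'" for z
  proof -
    obtain t z' where "z = s t z'" using surj by blast
    then show ?thesis by (intro exI[of _ "\<not> t"] exI[of _ z']) simp
  qed
  have "b (a x) = x" for x by (rule rebracket_flip_inverse[OF surj a b])
  moreover have "a (b x) = x" for x
    by (rule rebracket_flip_inverse[of "\<lambda>t. s (\<not> t)", OF _ b]) (use surj' a in auto)
  ultimately show ?thesis by (intro o_bij[of b]) auto
qed

text \<open>
  Both sides take the pieces \<open>B0, B1, C, D, E\<close> to \<open>B, C, D, E0, E1\<close>: these are the two ways around
  the pentagon of bracketings of a product of four factors. It suffices to compute both sides on
  each piece, after halving \<open>B\<close> and \<open>C\<close>.
\<close>

lemma rebracket_pentagon:
  assumes surj: "\<And>z. \<exists>t z'. z = s t z'"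
    and a: "rebracket s C D a" and u: "rebracket s B C u" and w: "rebracket s D E w"
    and dj: "range B \<inter> range C = {}" "range B \<inter> range D = {}" "range B \<inter> range E = {}"
      "range C \<inter> range D = {}" "range C \<inter> range E = {}" "range D \<inter> range E = {}"
  shows "a \<circ> w \<circ> u \<circ> a = w \<circ> a \<circ> u"
proof
  fix x
  have dj': "B z \<noteq> C z'" "B z \<noteq> D z'" "B z \<noteq> E z'" "C z \<noteq> D z'" "C z \<noteq> E z'" "D z \<noteq> E z'"
    "C z' \<noteq> B z" "D z' \<noteq> B z" "E z' \<noteq> B z" "D z' \<noteq> C z" "E z' \<noteq> C z" "E z' \<noteq> D z" for z z'
  proof -
    have *: "X z \<noteq> Y z' \<and> Y z' \<noteq> X z" if "range X \<inter> range Y = {}" for X Y :: "'a \<Rightarrow> 'b" and z z'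
      using that by (metis disjoint_iff rangeI)
    show "B z \<noteq> C z'" "B z \<noteq> D z'" "B z \<noteq> E z'" "C z \<noteq> D z'" "C z \<noteq> E z'" "D z \<noteq> E z'"
      "C z' \<noteq> B z" "D z' \<noteq> B z" "E z' \<noteq> B z" "D z' \<noteq> C z" "E z' \<noteq> C z" "E z' \<noteq> D z"
      using dj[THEN *] by blast+
  qed
  have A: "a (C (s False z)) = C z" "a (C (s True z)) = D (s False z)" "a (D z) = D (s True z)"
    "a (B z) = B z" "a (E z) = E z" for z
    using a dj' unfolding rebracket_def by (auto simp: image_iff)
  have U: "u (B (s False z)) = B z" "u (B (s True z)) = C (s False z)" "u (C z) = C (s True z)"
    "u (D z) = D z" "u (E z) = E z" for z
    using u dj' unfolding rebracket_def by (auto simp: image_iff)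
  have Wd: "w (D (s False z)) = D z" "w (D (s True z)) = E (s False z)" "w (E z) = E (s True z)"
    "w (B z) = B z" "w (C z) = C z" for z
    using w dj' unfolding rebracket_def by (auto simp: image_iff)
  have out: "a x = x \<and> u x = x \<and> w x = x"
    if "x \<notin> range B" "x \<notin> range C" "x \<notin> range D" "x \<notin> range E"
    using a u w that unfolding rebracket_def by auto
  consider z where "x = B z" | z where "x = C z" | z where "x = D z" | z where "x = E z"
    | "x \<notin> range B" "x \<notin> range C" "x \<notin> range D" "x \<notin> range E" by blast
  then show "(a \<circ> w \<circ> u \<circ> a) x = (w \<circ> a \<circ> u) x"
  proof cases
    case 1
    obtain t z' where "z = s t z'" using surj by blast
    with 1 show ?thesis by (cases t) (simp_all add: A U Wd)
  next
    case 2
    obtain t z' where "z = s t z'" using surj by blast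
    with 2 show ?thesis by (cases t) (simp_all add: A U Wd)
  qed (simp_all add: A U Wd out)
qed

section \<open>Connecting leaf lists by rebracketing moves\<close>

definition split_at :: "nat \<Rightarrow> bool list list \<Rightarrow> bool list list" where
  "split_at r P = take r P @ (P ! r @ [False]) # (P ! r @ [True]) # drop (Suc r) P"

lemma split_at_append: "split_at (length A) (A @ c # B) = A @ (c @ [False]) # (c @ [True]) # B"
  by (simp add: split_at_def)

lemma leaf_unsplit_at:
  assumes "leaf P" "2 \<le> length P"
  obtains r P0 where "leaf P0" "r < length P0" "P = split_at r P0" "length P = Suc (length P0)"
proof -
  obtain A c B where *: "P = A @ (c @ [False]) # (c @ [True]) # B" "leaf (A @ c # B)"
    using leaf_unsplit[OF assms] by blast
  show ?thesis
    by (rule that[of "A @ c # B" "length A"]) (use * in \<open>simp_all add: split_at_append\<close>)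
qed

lemma leaf_length_2:
  assumes "leaf P" "length P = 2" shows "P = [[False], [True]]"
proof -
  obtain r P0 where *: "leaf P0" "r < length P0" "P = split_at r P0" "length P = Suc (length P0)"
    using leaf_unsplit_at[OF assms(1)] assms(2) by (metis order_refl)
  have "P0 = [[]]" using leaf_length_1 * assms(2) by simp
  with * show ?thesis by (simp add: split_at_def)
qed

lemma leaf_length_3:
  assumes "leaf P" "length P = 3"
  shows "P = [[False, False], [False, True], [True]] \<or> P = [[False], [True, False], [True, True]]"
proof -
  obtain r P0 where *: "leaf P0" "r < length P0" "P = split_at r P0" "length P = Suc (length P0)"
    using leaf_unsplit_at[OF assms(1)] assms(2) by (metis numeral_le_iff semiring_norm(68,72,69) order_refl eval_nat_numeral(3) le_SucI)
  have "P0 = [[False], [True]]" using leaf_length_2 * assms(2) by simp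
  moreover from this have "r = 0 \<or> r = 1" using * by auto
  ultimately show ?thesis using * by (auto simp: split_at_def)
qed

text \<open>
  \<open>K\<close> is a group of maps, \<open>R k a b\<close> some notion of carrying the word \<open>a\<close> to \<open>b\<close>, and \<open>move\<close>
  provides the effect of a rebracketing map on any two neighbours of a cyclic leaf list with at
  least three entries. There are two instances: carrying cones, and carrying cones at all small
  scales near the base point simultaneously.
\<close>

locale word_moves =
  fixes K :: "('x \<Rightarrow> 'x) set" and R :: "('x \<Rightarrow> 'x) \<Rightarrow> bool list \<Rightarrow> bool list \<Rightarrow> bool"
  assumes K_id: "id \<in> K" and R_id: "R id a a"
    and K_comp: "k \<in> K \<Longrightarrow> l \<in> K \<Longrightarrow> l \<circ> k \<in> K"
    and R_comp: "k \<in> K \<Longrightarrow> l \<in> K \<Longrightarrow> R k a b \<Longrightarrow> R l b c \<Longrightarrow> R (l \<circ> k) a c"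
    and K_inv: "k \<in> K \<Longrightarrow> finv k \<in> K"
    and R_inv: "k \<in> K \<Longrightarrow> R k a b \<Longrightarrow> R (finv k) b a"
    and R_split: "R k a b \<Longrightarrow> R k (a @ [t]) (b @ [t])"
    and move: "cyc (c # d # B) \<Longrightarrow> B \<noteq> [] \<Longrightarrow> \<exists>k\<in>K. R k (c @ [False]) c \<and> R k (c @ [True]) (d @ [False]) \<and>
       R k d (d @ [True]) \<and> (\<forall>w\<in>set B. R k w w)"
begin

definition eqv :: "bool list list \<Rightarrow> bool list list \<Rightarrow> bool" where
  "eqv P Q \<longleftrightarrow> (\<exists>k\<in>K. list_all2 (R k) P Q)"

lemma eqv_refl: "eqv P P"
  unfolding eqv_def using K_id R_id by (auto simp: list_all2_same)

lemma eqv_sym: "eqv P Q \<Longrightarrow> eqv Q P"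
  unfolding eqv_def list_all2_conv_all_nth using K_inv R_inv by metis

lemma eqv_trans: "eqv P Q \<Longrightarrow> eqv Q T \<Longrightarrow> eqv P T"
  unfolding eqv_def list_all2_conv_all_nth using K_comp R_comp by metis

lemma eqv_split_at: "eqv P Q \<Longrightarrow> r < length P \<Longrightarrow> eqv (split_at r P) (split_at r Q)"
  unfolding eqv_def split_at_def
proof (elim bexE)
  fix k assume k: "k \<in> K" "list_all2 (R k) P Q" and r: "r < length P"
  show "\<exists>k\<in>K. list_all2 (R k) (take r P @ (P ! r @ [False]) # (P ! r @ [True]) # drop (Suc r) P)
     (take r Q @ (Q ! r @ [False]) # (Q ! r @ [True]) # drop (Suc r) Q)"
    by (rule bexI[OF _ k(1)])
      (simp add: list_all2_appendI list_all2_takeI list_all2_dropI R_split list_all2_nthD[OF k(2) r] k(2))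
qed

lemma eqv_rotate: "eqv P Q \<Longrightarrow> eqv (rotate s P) (rotate s Q)"
proof -
  have "list_all2 r P Q \<Longrightarrow> list_all2 r (rotate s P) (rotate s Q)" for r
    by (simp add: rotate_drop_take list_all2_appendI list_all2_takeI list_all2_dropI list_all2_lengthD)
  then show "eqv P Q \<Longrightarrow> ?thesis" unfolding eqv_def by blast
qed

text \<open>
  A rebracketing map moves the caret from one leaf to the next.
\<close>

lemma eqv_shift:
  assumes "leaf P" "3 \<le> length P" "Suc r < length P"
  shows "eqv (split_at r P) (split_at (Suc r) P)"
proof -
  define A c d B where "A = take r P" "c = P ! r" "d = P ! Suc r" "B = drop (Suc (Suc r)) P"
  have P: "P = A @ c # d # B"
    unfolding A_c_d_B_def using assms(3) by (metis Cons_nth_drop_Suc Suc_lessD append_take_drop_id)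
  have lA: "length A = r" unfolding A_c_d_B_def using assms by simp
  have "cyc (c # d # B @ A)" using cyc_swap[OF cyc_leaf[OF assms(1)[unfolded P]]] by simp
  moreover have "B @ A \<noteq> []" using assms(2) P by auto
  ultimately obtain k where k: "k \<in> K" "R k (c @ [False]) c" "R k (c @ [True]) (d @ [False])"
      "R k d (d @ [True])" "\<forall>w\<in>set (B @ A). R k w w"
    using move by blast
  have 1: "split_at r P = A @ (c @ [False]) # (c @ [True]) # d # B" unfolding P lA[symmetric] by (simp add: split_at_append)
  have 2: "split_at (Suc r) P = A @ c # (d @ [False]) # (d @ [True]) # B"
    using split_at_append[of "A @ [c]" d B] unfolding P lA[symmetric] by simp
  show ?thesis unfolding eqv_def 1 2
    by (rule bexI[OF _ k(1)]) (use k in \<open>auto intro!: list_all2_appendI simp: list_all2_same\<close>)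
qed

lemma eqv_split_at_any:
  assumes "leaf P" "3 \<le> length P" "r < length P" "q < length P"
  shows "eqv (split_at r P) (split_at q P)"
proof -
  have "r < length P \<Longrightarrow> eqv (split_at 0 P) (split_at r P)" for r
  proof (induction r)
    case (Suc r)
    then show ?case using eqv_shift[OF assms(1,2), of r] eqv_trans Suc_lessD by blast
  qed (rule eqv_refl)
  from eqv_trans[OF eqv_sym[OF this[OF assms(3)]] this[OF assms(4)]] show ?thesis .
qed

text \<open>
  The same from the last leaf to the first, which is where rotations come from.
\<close>

lemma eqv_wrap:
  assumes "leaf P" "3 \<le> length P"
  shows "eqv (split_at (length P - 1) P) (rotate1 (split_at 0 P))"
proof -
  obtain d B c where P: "P = d # B @ [c]" "B \<noteq> []"
    using assms(2) by (cases P; cases "tl P" rule: rev_cases) (auto simp: Suc_le_eq)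
  have "cyc (c # d # B)" using cyc_swap[of "d # B" "[c]"] cyc_leaf[OF assms(1)] P by simp
  then obtain k where k: "k \<in> K" "R k (c @ [False]) c" "R k (c @ [True]) (d @ [False])"
      "R k d (d @ [True])" "\<forall>w\<in>set B. R k w w"
    using move P(2) by blast
  have 1: "split_at (length P - 1) P = d # B @ [c @ [False], c @ [True]]"
    using split_at_append[of "d # B" c "[]"] P by simp
  have 2: "rotate1 (split_at 0 P) = (d @ [True]) # B @ [c, d @ [False]]"
    unfolding P by (simp add: split_at_def)
  show ?thesis unfolding eqv_def 1 2
    by (rule bexI[OF _ k(1)]) (use k in \<open>auto intro!: list_all2_appendI simp: list_all2_same\<close>)
qed

text \<open>
  By induction, removing a caret from each tree. The smaller trees are equivalent, and the
  position of the caret does not matter. The induction starts at four leaves: moves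
  need at least three entries, and the two trees with three leaves both become the complete tree
  of depth two when a suitable leaf is split.
\<close>

lemma eqv_leaf:
  "leaf P \<Longrightarrow> leaf Q \<Longrightarrow> length P = length Q \<Longrightarrow> 4 \<le> length P \<Longrightarrow> eqv P Q"
proof (induction "length P" arbitrary: P Q rule: less_induct)
  case less
  have l2: "2 \<le> length P" "2 \<le> length Q" using less(4,5) by auto
  obtain r P0 where P: "leaf P0" "r < length P0" "P = split_at r P0" "length P = Suc (length P0)"
    using leaf_unsplit_at[OF less(2)] l2 by blast
  obtain q Q0 where Q: "leaf Q0" "q < length Q0" "Q = split_at q Q0" "length Q = Suc (length Q0)"
    using leaf_unsplit_at[OF less(3)] l2(2) by blast
  have len: "length P0 = length Q0" "3 \<le> length P0" using P Q less by auto
  show ?case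
  proof (cases "eqv P0 Q0")
    case True
    then have "eqv (split_at r P0) (split_at r Q0)" using eqv_split_at P by blast
    moreover have "eqv (split_at r Q0) (split_at q Q0)" using eqv_split_at_any Q P len by simp
    ultimately show ?thesis using P Q eqv_trans by blast
  next
    case False
    have "\<not> 4 \<le> length P0" using less(1)[of P0 Q0] P Q len False by auto
    with len have l3: "length P0 = 3" "length Q0 = 3" by auto
    \<comment> \<open>Both trees with three leaves become the complete tree of depth two.\<close>
    define M where "M = [[False, False], [False, True], [True, False], [True, True]]"
    have *: "eqv (split_at r P0) M" if "leaf P0" "length P0 = 3" "r < length P0" for r P0
      using leaf_length_3[OF that(1,2)]
    proof
      assume e: "P0 = [[False, False], [False, True], [True]]"
      have "eqv (split_at r P0) (split_at 2 P0)" using eqv_split_at_any that by simp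
      then show ?thesis unfolding e M_def by (simp add: split_at_def numeral_2_eq_2)
    next
      assume e: "P0 = [[False], [True, False], [True, True]]"
      have "eqv (split_at r P0) (split_at 0 P0)" using eqv_split_at_any that by simp
      then show ?thesis unfolding e M_def by (simp add: split_at_def)
    qed
    show ?thesis using *[OF P(1) l3(1) P(2)] *[OF Q(1) l3(2) Q(2)] P Q eqv_sym eqv_trans by blast
  qed
qed

lemma eqv_rotate1:
  assumes "leaf P" "4 \<le> length P" shows "eqv P (rotate1 P)"
proof -
  have l2: "2 \<le> length P" using assms(2) by simp
  obtain r P0 where P: "leaf P0" "r < length P0" "P = split_at r P0" "length P = Suc (length P0)"
    using leaf_unsplit_at[OF assms(1) l2] by blast
  have l: "3 \<le> length P0" using P assms by simp
  have "eqv P (split_at (length P0 - 1) P0)" unfolding P(3) by (rule eqv_split_at_any) (use P l in auto)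
  moreover have "eqv (split_at (length P0 - 1) P0) (rotate1 (split_at 0 P0))" using eqv_wrap P l by blast
  moreover have "eqv (split_at 0 P0) P" unfolding P(3) by (rule eqv_split_at_any) (use P l in auto)
  then have "eqv (rotate1 (split_at 0 P0)) (rotate1 P)" using eqv_rotate[of _ _ 1] by simp
  ultimately show ?thesis using eqv_trans by blast
qed

lemma eqv_rotate_any:
  assumes "leaf P" "4 \<le> length P" shows "eqv P (rotate s P)"
proof (induction s)
  case (Suc s)
  have "eqv (rotate s P) (rotate s (rotate1 P))" by (rule eqv_rotate[OF eqv_rotate1[OF assms]])
  moreover have "rotate s (rotate1 P) = rotate (Suc s) P" by (simp add: rotate1_rotate_swap)
  ultimately show ?case using eqv_trans[OF Suc] by metis
qed (simp add: eqv_refl)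

text \<open>
  By \<open>eqv_wrap\<close> a leaf list is also connected with its rotations.
\<close>

theorem eqv_cyc:
  assumes "cyc P" "cyc Q" "length P = length Q" "4 \<le> length P" shows "eqv P Q"
proof -
  have *: "\<exists>P'. leaf P' \<and> length P' = length P \<and> eqv P' P" if "cyc P" "4 \<le> length P" for P
  proof -
    obtain A B where AB: "leaf (A @ B)" "P = B @ A" using cycE[OF \<open>cyc P\<close>] .
    have "P = rotate (length A) (A @ B)" unfolding AB(2) by (simp add: rotate_append)
    then show ?thesis using eqv_rotate_any[OF AB(1)] AB that by (intro exI[of _ "A @ B"]) auto
  qed
  obtain P' where P': "leaf P'" "length P' = length P" "eqv P' P" using * assms by blast
  have "4 \<le> length Q" using assms by simp
  then obtain Q' where Q': "leaf Q'" "length Q' = length Q" "eqv Q' Q" using * assms(2) by blast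
  have "eqv P' Q'" by (rule eqv_leaf[OF P'(1) Q'(1)]) (use P' Q' assms in simp_all)
  show ?thesis by (rule eqv_trans[OF eqv_sym[OF P'(3)] eqv_trans[OF \<open>eqv P' Q'\<close> Q'(3)]])
qed

end

section \<open>Compactness and cyclic order\<close>

text \<open>
  Koenig's lemma, for a property that passes to all extensions of a word.
\<close>

lemma koenig:
  assumes path: "\<And>x :: nat \<Rightarrow> bool. \<exists>k. good (map x [0..<k])"
    and mono: "\<And>w v. good w \<Longrightarrow> good (w @ v)"
  shows "\<exists>n. \<forall>w. n \<le> length w \<longrightarrow> good w"
proof (rule ccontr)
  define ok where "ok w \<longleftrightarrow> (\<exists>n. \<forall>v. n \<le> length v \<longrightarrow> good (w @ v))" for w :: "bool list"
  assume "\<nexists>n. \<forall>w. n \<le> length w \<longrightarrow> good w"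
  then have root: "\<not> ok []" unfolding ok_def by simp
  have step: "\<exists>t. \<not> ok (w @ [t])" if "\<not> ok w" for w
  proof (rule ccontr)
    assume "\<nexists>t. \<not> ok (w @ [t])"
    then obtain n where n: "\<And>t v. n t \<le> length v \<Longrightarrow> good (w @ [t] @ v)"
      unfolding ok_def by simp metis
    have "good (w @ v)" if v: "Suc (max (n True) (n False)) \<le> length v" for v
    proof -
      obtain t v' where "v = t # v'" using v by (cases v) auto
      moreover have "n t \<le> length v'" using v calculation by (cases t) auto
      ultimately show ?thesis using n[of t v'] by simp
    qed
    then show False using that unfolding ok_def by blast
  qed
  define nxt where "nxt w = w @ [SOME t. \<not> ok (w @ [t])]" for w
  define p where "p k = (nxt ^^ k) []" for k
  have bad: "\<not> ok (p k)" for k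
  proof (induction k)
    case (Suc k)
    then show ?case using someI_ex[OF step[OF Suc]] by (simp add: p_def nxt_def)
  qed (simp add: p_def root)
  define x where "x k = last (p (Suc k))" for k
  have "map x [0..<k] = p k" for k
    by (induction k) (simp_all add: x_def p_def nxt_def)
  moreover obtain k where "good (map x [0..<k])" using path by blast
  ultimately have "ok (p k)" unfolding ok_def using mono by auto
  with bad show False by blast
qed

text \<open>
  Adjacency on the circle: the last leaf of a tree is followed by the first one.
\<close>

definition cadj :: "bool list \<Rightarrow> bool list \<Rightarrow> bool" where
  "cadj a b \<longleftrightarrow> adj a b \<or> (\<exists>k l. a = replicate k True \<and> b = replicate l False)"

lemma cyc_cadj: assumes "cyc (a # b # M)" shows "cadj a b"
proof -
  obtain A B where AB: "leaf (A @ B)" "a # b # M = B @ A" using cycE[OF assms] .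
  show ?thesis
  proof (cases B)
    case Nil
    then show ?thesis using AB leaf_adjD[of "[]" a b M] by (simp add: cadj_def)
  next
    case (Cons a' B')
    show ?thesis
    proof (cases B')
      case Nil
      then have "leaf (b # M @ [a])" using AB Cons by (auto simp: append_eq_Cons_conv)
      from leaf_hd[OF this] leaf_last[OF this] show ?thesis by (auto simp: cadj_def)
    next
      case (Cons b' B'')
      then show ?thesis using AB \<open>B = a' # B'\<close> leaf_adjD[of A a b B''] by (simp add: cadj_def)
    qed
  qed
qed

lemma replicate_comparable: "(\<exists>v. replicate k t = replicate l t @ v) \<or> (\<exists>v. replicate l t = replicate k t @ v)"
  by (metis le_add_diff_inverse nle_le replicate_add)

lemma leaf_eq_of_comparable:
  assumes "leaf P" "a \<in> set P" "b \<in> set P" "(\<exists>v. a = b @ v) \<or> (\<exists>v. b = a @ v)"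
  shows "a = b"
  using assms leaf_antichain by (metis append_Nil2)

text \<open>
  In a leaf list every entry has only one leaf that can follow it, so an enumeration of the leaves
  in which each entry is followed by a neighbour is determined by its first entry. It is a rotation.
\<close>

lemma cyc_from_cadj:
  assumes Q': "leaf Q'" and m: "mset Q = mset Q'"
    and c: "\<And>r. Suc r < length Q \<Longrightarrow> cadj (Q ! r) (Q ! Suc r)"
  shows "cyc Q"
proof -
  define n where "n = length Q"
  have n: "length Q' = n" using m unfolding n_def by (metis mset_eq_length)
  have n0: "0 < n" using leaf_nonempty[OF Q'] n by auto
  have s: "set Q = set Q'" using m by (metis set_mset_mset)
  have "Q ! 0 \<in> set Q'" using n0 s unfolding n_def by (metis nth_mem)
  then obtain j where j: "j < n" "Q' ! j = Q ! 0" using n by (metis in_set_conv_nth)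
  have nx: "x = Q' ! (Suc t mod n)" if t: "t < n" and x: "x \<in> set Q'" and cx: "cadj (Q' ! t) x" for t x
  proof (cases "Suc t < n")
    case True
    have "Q' = take t Q' @ Q' ! t # Q' ! Suc t # drop (Suc (Suc t)) Q'"
      using True n by (metis Cons_nth_drop_Suc Suc_lessD append_take_drop_id)
    then have a: "adj (Q' ! t) (Q' ! Suc t)" using Q' leaf_adjD by metis
    then have "adj (Q' ! t) x" using cx adj_not_replicate_True unfolding cadj_def by metis
    with a have "x = Q' ! Suc t"
      using leaf_eq_of_comparable[OF Q' x, of "Q' ! Suc t"] adj_det True n by (metis nth_mem)
    then show ?thesis using True by simp
  next
    case False
    then have t': "t = n - 1" using t by simp
    then have "Q' ! t = last Q'" using n n0 by (metis last_conv_nth length_greater_0_conv)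
    then obtain k where "Q' ! t = replicate k True" using leaf_last[OF Q'] by metis
    then obtain l where "x = replicate l False" using cx adj_not_replicate_True unfolding cadj_def by metis
    moreover obtain l' where "Q' ! 0 = replicate l' False"
      using leaf_hd[OF Q'] n n0 by (metis hd_conv_nth length_greater_0_conv)
    ultimately have "x = Q' ! 0"
      using leaf_eq_of_comparable[OF Q' x, of "Q' ! 0"] replicate_comparable n n0 by (metis nth_mem)
    then show ?thesis using t' n0 by simp
  qed
  have "r < n \<Longrightarrow> Q ! r = Q' ! ((j + r) mod n)" for r
  proof (induction r)
    case (Suc r)
    have "Q ! r = Q' ! ((j + r) mod n)" using Suc by simp
    then have "cadj (Q' ! ((j + r) mod n)) (Q ! Suc r)" using c[of r] Suc(2) n_def by metis
    moreover have "Q ! Suc r \<in> set Q'" using Suc s n_def by (metis nth_mem)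
    ultimately show ?case using nx[of "(j + r) mod n" "Q ! Suc r"] n0 by (simp add: mod_Suc_eq)
  qed (use j in simp)
  then have "Q = rotate j Q'"
    by (intro nth_equalityI) (auto simp: nth_rotate n n_def)
  then show ?thesis using cyc_rotate[OF cyc_leaf[OF Q']] by simp
qed

lemma unif_refine:
  "leaf P \<Longrightarrow> (\<And>w. w \<in> set P \<Longrightarrow> length w \<le> n) \<Longrightarrow>
     concat (map (\<lambda>w. map ((@) w) (unif (n - length w))) P) = unif n"
proof (induction arbitrary: n rule: leaf.induct)
  case leaf_root
  then show ?case by (simp add: map_idI)
next
  case (leaf_node P Q)
  obtain m where n: "n = Suc m"
    using leaf_node(5)[of "False # hd P"] leaf_nonempty[OF leaf_node(1)] by (cases n) auto
  have e: "(@) (t # w) = (#) t \<circ> (@) w" for t :: bool and w by auto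
  have 1: "concat (map (\<lambda>w. map ((@) w) (unif (m - length w))) P) = unif m"
    by (rule leaf_node(3)) (use leaf_node(5)[of "False # _"] n in auto)
  have 2: "concat (map (\<lambda>w. map ((@) w) (unif (m - length w))) Q) = unif m"
    by (rule leaf_node(4)) (use leaf_node(5)[of "True # _"] n in auto)
  have 3: "concat (map (\<lambda>w. map ((@) w) (unif (n - length w))) (map ((#) t) P)) =
    map ((#) t) (concat (map (\<lambda>w. map ((@) w) (unif (m - length w))) P))" for t P
    by (simp add: map_concat comp_def n e)
  show ?case using 1 2 by (simp only: map_append concat_append 3) (simp add: n)
qed

context dyad
begin

lemma carries_refine:
  assumes "list_all2 (carries h) P Q" "\<And>a w. (a, w) \<in> set (zip P Q) \<Longrightarrow> F a = F' w"
  shows "list_all2 (carries h) (concat (map (\<lambda>w. map ((@) w) (F w)) P)) (concat (map (\<lambda>w. map ((@) w) (F' w)) Q))"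
  using assms
proof (induction rule: list_all2_induct)
  case (Cons a P b Q)
  have "list_all2 (carries h) (map ((@) a) L) (map ((@) b) L)" for L
    using Cons(1) by (auto simp: list_all2_conv_all_nth carries_append)
  moreover have "F a = F' b" using Cons(4) by simp
  ultimately have 1: "list_all2 (carries h) (map ((@) a) (F a)) (map ((@) b) (F' b))" by metis
  have "list_all2 (carries h) (concat (map (\<lambda>w. map ((@) w) (F w)) P)) (concat (map (\<lambda>w. map ((@) w) (F' w)) Q))"
    by (rule Cons(3)) (use Cons(4) in simp)
  with 1 show ?case by (simp add: list_all2_appendI)
qed simp

text \<open>
  The images of the cones of depth \<open>n\<close> form a partition and hence are the leaves of a tree. Consecutive
  ones are cyclically adjacent, so they are listed in cyclic order.
\<close>

lemma word_map_cyc: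
  assumes f: "bij f" and w: "\<And>w. length w = n \<Longrightarrow> \<exists>u. carries f w u"
    and c: "\<And>a b u v. cadj a b \<Longrightarrow> carries f a u \<Longrightarrow> carries f b v \<Longrightarrow> cadj u v"
  shows "\<exists>P Q. cyc P \<and> cyc Q \<and> list_all2 (carries f) P Q"
proof -
  obtain \<phi> where \<phi>: "\<And>w. length w = n \<Longrightarrow> carries f w (\<phi> w)" using w by metis
  define P Q where "P = unif n" "Q = map \<phi> (unif n)"
  have P: "leaf P" using leaf_unif P_Q_def by simp
  have a: "list_all2 (carries f) P Q"
  proof -
    have "length (unif n ! i) = n" if "i < length (unif n)" for i
      using nth_mem[OF that] set_unif by blast
    then show ?thesis unfolding P_Q_def by (simp add: list_all2_conv_all_nth \<phi>)
  qed
  have "tiling Q" using tiling_image[OF leaf_tiling[OF P] a f] .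
  then obtain Q' where Q': "leaf Q'" "mset Q' = mset Q" using tiling_leaf by blast
  have "cyc Q"
  proof (rule cyc_from_cadj[OF Q'(1) Q'(2)[symmetric]])
    fix r assume r: "Suc r < length Q"
    have len: "length P = length Q" using a by (simp add: list_all2_lengthD)
    have "adj (P ! r) (P ! Suc r)"
      using P leaf_successively_adj successively_conv_nth r len by metis
    moreover have "carries f (P ! r) (Q ! r)" "carries f (P ! Suc r) (Q ! Suc r)"
      using a r len by (auto simp: list_all2_conv_all_nth)
    ultimately show "cadj (Q ! r) (Q ! Suc r)" using c unfolding cadj_def by metis
  qed
  then show ?thesis using cyc_leaf[OF P] a by blast
qed

text \<open>
  The elements of Thompson's group \<open>F\<close>.
\<close>

definition F_like :: "('x \<Rightarrow> 'x) \<Rightarrow> bool" where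
  "F_like h \<longleftrightarrow> (\<exists>P Q. leaf P \<and> leaf Q \<and> list_all2 (carries h) P Q)"

lemma F_like_id: "F_like id"
  unfolding F_like_def by (intro exI[of _ "[[]]"]) (simp add: leaf_root carries_id)

lemma F_like_refine_target:
  assumes "leaf P" "leaf Q" "list_all2 (carries h) P Q" "\<And>w. leaf (F w)"
  shows "\<exists>P'. leaf P' \<and> list_all2 (carries h) P' (concat (map (\<lambda>w. map ((@) w) (F w)) Q))"
proof -
  define F' where "F' a = F (the (map_of (zip P Q) a))" for a
  have len: "length P = length Q" using assms(3) by (simp add: list_all2_lengthD)
  have "F' a = F w" if "(a, w) \<in> set (zip P Q)" for a w
    using that leaf_distinct[OF assms(1)] len unfolding F'_def by (simp add: map_of_eq_Some_iff)
  from carries_refine[of h P Q F' F, OF assms(3) this] leaf_refine[OF assms(1), of F'] show ?thesis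
    using assms(4) F'_def by auto
qed

lemma F_like_refine_source:
  assumes "leaf P" "leaf Q" "list_all2 (carries h) P Q" "\<And>w. leaf (F w)"
  shows "\<exists>Q'. leaf Q' \<and> list_all2 (carries h) (concat (map (\<lambda>w. map ((@) w) (F w)) P)) Q'"
proof -
  define F' where "F' a = F (the (map_of (zip Q P) a))" for a
  have len: "length P = length Q" using assms(3) by (simp add: list_all2_lengthD)
  have "F a = F' w" if "(a, w) \<in> set (zip P Q)" for a w
  proof -
    have "(w, a) \<in> set (zip Q P)" using that by (auto simp: in_set_zip)
    then show ?thesis using leaf_distinct[OF assms(2)] len unfolding F'_def by (simp add: map_of_eq_Some_iff)
  qed
  from carries_refine[of h P Q F F', OF assms(3) this] leaf_refine[OF assms(2), of F'] show ?thesis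
    using assms(4) F'_def by auto
qed

text \<open>
  Refine the target of the first map and the source of the second to the same complete tree.
\<close>

lemma F_like_comp:
  assumes "F_like f" "F_like g" shows "F_like (g \<circ> f)"
proof -
  obtain P Q where PQ: "leaf P" "leaf Q" "list_all2 (carries f) P Q" using assms unfolding F_like_def by blast
  obtain S T where ST: "leaf S" "leaf T" "list_all2 (carries g) S T" using assms unfolding F_like_def by blast
  define n where "n = Max (length ` set (Q @ S))"
  have n: "length w \<le> n" if "w \<in> set Q \<or> w \<in> set S" for w
    unfolding n_def using that by (intro Max_ge) auto
  obtain P' where P': "leaf P'" "list_all2 (carries f) P' (unif n)"
    using F_like_refine_target[OF PQ, of "\<lambda>w. unif (n - length w)"] unif_refine[OF PQ(2), of n] n leaf_unif by auto
  obtain T' where T': "leaf T'" "list_all2 (carries g) (unif n) T'"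
    using F_like_refine_source[OF ST, of "\<lambda>w. unif (n - length w)"] unif_refine[OF ST(1), of n] n leaf_unif by auto
  show ?thesis unfolding F_like_def using P' T' list_all2_carries_comp by blast
qed

lemma rebracket_fixes: "rebracket s (W c) (W d) a \<Longrightarrow> disj c w \<Longrightarrow> disj d w \<Longrightarrow> carries a w w"
  unfolding carries_def rebracket_def by (metis disjD imageE)

lemma rebracket_list:
  assumes "tiling (A @ c # d # B)" "rebracket y (W c) (W d) a"
  shows "list_all2 (carries a) (A @ (c @ [False]) # (c @ [True]) # d # B) (A @ c # (d @ [False]) # (d @ [True]) # B)"
proof -
  have "carries a w w" if "w \<in> set A \<or> w \<in> set B" for w
  proof -
    have "disj c w" "disj d w"
      using assms(1) that unfolding tiling_def by (auto simp: sorted_wrt_append intro: disj_sym)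
    then show ?thesis using rebracket_fixes assms(2) by blast
  qed
  then show ?thesis using assms(2)
    by (auto intro!: list_all2_appendI simp: list_all2_same carries_def rebracket_def)
qed

lemma rebracket_F_like:
  assumes "adj c d" "rebracket y (W c) (W d) a" shows "F_like a"
proof -
  obtain A B where AB: "leaf (A @ c # d # B)" using adj_leaf[OF assms(1)] by blast
  show ?thesis unfolding F_like_def
    using rebracket_list[OF leaf_tiling[OF AB] assms(2)] leaf_split[OF AB] leaf_split[of "A @ [c]" d B] AB
    by auto
qed

lemma rebracket_W_exists:
  assumes "disj c d" shows "\<exists>a. rebracket y (W c) (W d) a"
  by (rule rebracket_exists) (use assms in \<open>auto simp: disj_def inj_def\<close>)

section \<open>Rebracketing at all scales near a point\<close>

text \<open>
  The sequence of the pieces of address \<open>c\<close> inside the blocks at scales \<open>p\<close>, \<open>p + 1\<close>, ... is handled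
  as one piece parametrized by \<open>level_cone p c\<close>, with the halving \<open>level_split\<close>.
\<close>

definition level_split :: "bool \<Rightarrow> nat \<times> 'x \<Rightarrow> nat \<times> 'x" where "level_split t z = (fst z, y t (snd z))"
definition level_cone :: "nat \<Rightarrow> bool list \<Rightarrow> nat \<times> 'x \<Rightarrow> 'x" where "level_cone p c z = W (at_scale (p + fst z) c) (snd z)"

lemma level_split_inj: "level_split a x = level_split b z \<Longrightarrow> a = b \<and> x = z"
  by (cases x; cases z) (simp add: level_split_def)

lemma level_split_surj: "\<exists>t z'. z = level_split t z'"
  unfolding level_split_def using y_surj[of "snd z"] by (metis fst_conv snd_conv surjective_pairing)

lemma W_at_scale_eqD: "W (at_scale i a) x = W (at_scale j b) z \<Longrightarrow> i = j \<and> W a x = W b z"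
proof (induction i arbitrary: j)
  case 0
  then show ?case by (cases j) (auto simp: at_scale_def)
next
  case (Suc i)
  then show ?case by (cases j) (auto simp: at_scale_def)
qed

lemma disj_at_scale: "i \<noteq> j \<or> disj a b \<Longrightarrow> disj (at_scale i a) (at_scale j b)"
proof -
  assume h: "i \<noteq> j \<or> disj a b"
  have "W (at_scale i a) x \<noteq> W (at_scale j b) z" for x z
    using h disjD W_at_scale_eqD by blast
  then show ?thesis unfolding disj_def by auto
qed

lemma level_cone_inj: "inj (level_cone p c)"
proof (rule injI)
  fix u v :: "nat \<times> 'x" assume "level_cone p c u = level_cone p c v"
  then show "u = v" using W_at_scale_eqD[of "p + fst u" c "snd u" "p + fst v" c "snd v"] unfolding level_cone_def
    by (auto intro: prod_eqI)
qed

lemma level_cone_disjoint: "disj c d \<Longrightarrow> range (level_cone p c) \<inter> range (level_cone q d) = {}"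
  unfolding level_cone_def using disjD[OF disj_at_scale] by auto

lemma at_scale_append [simp]: "at_scale i a @ u = at_scale i (a @ u)"
  by (simp add: at_scale_def)

lemma at_scale_Suc: "at_scale (Suc i) a = False # at_scale i a"
  by (simp add: at_scale_def)

lemma W_at_scale_Suc: "W (at_scale (Suc i) a) x = y False (W (at_scale i a) x)"
  by (simp add: at_scale_def)

lemma at_scale_in_zeros: "m \<le> i \<Longrightarrow> W (at_scale i a) x \<in> range (W (replicate m False))"
  unfolding at_scale_def by (metis W_append le_add_diff_inverse rangeI replicate_add)

lemma zeros_antimono: "m \<le> n \<Longrightarrow> range (W (replicate n False)) \<subseteq> range (W (replicate m False))"
  by (metis W_append image_subset_iff le_add_diff_inverse rangeI replicate_add)

lemma at_scale_in_zeros_iff: "W (at_scale i a) x \<in> range (W (replicate m False)) \<longleftrightarrow> m \<le> i"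
proof
  assume "W (at_scale i a) x \<in> range (W (replicate m False))"
  then show "m \<le> i"
  proof (induction i arbitrary: m)
    case 0
    then show ?case by (cases m) (auto simp: at_scale_def)
  next
    case (Suc i)
    then show ?case by (cases m) (auto simp: W_at_scale_Suc image_iff)
  qed
qed (rule at_scale_in_zeros)

end

locale dyad_pt = dyad y for y :: "bool \<Rightarrow> 'x \<Rightarrow> 'x" +
  fixes pt :: 'x
  assumes pt_fix: "y False pt = pt"
    and pt_or: "z = pt \<or> (\<exists>i x. z = W (at_scale i []) x)"
begin

lemma W_zeros_pt: "W (replicate m False) pt = pt"
  by (induction m) (auto simp: pt_fix)

lemma W_at_scale_neq_pt: "W (at_scale i a) x \<noteq> pt"
proof
  assume "W (at_scale i a) x = pt"
  then have "W (at_scale i a) x \<in> range (W (replicate (Suc i) False))" by (metis W_zeros_pt rangeI)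
  then show False unfolding at_scale_in_zeros_iff by simp
qed

text \<open>
  A rebracketing map performed at once on \<open>0\<^sup>p\<^sup>+\<^sup>i1c\<close> and \<open>0\<^sup>q\<^sup>+\<^sup>i1d\<close> for all \<open>i\<close>. The scales \<open>p\<close> and \<open>q\<close> may
  differ by one, which occurs when \<open>c\<close> is the last and \<open>d\<close> the first leaf. The requirement
  \<open>1 \<le> p, q\<close> keeps the support inside the cone of \<open>0\<close>, that is, on the right side of the base
  point of the circle.
\<close>

definition spread :: "nat \<Rightarrow> nat \<Rightarrow> bool list \<Rightarrow> bool list \<Rightarrow> ('x \<Rightarrow> 'x) \<Rightarrow> bool" where
  "spread p q c d a \<longleftrightarrow> 1 \<le> p \<and> 1 \<le> q \<and> adj (at_scale p c) (at_scale q d) \<and> disj c d \<and> rebracket level_split (level_cone p c) (level_cone q d) a"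

lemma spread_vals:
  assumes "spread p q c d a"
  shows "a (W (at_scale (p + i) c) (y False x)) = W (at_scale (p + i) c) x"
    "a (W (at_scale (p + i) c) (y True x)) = W (at_scale (q + i) d) (y False x)"
    "a (W (at_scale (q + i) d) x) = W (at_scale (q + i) d) (y True x)"
proof -
  have *: "a (level_cone p c (level_split False z)) = level_cone p c z" "a (level_cone p c (level_split True z)) = level_cone q d (level_split False z)"
    "a (level_cone q d z) = level_cone q d (level_split True z)" for z
    using assms unfolding spread_def rebracket_def by blast+
  show "a (W (at_scale (p + i) c) (y False x)) = W (at_scale (p + i) c) x"
    "a (W (at_scale (p + i) c) (y True x)) = W (at_scale (q + i) d) (y False x)"
    "a (W (at_scale (q + i) d) x) = W (at_scale (q + i) d) (y True x)"
    using *[of "(i, x)"] unfolding level_split_def level_cone_def by simp_all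
qed

lemma spread_fix:
  assumes "spread p q c d a" "\<And>i. z \<notin> range (W (at_scale (p + i) c))" "\<And>i. z \<notin> range (W (at_scale (q + i) d))"
  shows "a z = z"
proof -
  have "z \<notin> range (level_cone p c)" "z \<notin> range (level_cone q d)" unfolding level_cone_def using assms(2,3) by blast+
  then show ?thesis using assms(1) unfolding spread_def rebracket_def by blast
qed

lemma spread_bij: "spread p q c d a \<Longrightarrow> bij a"
  unfolding spread_def
  by (rule rebracket_bij[of level_split "level_cone p c" "level_cone q d"]) (use level_split_inj level_split_surj level_cone_inj level_cone_disjoint in blast)+

lemma spread_exists:
  assumes "disj c d" shows "\<exists>a. rebracket level_split (level_cone p c) (level_cone q d) a"
  by (rule rebracket_exists) (use level_split_inj level_cone_inj level_cone_disjoint[OF assms] in blast)+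

lemma spread_pt: "spread p q c d a \<Longrightarrow> a pt = pt"
  using spread_fix[of p q c d a pt] W_at_scale_neq_pt by (metis imageE)

lemma spread_off: assumes "spread p q c d a" "z \<notin> range (W [False])" shows "a z = z"
proof (rule spread_fix[OF assms(1)])
  have *: "W (at_scale (Suc i) e) x \<in> range (W [False])" for i e x by (simp add: W_at_scale_Suc)
  obtain p' q' where "p = Suc p'" "q = Suc q'"
    using assms(1) unfolding spread_def by (metis Suc_le_D One_nat_def)
  then show "z \<notin> range (W (at_scale (p + i) c))" "z \<notin> range (W (at_scale (q + i) d))" for i
    using assms(2) * by (metis add_Suc imageE)+
qed

lemma spread_cases:
  assumes "spread p q c d a"
  obtains i x where "z = W (at_scale (p + i) c) (y False x)" | i x where "z = W (at_scale (p + i) c) (y True x)"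
    | i x where "z = W (at_scale (q + i) d) x"
    | "\<And>i. z \<notin> range (W (at_scale (p + i) c))" "\<And>i. z \<notin> range (W (at_scale (q + i) d))"
  using y_range by (metis imageE)

text \<open>
  The map does the same at every scale, from \<open>p\<close> and \<open>q\<close> on.
\<close>

lemma spread_commute:
  assumes h: "spread p q c d a" and z: "z \<in> range (W (replicate (p + q) False))"
  shows "a (y False z) = y False (a z)"
proof (cases rule: spread_cases[OF h, of z])
  case (1 i x)
  then show ?thesis using spread_vals(1)[OF h, of i x] spread_vals(1)[OF h, of "Suc i" x] by (simp add: W_at_scale_Suc)
next
  case (2 i x)
  then show ?thesis using spread_vals(2)[OF h, of i x] spread_vals(2)[OF h, of "Suc i" x] by (simp add: W_at_scale_Suc)
next
  case (3 i x)
  then show ?thesis using spread_vals(3)[OF h, of i x] spread_vals(3)[OF h, of "Suc i" x] by (simp add: W_at_scale_Suc)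
next
  case 4
  have *: "y False z \<notin> range (W (at_scale (k + i) e))"
    if k: "1 \<le> k" "k \<le> p + q" "\<And>i. z \<notin> range (W (at_scale (k + i) e))" for k i e
  proof
    assume "y False z \<in> range (W (at_scale (k + i) e))"
    then obtain x where x: "y False z = W (at_scale (k + i) e) x" by blast
    obtain l where l: "k + i = Suc l" using k(1) by (metis Suc_le_D One_nat_def add_Suc)
    then have zl: "z = W (at_scale l e) x" using x by (simp add: W_at_scale_Suc)
    then have "p + q \<le> l" using z at_scale_in_zeros_iff by blast
    then have "k \<le> l" using k by simp
    then show False using k(3)[of "l - k"] zl by simp
  qed
  have "a (y False z) = y False z"
    by (rule spread_fix[OF h]; rule *) (use h 4 in \<open>auto simp: spread_def\<close>)
  then show ?thesis using spread_fix[OF h 4] by simp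
qed

lemma spread_shrink:
  assumes h: "spread p q c d a" and z: "z \<in> range (W (replicate (M + p + q) False))"
  shows "a z \<in> range (W (replicate M False))"
proof (cases rule: spread_cases[OF h, of z])
  case (1 i x)
  then have "M + p + q \<le> p + i" using z at_scale_in_zeros_iff by blast
  then show ?thesis using 1 spread_vals[OF h] by (simp add: at_scale_in_zeros_iff)
next
  case (2 i x)
  then have "M + p + q \<le> p + i" using z at_scale_in_zeros_iff by blast
  then show ?thesis using 2 spread_vals[OF h] by (simp add: at_scale_in_zeros_iff)
next
  case (3 i x)
  then have "M + p + q \<le> q + i" using z at_scale_in_zeros_iff by blast
  then show ?thesis using 3 spread_vals[OF h] by (simp add: at_scale_in_zeros_iff)
next
  case 4
  then show ?thesis using spread_fix[OF h 4] z zeros_antimono[of M "M + p + q"] by auto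
qed

text \<open>
  Away from the base point only finitely many scales matter, and there the spread map is a finite
  product of ordinary rebracketing maps of neighbouring cones. So it is locally an element of
  \<open>F\<close>, and in particular its only possible singular point is the base point.
\<close>

lemma spread_approx:
  assumes h: "spread p q c d a"
  shows "\<exists>g. F_like g \<and> (\<forall>z. z \<notin> range (W (replicate M False)) \<longrightarrow> a z = g z)"
proof -
  \<comment> \<open>Removing the moves at scales \<open>\<ge> M\<close> leaves a product of \<open>M\<close> rebracketing maps.\<close>
  define S where "S M = {z. \<exists>i\<ge>M. z \<in> range (W (at_scale (p + i) c)) \<or> z \<in> range (W (at_scale (q + i) d))}" for M
  have cd: "disj c d" and ad: "adj (at_scale p c) (at_scale q d)" using h unfolding spread_def by auto
  have "\<exists>g. F_like g \<and> (\<forall>z. g z = (if z \<in> S M then z else a z))" for M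
  proof (induction M)
    case 0
    have "a z = z" if "z \<notin> S 0" for z
      by (rule spread_fix[OF h]) (use that in \<open>auto simp: S_def\<close>)
    then show ?case by (intro exI[of _ id] conjI F_like_id) auto
  next
    case (Suc M)
    then obtain g where g: "F_like g" "\<And>z. g z = (if z \<in> S M then z else a z)" by blast
    have zzz: "at_scale (k + M) e = replicate M False @ at_scale k e" for k e
      by (simp add: at_scale_def add.commute flip: replicate_add append_assoc)
    have "adj (at_scale (p + M) c) (at_scale (q + M) d)" using adj_append[OF ad] by (simp only: zzz)
    moreover have dM: "disj (at_scale (p + M) c) (at_scale (q + M) d)" using disj_at_scale cd by blast
    then obtain x where x: "rebracket y (W (at_scale (p + M) c)) (W (at_scale (q + M) d)) x" using rebracket_W_exists by blast
    ultimately have "F_like x" using rebracket_F_like by blast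
    then have "F_like (g \<circ> x)" using F_like_comp g(1) by blast
    moreover have "(g \<circ> x) z = (if z \<in> S (Suc M) then z else a z)" for z
    proof -
      have X: "x (W (at_scale (p + M) c) (y False u)) = W (at_scale (p + M) c) u"
        "x (W (at_scale (p + M) c) (y True u)) = W (at_scale (q + M) d) (y False u)"
        "x (W (at_scale (q + M) d) u) = W (at_scale (q + M) d) (y True u)" for u
        using x unfolding rebracket_def by auto
      have inS: "W (at_scale (p + M) c) u \<in> S M" "W (at_scale (q + M) d) u \<in> S M" for u unfolding S_def by auto
      have notS: "W (at_scale (p + M) c) u \<notin> S (Suc M)" "W (at_scale (q + M) d) u \<notin> S (Suc M)" for u
        unfolding S_def using disjD[OF disj_at_scale] disjD[OF disj_at_scale[OF disjI2[OF cd]]]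
          disjD[OF disj_at_scale[OF disjI2[OF disj_sym[OF cd]]]]
        by (auto simp: image_iff Suc_le_eq)
      consider u where "z = W (at_scale (p + M) c) (y False u)" | u where "z = W (at_scale (p + M) c) (y True u)"
        | u where "z = W (at_scale (q + M) d) u"
        | "z \<notin> range (W (at_scale (p + M) c))" "z \<notin> range (W (at_scale (q + M) d))"
        using y_range by (metis imageE)
      then show ?thesis
      proof cases
        case 4
        then have "x z = z" using x unfolding rebracket_def by blast
        moreover have "z \<in> S M \<longleftrightarrow> z \<in> S (Suc M)"
        proof
          assume "z \<in> S M"
          then obtain i where i: "M \<le> i" "z \<in> range (W (at_scale (p + i) c)) \<or> z \<in> range (W (at_scale (q + i) d))"
            unfolding S_def by blast
          moreover have "i \<noteq> M" using i 4 by blast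
          ultimately show "z \<in> S (Suc M)" unfolding S_def by (auto simp: Suc_le_eq intro!: exI[of _ i])
        next
          assume "z \<in> S (Suc M)"
          then show "z \<in> S M" unfolding S_def using Suc_leD by blast
        qed
        ultimately show ?thesis using g by simp
      qed (simp_all add: X g inS notS spread_vals[OF h])
    qed
    ultimately show ?case by blast
  qed
  then obtain g where g: "F_like g" "\<And>z. g z = (if z \<in> S M then z else a z)" by blast
  have "S M \<subseteq> range (W (replicate M False))"
    unfolding S_def using at_scale_in_zeros by auto
  then show ?thesis using g by (metis subsetD)
qed

end

section \<open>Normal subgroups contain small commutators\<close>

lemma bij_simps [simp]:
  assumes "bij f" shows "f (finv f x) = x" "finv f (f x) = x"
  using assms by (simp_all add: bij_is_surj surj_f_inv_f bij_is_inj inv_f_f)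

text \<open>
  What the proof uses of \<open>TA\<close> and \<open>VA\<close>. \<open>G0\<close> stands for the elements that fix the base point, are
  singular at most there, and are supported in the cone of \<open>0\<close>. The last four assumptions describe
  an element \<open>g\<close> fixing the base point, on the cones \<open>0\<^sup>m\<close>: on some block of arbitrarily small size
  it is a prefix replacement on all deep cones, it commutes with the shift \<open>x \<mapsto> 0x\<close>, it preserves
  adjacency of cones, and it is continuous at the base point along these cones. On the circle the
  last point includes that \<open>g\<close> does not exchange the two sides of the base point.
\<close>

locale dyad_group = dyad_pt y pt for y :: "bool \<Rightarrow> 'x \<Rightarrow> 'x" and pt :: 'x +
  fixes G G0 :: "('x \<Rightarrow> 'x) set"
  assumes G_bij: "f \<in> G \<Longrightarrow> bij f"
    and G_id: "id \<in> G"
    and G_comp: "f \<in> G \<Longrightarrow> g \<in> G \<Longrightarrow> f \<circ> g \<in> G"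
    and G_inv: "f \<in> G \<Longrightarrow> finv f \<in> G"
    and G0_sub: "G0 \<subseteq> G"
    and G0_id: "id \<in> G0"
    and G0_comp: "f \<in> G0 \<Longrightarrow> g \<in> G0 \<Longrightarrow> f \<circ> g \<in> G0"
    and G0_inv: "f \<in> G0 \<Longrightarrow> finv f \<in> G0"
    and G0_pt: "f \<in> G0 \<Longrightarrow> f pt = pt"
    and cycG: "cyc P \<Longrightarrow> cyc Q \<Longrightarrow> list_all2 (carries f) P Q \<Longrightarrow> f \<in> G"
    and displace: "f \<in> G \<Longrightarrow> f \<noteq> id \<Longrightarrow> \<exists>w. f ` range (W w) \<inter> range (W w) = {}"
    and spreadG: "spread p q c d a \<Longrightarrow> a \<in> G0"
    and G_scales: "g \<in> G \<Longrightarrow> g pt = pt \<Longrightarrow> \<exists>m\<ge>m0. \<exists>n. \<forall>w. n \<le> length w \<longrightarrow> (\<exists>u. carries g (at_scale m w) u)"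
    and G_commute: "g \<in> G \<Longrightarrow> g pt = pt \<Longrightarrow> \<exists>m. \<forall>z\<in>range (W (replicate m False)). g (y False z) = y False (g z)"
    and G_adj: "g \<in> G \<Longrightarrow> g pt = pt \<Longrightarrow> \<exists>m. \<forall>i j a b u v. m \<le> i \<longrightarrow> m \<le> j \<longrightarrow> adj (at_scale i a) (at_scale j b) \<longrightarrow>
       carries g (at_scale i a) u \<longrightarrow> carries g (at_scale j b) v \<longrightarrow> adj u v"
    and G_shrink: "g \<in> G \<Longrightarrow> g pt = pt \<Longrightarrow> \<exists>m. g ` range (W (replicate m False)) \<subseteq> range (W (replicate M False))"

locale normal_dyad_group = dyad_group y pt G G0 for y :: "bool \<Rightarrow> 'x \<Rightarrow> 'x" and pt G G0 +
  fixes N :: "('x \<Rightarrow> 'x) set"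
  assumes N_sub: "N \<subseteq> G"
    and N_id: "id \<in> N"
    and N_comp: "f \<in> N \<Longrightarrow> g \<in> N \<Longrightarrow> f \<circ> g \<in> N"
    and N_inv: "f \<in> N \<Longrightarrow> finv f \<in> N"
    and N_conj: "g \<in> G \<Longrightarrow> f \<in> N \<Longrightarrow> g \<circ> f \<circ> finv g \<in> N"
    and N_nontriv: "\<exists>f\<in>N. f \<noteq> id"

context dyad_group
begin

lemma word_transitive:
  assumes "a \<noteq> []" "b \<noteq> []" shows "\<exists>f\<in>G. carries f a b"
  using word_transitive_list[OF assms] cycG by blast

lemma squeeze:
  assumes "u \<noteq> []" "w \<noteq> []"
  shows "\<exists>\<phi>\<in>G. \<forall>x. x \<notin> range (W u) \<longrightarrow> \<phi> x \<in> range (W w)"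
proof -
  obtain f where f: "f \<in> G" "carries f u [True]" using word_transitive[OF assms(1)] by blast
  obtain g where g: "g \<in> G" "carries g [False] w" using word_transitive[OF _ assms(2)] by blast
  have "g (f x) \<in> range (W w)" if "x \<notin> range (W u)" for x
  proof -
    obtain z where "f x = y False z \<or> f x = y True z" using y_range by blast
    moreover have "f x \<noteq> y True z"
    proof
      assume "f x = y True z"
      then have "f x = f (W u z)" using f(2) by (simp add: carries_def)
      then have "x = W u z" using G_bij[OF f(1)] by (metis bij_simps(2))
      with that show False by blast
    qed
    ultimately show ?thesis using g(2) by (auto simp: carries_def)
  qed
  then show ?thesis using G_comp[OF g(1) f(1)] by (intro bexI[of _ "g \<circ> f"]) auto
qed

lemma rebracket_G: "cyc (c # d # B) \<Longrightarrow> rebracket y (W c) (W d) a \<Longrightarrow> a \<in> G"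
  using rebracket_list[of "[]" c d B a] cyc_tiling[of "c # d # B"] cyc_split[of "[]" c "d # B"]
    cyc_split[of "[c]" d B] cycG by simp

end

context normal_dyad_group
begin

text \<open>
  Put \<open>m = n g\<^sup>-\<^sup>1 n\<^sup>-\<^sup>1\<close>. It is supported in \<open>n D\<close>, which is disjoint from \<open>D\<close>, and so commutes with \<open>h\<close>.
  The element \<open>k = g m\<close> is in \<open>N\<close>, hence so is \<open>[k, h]\<close>, and this equals \<open>[g, h]\<close>.
\<close>

lemma double_commutator:
  assumes w: "n \<in> N" "n ` D \<inter> D = {}"
    and g: "g \<in> G" "\<And>x. x \<notin> D \<Longrightarrow> g x = x" and h: "h \<in> G" "\<And>x. x \<notin> D \<Longrightarrow> h x = x"
  shows "g \<circ> h \<circ> finv g \<circ> finv h \<in> N"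
proof -
  have b: "bij n" "bij g" "bij h" using G_bij w(1) g(1) h(1) N_sub by auto
  define k where "k = g \<circ> n \<circ> finv g \<circ> finv n"
  have k: "k \<in> N" unfolding k_def using N_comp N_conj N_inv w(1) g(1) by blast
  have bk: "bij k" using k N_sub G_bij by blast
  have "h \<circ> finv k \<circ> finv h \<in> N" using k N_conj N_inv h(1) by blast
  then have 1: "k \<circ> (h \<circ> finv k \<circ> finv h) \<in> N" using k N_comp by blast
  define m where "m = n \<circ> finv g \<circ> finv n"
  have bm: "bij m" unfolding m_def using b by (simp add: bij_comp bij_imp_bij_inv)
  have mD: "m x = x" if "x \<in> D" for x
  proof -
    have "finv n x \<notin> D" using w(2) that b(1) by (metis bij_simps(1) disjoint_iff image_eqI)
    then have "finv g (finv n x) = finv n x" using g(2) b(2) by (metis bij_simps(2))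
    then show ?thesis unfolding m_def using b by simp
  qed
  have mh: "m (h x) = h (m x)" for x
  proof (cases "x \<in> D")
    case True
    then have "h x \<in> D" using h(2) b(3) by (metis bij_simps(2))
    then show ?thesis using mD True by simp
  next
    case False
    then have "m x \<notin> D" using mD bm by (metis bij_simps(2))
    then show ?thesis using h(2) False by simp
  qed
  have km: "k = g \<circ> m" unfolding k_def m_def by (simp add: comp_assoc)
  have "(k \<circ> h) x = (g \<circ> h \<circ> finv g \<circ> k) x" for x
    unfolding km using mh b by simp
  then have "k \<circ> h = g \<circ> h \<circ> finv g \<circ> k" by blast
  then have "k \<circ> (h \<circ> finv k \<circ> finv h) = g \<circ> h \<circ> finv g \<circ> k \<circ> finv k \<circ> finv h"
    by (simp add: comp_assoc[symmetric])
  also have "\<dots> = g \<circ> h \<circ> finv g \<circ> finv h" using bk by (auto simp: fun_eq_iff)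
  finally show ?thesis using 1 by simp
qed

text \<open>
  Choose a cone displaced by an element of \<open>N\<close>, and conjugate so that the complement of the cone on
  which \<open>g\<close> and \<open>h\<close> are the identity moves into the displaced cone. Passing to a half of each cone
  makes both words nonempty, as \<open>squeeze\<close> requires.
\<close>

lemma small_commutator:
  assumes g: "g \<in> G" "carries g u u" and h: "h \<in> G" "carries h u u"
  shows "g \<circ> h \<circ> finv g \<circ> finv h \<in> N"
proof -
  obtain n where n: "n \<in> N" "n \<noteq> id" using N_nontriv by blast
  then obtain w where w: "n ` range (W w) \<inter> range (W w) = {}" using displace N_sub by blast
  define w' where "w' = w @ [False]"
  have w': "n ` range (W w') \<inter> range (W w') = {}" using w unfolding w'_def by (auto simp: disjoint_iff)
  define u' where "u' = u @ [False]"
  have u': "carries g u' u'" "carries h u' u'" using carries_append g(2) h(2) unfolding u'_def by auto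
  obtain \<phi> where \<phi>: "\<phi> \<in> G" "\<And>x. x \<notin> range (W u') \<Longrightarrow> \<phi> x \<in> range (W w')"
    using squeeze[of u' w'] unfolding u'_def w'_def by auto
  have b: "bij \<phi>" "bij g" "bij h" using G_bij \<phi>(1) g(1) h(1) by auto
  have cG: "\<phi> \<circ> f \<circ> finv \<phi> \<in> G" if "f \<in> G" for f using that \<phi>(1) G_comp G_inv by blast
  have cD: "(\<phi> \<circ> f \<circ> finv \<phi>) x = x" if "carries f u' u'" "x \<notin> range (W w')" for f x
  proof -
    have "finv \<phi> x \<in> range (W u')" using \<phi>(2)[of "finv \<phi> x"] that(2) b(1) by auto
    then have "f (finv \<phi> x) = finv \<phi> x" using that(1) by (auto simp: carries_def)
    then show ?thesis using b by simp
  qed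
  define g' h' where "g' = \<phi> \<circ> g \<circ> finv \<phi>" "h' = \<phi> \<circ> h \<circ> finv \<phi>"
  have "g' \<circ> h' \<circ> finv g' \<circ> finv h' \<in> N"
    by (rule double_commutator[OF n(1) w']) (use cG cD g h u' g'_h'_def in auto)
  then have 1: "finv \<phi> \<circ> (g' \<circ> h' \<circ> finv g' \<circ> finv h') \<circ> finv (finv \<phi>) \<in> N"
    using N_conj G_inv \<phi>(1) by blast
  have ig: "finv g' = \<phi> \<circ> finv g \<circ> finv \<phi>" "finv h' = \<phi> \<circ> finv h \<circ> finv \<phi>"
    unfolding g'_h'_def using b by (auto intro!: inv_equality)
  have "finv \<phi> \<circ> (g' \<circ> h' \<circ> finv g' \<circ> finv h') \<circ> finv (finv \<phi>) = g \<circ> h \<circ> finv g \<circ> finv h"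
    unfolding ig unfolding g'_h'_def using b by (auto simp: fun_eq_iff inv_inv_eq)
  with 1 show ?thesis by simp
qed

text \<open>
  The pentagon identity solved for \<open>a\<close> reads \<open>a = w [a, u] w\<^sup>-\<^sup>1\<close>.
\<close>

lemma pentagon_N:
  assumes surj: "\<And>z. \<exists>t z'. z = s t z'"
    and G: "a \<in> G" "u \<in> G" "w \<in> G"
    and a: "rebracket s C D a" and u: "rebracket s B C u" and w: "rebracket s D E w"
    and dj: "range B \<inter> range C = {}" "range B \<inter> range D = {}" "range B \<inter> range E = {}"
      "range C \<inter> range D = {}" "range C \<inter> range E = {}" "range D \<inter> range E = {}"
    and fx: "carries a f f" "carries u f f"
  shows "a \<in> N"
proof -
  have b: "bij a" "bij u" "bij w" using G G_bij by auto
  have p: "a \<circ> w \<circ> u \<circ> a = w \<circ> a \<circ> u" by (rule rebracket_pentagon[OF surj a u w dj])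
  have p': "a (w (u (a x))) = w (a (u x))" for x using fun_cong[OF p] by simp
  have "a \<circ> u \<circ> finv a \<circ> finv u \<in> N" using small_commutator G fx by blast
  then have 1: "w \<circ> (a \<circ> u \<circ> finv a \<circ> finv u) \<circ> finv w \<in> N" using N_conj G by blast
  have "w (a (u (finv a (finv u (finv w x))))) = a x" for x
    using p'[of "finv a (finv u (finv w x))"] b by simp
  then have "w \<circ> (a \<circ> u \<circ> finv a \<circ> finv u) \<circ> finv w = a" by auto
  with 1 show ?thesis by simp
qed

end

section \<open>Generators in a normal subgroup\<close>

text \<open>
  Room for the pentagon: after splitting an entry of \<open>B\<close> if necessary, \<open>c\<close> and \<open>d\<close> have a further neighbour
  on each side.
\<close>

lemma cyc_neighbours:
  assumes "cyc (c # d # B)" "B \<noteq> []"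
  obtains b e M where "cyc (b # c # d # e # M)"
proof (cases B rule: rev_cases)
  case Nil
  with assms show ?thesis by simp
next
  case (snoc M l)
  show ?thesis
  proof (cases M)
    case Nil
    have "cyc ([c, d] @ (l @ [False]) # (l @ [True]) # [])"
      by (rule cyc_split) (use assms snoc Nil in simp)
    then have "cyc ([c, d, l @ [False]] @ [l @ [True]])" by simp
    from cyc_swap[OF this] show ?thesis using that by auto
  next
    case (Cons h M')
    have "cyc ([c, d] @ (h @ [False]) # (h @ [True]) # (M' @ [l]))"
      by (rule cyc_split) (use assms snoc Cons in simp)
    then have "cyc ((c # d # (h @ [False]) # (h @ [True]) # M') @ [l])" by simp
    from cyc_swap[OF this] show ?thesis using that by auto
  qed
qed

lemma adj_at_scale_same: "adj a b \<Longrightarrow> adj (at_scale p a) (at_scale p b)"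
  unfolding at_scale_def by (intro adj_append adj_Cons)

lemma adj_at_scale_wrap: "adj (at_scale (Suc p) (replicate k True)) (at_scale p (replicate l False))"
  unfolding at_scale_def adj_def
  by (rule exI[of _ "replicate p False"], rule exI[of _ "Suc k"], rule exI[of _ l])
     (simp add: replicate_app_Cons_same)

lemma cadj_at_scale:
  "cadj a b \<Longrightarrow> (\<forall>p. adj (at_scale p a) (at_scale p b)) \<or> (\<forall>p. adj (at_scale (Suc p) a) (at_scale p b))"
  unfolding cadj_def using adj_at_scale_same adj_at_scale_wrap by blast

context dyad
begin

text \<open>
  Commuting with the shift propagates the action on one block to all smaller ones.
\<close>

lemma carries_Suc_at_scale:
  assumes "\<And>z. z \<in> range (W (replicate m False)) \<Longrightarrow> g (y False z) = y False (g z)"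
    and "carries g (at_scale m w) (at_scale j v)"
  shows "carries g (at_scale (m + i) w) (at_scale (j + i) v)"
proof (induction i)
  case (Suc i)
  show ?case unfolding carries_def
  proof
    fix x
    have "W (at_scale (m + i) w) x \<in> range (W (replicate m False))" by (rule at_scale_in_zeros) simp
    then show "g (W (at_scale (m + Suc i) w) x) = W (at_scale (j + Suc i) v) x"
      using assms(1) Suc by (simp add: W_at_scale_Suc carries_def)
  qed
qed (use assms(2) in simp)

text \<open>
  Carrying the piece \<open>a\<close> to the piece \<open>b\<close> in all sufficiently small blocks, with a constant
  change of scale.
\<close>

definition carries_end :: "('x \<Rightarrow> 'x) \<Rightarrow> bool list \<Rightarrow> bool list \<Rightarrow> bool" where
  "carries_end f a b \<longleftrightarrow> (\<exists>p q. \<forall>i. carries f (at_scale (p + i) a) (at_scale (q + i) b))"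

lemma carries_end_comp:
  assumes "carries_end f a b" "carries_end g b c" shows "carries_end (g \<circ> f) a c"
proof -
  obtain p q where 1: "\<And>i. carries f (at_scale (p + i) a) (at_scale (q + i) b)" using assms(1) unfolding carries_end_def by blast
  obtain p' q' where 2: "\<And>i. carries g (at_scale (p' + i) b) (at_scale (q' + i) c)" using assms(2) unfolding carries_end_def by blast
  have "carries (g \<circ> f) (at_scale (p + p' + i) a) (at_scale (q' + q + i) c)" for i
    using carries_comp[OF 1[of "p' + i"]] 2[of "q + i"] by (simp add: algebra_simps)
  then show ?thesis unfolding carries_end_def by blast
qed

lemma carries_end_inv: "bij f \<Longrightarrow> carries_end f a b \<Longrightarrow> carries_end (finv f) b a"
  unfolding carries_end_def using carries_inv by blast

lemma carries_end_append: "carries_end f a b \<Longrightarrow> carries_end f (a @ u) (b @ u)"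
  unfolding carries_end_def using carries_append by (metis at_scale_append)

lemma carries_cover_eq:
  assumes "tiling P" "list_all2 (carries f) P Q" "list_all2 (carries g) P Q" shows "f = g"
proof
  fix x obtain i z where i: "i < length P" "x = W (P ! i) z" using tiling_cover[OF assms(1)] .
  then show "f x = g x" using assms(2,3) by (auto simp: list_all2_conv_all_nth carries_def)
qed

end

context normal_dyad_group
begin

text \<open>
  The commutator in the pentagon identity is small because the maps at \<open>c, d\<close> and at \<open>b, c\<close> both
  fix the cone of \<open>e\<close>.
\<close>

lemma rebracket_N:
  assumes "cyc (c # d # B)" "B \<noteq> []" and a: "rebracket y (W c) (W d) a"
  shows "a \<in> N"
proof -
  obtain b e M where bM: "cyc (b # c # d # e # M)" using cyc_neighbours[OF assms(1,2)] .
  have dj: "disj b c" "disj b d" "disj b e" "disj c d" "disj c e" "disj d e"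
    using cyc_tiling[OF bM] unfolding tiling_def by auto
  obtain u where u: "rebracket y (W b) (W c) u" using rebracket_W_exists dj by blast
  obtain w where w: "rebracket y (W d) (W e) w" using rebracket_W_exists dj by blast
  have cde: "cyc (d # e # M @ [b, c])" using cyc_swap[of "[b, c]" "d # e # M"] bM by simp
  have "a \<in> G" by (rule rebracket_G[OF assms(1) a])
  moreover have "u \<in> G" by (rule rebracket_G[OF bM u])
  moreover have "w \<in> G" by (rule rebracket_G[OF cde w])
  ultimately show ?thesis
    by (rule pentagon_N[OF y_surj _ _ _ a u w, where f = e])
      (use dj rebracket_fixes[OF a] rebracket_fixes[OF u] in \<open>auto simp: disj_def\<close>)
qed

text \<open>
  The pentagon argument again, with families of pieces in place of cones. The common fixed cone
  is \<open>1e\<close>, the piece \<open>e\<close> of the block at scale \<open>0\<close>, which the spread maps leave alone.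
\<close>

lemma spread_N:
  assumes "cyc (c # d # B)" "B \<noteq> []"
  shows "\<exists>p q a. spread p q c d a \<and> a \<in> N"
proof -
  obtain b e M where bM: "cyc (b # c # d # e # M)" using cyc_neighbours[OF assms] .
  have dj: "disj b c" "disj b d" "disj b e" "disj c d" "disj c e" "disj d e"
    using cyc_tiling[OF bM] unfolding tiling_def by auto
  have "cyc (d # e # M @ [b, c])" using cyc_swap[of "[b, c]" "d # e # M"] bM by simp
  then have "cadj d e" by (rule cyc_cadj)
  then obtain q r where qr: "adj (at_scale q d) (at_scale r e)" "1 \<le> q" "1 \<le> r"
    using cadj_at_scale[of d e] by (metis le_refl le_SucI)
  have "cadj c d" by (rule cyc_cadj[OF assms(1)])
  then obtain p where p: "adj (at_scale p c) (at_scale q d)" "1 \<le> p" using cadj_at_scale[of c d] qr(2) by (metis le_SucI)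
  have "cadj b c" by (rule cyc_cadj[OF bM])
  then obtain o' where o: "adj (at_scale o' b) (at_scale p c)" "1 \<le> o'" using cadj_at_scale[of b c] p(2) by (metis le_SucI)
  obtain a where a: "rebracket level_split (level_cone p c) (level_cone q d) a" using spread_exists[OF dj(4)] by blast
  obtain u where u: "rebracket level_split (level_cone o' b) (level_cone p c) u" using spread_exists[OF dj(1)] by blast
  obtain w where w: "rebracket level_split (level_cone q d) (level_cone r e) w" using spread_exists[OF dj(6)] by blast
  have ha: "spread p q c d a" and hu: "spread o' p b c u" and hw: "spread q r d e w"
    unfolding spread_def using a u w p o qr dj by auto
  have fx: "carries a (at_scale 0 e) (at_scale 0 e)" "carries u (at_scale 0 e) (at_scale 0 e)"
    unfolding carries_def
    by (auto intro!: spread_fix[OF ha] spread_fix[OF hu])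
      (use disjD[OF disj_at_scale[OF disjI2]] dj disj_sym in metis)+
  have "a \<in> N"
    by (rule pentagon_N[OF level_split_surj _ _ _ a u w _ _ _ _ _ _ fx])
      (use spreadG[OF ha] spreadG[OF hu] spreadG[OF hw] G0_sub level_cone_disjoint dj in auto)
  then show ?thesis using ha by blast
qed

interpretation plain: word_moves N carries
proof
  show "id \<in> N" by (rule N_id)
  show "carries id a a" for a by (rule carries_id)
  show "l \<circ> k \<in> N" if "k \<in> N" "l \<in> N" for k l using that N_comp by blast
  show "carries (l \<circ> k) a c" if "carries k a b" "carries l b c" for k l a b c using that carries_comp by blast
  show "finv k \<in> N" if "k \<in> N" for k using that N_inv by blast
  show "carries (finv k) b a" if "k \<in> N" "carries k a b" for k a b using that carries_inv G_bij N_sub by blast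
  show "carries k (a @ [t]) (b @ [t])" if "carries k a b" for k a b t using that by (rule carries_append)
  show "\<exists>k\<in>N. carries k (c @ [False]) c \<and> carries k (c @ [True]) (d @ [False]) \<and> carries k d (d @ [True]) \<and> (\<forall>w\<in>set B. carries k w w)"
    if "cyc (c # d # B)" "B \<noteq> []" for c d B
  proof -
    have t: "tiling (c # d # B)" by (rule cyc_tiling[OF that(1)])
    then have "disj c d" unfolding tiling_def by simp
    then obtain a where a: "rebracket y (W c) (W d) a" using rebracket_W_exists by blast
    have "a \<in> N" by (rule rebracket_N[OF that a])
    moreover have "list_all2 (carries a) ((c @ [False]) # (c @ [True]) # d # B) (c # (d @ [False]) # (d @ [True]) # B)"
      using rebracket_list[of "[]" c d B a] t a by simp
    ultimately show ?thesis by (intro bexI[of _ a]) (auto simp: list_all2_same)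
  qed
qed

lemma cyc_N_aux:
  assumes "cyc P" "cyc Q" "list_all2 (carries f) P Q" "4 \<le> length P" shows "f \<in> N"
proof -
  have "plain.eqv P Q" using plain.eqv_cyc assms list_all2_lengthD by blast
  then obtain k where "k \<in> N" "list_all2 (carries k) P Q" unfolding plain.eqv_def by blast
  then show ?thesis using carries_cover_eq[OF cyc_tiling[OF assms(1)] assms(3)] by simp
qed

text \<open>
  Moves by elements of \<open>N\<close> have the same effect as \<open>f\<close> on the list \<open>P\<close>. Splitting every cone twice
  provides the four entries needed by \<open>eqv_cyc\<close>.
\<close>

theorem cyc_N:
  assumes "cyc P" "cyc Q" "list_all2 (carries f) P Q" shows "f \<in> N"
proof -
  define E where "E P = concat (map (\<lambda>w. map ((@) w) (unif 2)) P)" for P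
  have "cyc (E P)" "cyc (E Q)" unfolding E_def using cyc_refine leaf_unif assms by auto
  moreover have "list_all2 (carries f) (E P) (E Q)" unfolding E_def by (rule carries_refine[OF assms(3)]) simp
  moreover have "4 \<le> length (E P)"
    using cyc_nonempty[OF assms(1)] unfolding E_def by (cases P) (auto simp: length_concat numeral_2_eq_2)
  ultimately show ?thesis by (rule cyc_N_aux)
qed

interpretation ends: word_moves "N \<inter> G0" carries_end
proof
  show "id \<in> N \<inter> G0" using N_id G0_id by blast
  show "carries_end id a a" for a unfolding carries_end_def using carries_id by blast
  show "l \<circ> k \<in> N \<inter> G0" if "k \<in> N \<inter> G0" "l \<in> N \<inter> G0" for k l using that N_comp G0_comp by blast
  show "carries_end (l \<circ> k) a c" if "carries_end k a b" "carries_end l b c" for k l a b c using that carries_end_comp by blast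
  show "finv k \<in> N \<inter> G0" if "k \<in> N \<inter> G0" for k using that N_inv G0_inv by blast
  show "carries_end (finv k) b a" if "k \<in> N \<inter> G0" "carries_end k a b" for k a b using that carries_end_inv G_bij N_sub by blast
  show "carries_end k (a @ [t]) (b @ [t])" if "carries_end k a b" for k a b t using that by (rule carries_end_append)
  show "\<exists>k\<in>N \<inter> G0. carries_end k (c @ [False]) c \<and> carries_end k (c @ [True]) (d @ [False]) \<and> carries_end k d (d @ [True]) \<and> (\<forall>w\<in>set B. carries_end k w w)"
    if "cyc (c # d # B)" "B \<noteq> []" for c d B
  proof -
    have "\<exists>p q a. spread p q c d a \<and> a \<in> N" by (rule spread_N[OF that])
    then obtain p q a where a: "spread p q c d a" "a \<in> N" by blast
    have e: "W (at_scale i (w @ [t])) x = W (at_scale i w) (y t x)" for i w t x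
      by (metis W.simps W_append at_scale_append)
    have "carries_end a (c @ [False]) c" "carries_end a (c @ [True]) (d @ [False])" "carries_end a d (d @ [True])"
      unfolding carries_end_def carries_def e using spread_vals[OF a(1)] by blast+
    moreover have "carries_end a w w" if "w \<in> set B" for w
    proof -
      have "disj c w" "disj d w" using cyc_tiling[OF \<open>cyc (c # d # B)\<close>] that unfolding tiling_def by auto
      then have "a (W (at_scale i w) x) = W (at_scale i w) x" for i x
        by (intro spread_fix[OF a(1)]) (use disjD[OF disj_at_scale[OF disjI2]] disj_sym in blast)+
      then show ?thesis unfolding carries_end_def carries_def by blast
    qed
    ultimately show ?thesis using a spreadG by blast
  qed
qed

lemma word_at_scale_cases: "(\<exists>k. u = replicate k False) \<or> (\<exists>j v. u = at_scale j v)"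
proof (induction u)
  case (Cons t u)
  show ?case
  proof (cases t)
    case True
    then show ?thesis by (intro disjI2 exI[of _ 0] exI[of _ u]) (simp add: at_scale_def)
  next
    case False
    with Cons show ?thesis by (metis replicate_Suc at_scale_Suc)
  qed
qed (auto intro!: exI[of _ 0])

text \<open>
  Take a small block on which \<open>g\<close> acts by prefix replacement, and let \<open>P\<close> be the leaves of a complete
  tree subdividing it. The images of these pieces, with the scale forgotten, form a cyclic leaf
  list \<open>Q\<close>: they tile one period of the action of the shift, and consecutive pieces stay
  neighbours. Some product \<open>k\<close> of spread maps also takes \<open>P\<close> to \<open>Q\<close> in all small blocks.
  So \<open>k\<^sup>-\<^sup>1 g\<close> only changes the scale of each piece of \<open>P\<close>, and since neighbours stay neighbours the change
  is the same for all pieces.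
\<close>

theorem end_reduction:
  assumes g: "g \<in> G" "g pt = pt"
  shows "\<exists>n\<in>N \<inter> G0. \<exists>p q. \<forall>i. carries (n \<circ> g) (at_scale (p + i) []) (at_scale (q + i) [])"
proof -
  have bg: "bij g" using g G_bij by blast
  obtain m2 where m2: "\<And>z. z \<in> range (W (replicate m2 False)) \<Longrightarrow> g (y False z) = y False (g z)"
    using G_commute[OF g] by blast
  obtain m3 where m3: "\<And>i j a b u v. m3 \<le> i \<Longrightarrow> m3 \<le> j \<Longrightarrow> adj (at_scale i a) (at_scale j b) \<Longrightarrow>
      carries g (at_scale i a) u \<Longrightarrow> carries g (at_scale j b) v \<Longrightarrow> adj u v"
    using G_adj[OF g] by blast
  obtain m n0 where m: "max m2 m3 \<le> m" "\<And>w. n0 \<le> length w \<Longrightarrow> \<exists>u. carries g (at_scale m w) u"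
    using G_scales[OF g] by blast
  have gm: "g (y False z) = y False (g z)" if "z \<in> range (W (replicate m False))" for z
    using m2 that zeros_antimono[of m2 m] m(1) by auto
  \<comment> \<open>Depth at least \<open>2\<close>, since \<open>ends.eqv_cyc\<close> needs four entries.\<close>
  define P where "P = unif (max n0 2)"
  have P: "leaf P" unfolding P_def by (rule leaf_unif)
  have lenP: "4 \<le> length P"
    unfolding P_def length_unif using power_increasing[of 2 "max n0 2" "2::nat"] by simp
  have "\<exists>j v. carries g (at_scale m w) (at_scale j v)" if "w \<in> set P" for w
  proof -
    have "n0 \<le> length w" using that unfolding P_def set_unif by simp
    then obtain u where u: "carries g (at_scale m w) u" using m(2) by blast
    have "u \<noteq> replicate k False" for k
    proof
      assume "u = replicate k False"
      then have "g (W (at_scale m w) pt) = g pt" using u g(2) by (simp add: carries_def W_zeros_pt)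
      then show False using W_at_scale_neq_pt bg by (metis bij_simps(2))
    qed
    then show ?thesis using word_at_scale_cases u by metis
  qed
  then obtain J \<phi> where J: "\<And>w. w \<in> set P \<Longrightarrow> carries g (at_scale m w) (at_scale (J w) (\<phi> w))" by metis
  have J': "carries g (at_scale (m + i) w) (at_scale (J w + i) (\<phi> w))" if "w \<in> set P" for w i
    by (rule carries_Suc_at_scale[OF gm J[OF that]])
  define Q where "Q = map \<phi> P"
  have "tiling Q" unfolding tiling_def
  proof (intro conjI allI)
    show "sorted_wrt disj Q" unfolding sorted_wrt_iff_nth_less
    proof (intro allI impI)
      fix r s assume rs: "r < s" "s < length Q"
      then have in': "P ! r \<in> set P" "P ! s \<in> set P" and ne: "disj (P ! r) (P ! s)"
        using leaf_tiling[OF P] tiling_disj_nth[of P r s] unfolding Q_def by auto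
      have "W (\<phi> (P ! r)) x \<noteq> W (\<phi> (P ! s)) z" for x z
      proof
        assume "W (\<phi> (P ! r)) x = W (\<phi> (P ! s)) z"
        then have "W (at_scale (J (P ! r) + J (P ! s)) (\<phi> (P ! r))) x = W (at_scale (J (P ! s) + J (P ! r)) (\<phi> (P ! s))) z"
          by (simp add: at_scale_def add.commute)
        then have "g (W (at_scale (m + J (P ! s)) (P ! r)) x) = g (W (at_scale (m + J (P ! r)) (P ! s)) z)"
          using J'[OF in'(1), of "J (P ! s)"] J'[OF in'(2), of "J (P ! r)"] by (simp add: carries_def)
        then have "W (at_scale (m + J (P ! s)) (P ! r)) x = W (at_scale (m + J (P ! r)) (P ! s)) z"
          using bg by (metis bij_simps(2))
        then show False using disjD[OF disj_at_scale] ne by blast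
      qed
      then show "disj (Q ! r) (Q ! s)" using rs unfolding Q_def disj_def by auto
    qed
    fix x
    have "finv g pt = pt" using g(2) bg by (metis bij_simps(2))
    then obtain j where j: "finv g ` range (W (replicate j False)) \<subseteq> range (W (replicate m False))"
      using G_shrink[of "finv g" m] G_inv g(1) by blast
    \<comment> \<open>To see that \<open>Q\<close> covers \<open>x\<close>, pull \<open>x\<close> back from a block so small that its preimage is in the range
      where \<open>g\<close> commutes with the shift.\<close>
    define z where "z = W (at_scale j []) x"
    have "finv g z \<in> range (W (replicate m False))" using j at_scale_in_zeros[of j j] unfolding z_def by blast
    moreover have "finv g z \<noteq> pt"
    proof
      assume "finv g z = pt"
      then have "z = pt" using g(2) bg by (metis bij_simps(1))
      then show False using W_at_scale_neq_pt unfolding z_def by blast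
    qed
    ultimately obtain i x' where x': "finv g z = W (at_scale i []) x'" "m \<le> i" using pt_or at_scale_in_zeros_iff by metis
    obtain r x'' where r: "r < length P" "x' = W (P ! r) x''" using tiling_cover[OF leaf_tiling[OF P]] .
    have "z = g (W (at_scale (m + (i - m)) (P ! r)) x'')"
      using x' r bg by (metis W_append append_Nil bij_simps(1) le_add_diff_inverse at_scale_append)
    also have "\<dots> = W (at_scale (J (P ! r) + (i - m)) (\<phi> (P ! r))) x''" using J' r unfolding carries_def by simp
    finally have "x = W (\<phi> (P ! r)) x''" unfolding z_def using W_at_scale_eqD by (metis W.simps(1))
    then show "\<exists>w\<in>set Q. x \<in> range (W w)" using r unfolding Q_def by (intro bexI[of _ "\<phi> (P ! r)"]) auto
  qed
  then obtain Q' where Q': "leaf Q'" "mset Q' = mset Q" using tiling_leaf by blast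
  have adjP: "adj (P ! r) (P ! Suc r)" if "Suc r < length P" for r
    using leaf_successively_adj[OF P] that by (simp add: successively_conv_nth)
  have "cyc Q"
  proof (rule cyc_from_cadj[OF Q'(1) Q'(2)[symmetric]])
    fix r assume r: "Suc r < length Q"
    then have r': "Suc r < length P" "P ! r \<in> set P" "P ! Suc r \<in> set P" unfolding Q_def by auto
    have "adj (at_scale (J (P ! r)) (\<phi> (P ! r))) (at_scale (J (P ! Suc r)) (\<phi> (P ! Suc r)))"
      by (rule m3[OF _ _ adj_at_scale_same[OF adjP[OF r'(1)]] J[OF r'(2)] J[OF r'(3)]]) (use m(1) in auto)
    from adj_at_scale_cases[OF this] show "cadj (Q ! r) (Q ! Suc r)" using r' unfolding Q_def cadj_def by auto
  qed
  have lPQ: "length P = length Q" unfolding Q_def by simp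
  have "ends.eqv P Q" by (rule ends.eqv_cyc[OF cyc_leaf[OF P] \<open>cyc Q\<close> lPQ lenP])
  then obtain k where k: "k \<in> N \<inter> G0" "list_all2 (carries_end k) P Q" unfolding ends.eqv_def by blast
  define h where "h = finv k \<circ> g"
  have bk: "bij k" using k N_sub G_bij by blast
  have hG: "h \<in> G" unfolding h_def using k N_sub G_comp G_inv g by blast
  have hpt: "h pt = pt" unfolding h_def using g(2) G0_pt[of k] k(1) bk by (metis IntD2 bij_simps(2) comp_apply)
  obtain m' where m': "\<And>i j a b u v. m' \<le> i \<Longrightarrow> m' \<le> j \<Longrightarrow> adj (at_scale i a) (at_scale j b) \<Longrightarrow>
      carries h (at_scale i a) u \<Longrightarrow> carries h (at_scale j b) v \<Longrightarrow> adj u v"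
    using G_adj[OF hG hpt] by blast
  have RH: "carries_end h w w" if w: "w \<in> set P" for w
  proof -
    obtain r where r: "r < length P" "w = P ! r" using w by (metis in_set_conv_nth)
    then have "carries_end k w (\<phi> w)" using k(2) unfolding Q_def by (simp add: list_all2_conv_all_nth)
    moreover have "carries_end g w (\<phi> w)" unfolding carries_end_def using J'[OF w] by blast
    ultimately show ?thesis unfolding h_def using carries_end_comp carries_end_inv bk by blast
  qed
  have "eventually (\<lambda>p. \<forall>w\<in>set P. \<exists>q. \<forall>i. carries h (at_scale (p + i) w) (at_scale (q + i) w)) sequentially"
  proof (rule eventually_ball_finite)
    show "\<forall>w\<in>set P. eventually (\<lambda>p. \<exists>q. \<forall>i. carries h (at_scale (p + i) w) (at_scale (q + i) w)) sequentially"
    proof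
      fix w assume "w \<in> set P"
      then obtain p q where pq: "\<And>i. carries h (at_scale (p + i) w) (at_scale (q + i) w)" using RH unfolding carries_end_def by blast
      have "\<exists>q. \<forall>i. carries h (at_scale (p' + i) w) (at_scale (q + i) w)" if "p \<le> p'" for p'
        using pq[of "p' - p + _"] that by (intro exI[of _ "q + (p' - p)"]) (simp add: add.assoc)
      then show "eventually (\<lambda>p. \<exists>q. \<forall>i. carries h (at_scale (p + i) w) (at_scale (q + i) w)) sequentially"
        using eventually_sequentially by blast
    qed
  qed simp
  then obtain p where p: "m' \<le> p" "\<And>w. w \<in> set P \<Longrightarrow> \<exists>q. \<forall>i. carries h (at_scale (p + i) w) (at_scale (q + i) w)"
    unfolding eventually_sequentially by (metis max.cobounded1 max.cobounded2)
  then obtain q where q: "\<And>w i. w \<in> set P \<Longrightarrow> carries h (at_scale (p + i) w) (at_scale (q w + i) w)" by metis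
  \<comment> \<open>The pieces \<open>P ! r\<close> and \<open>P ! Suc r\<close> have neighbouring images, and being neighbours inside
    one tree they must be in the same block.\<close>
  have qc: "q (P ! r) = q (P ! 0)" if "r < length P" for r
    using that
  proof (induction r)
    case (Suc r)
    then have in': "P ! r \<in> set P" "P ! Suc r \<in> set P" by auto
    have "adj (at_scale (q (P ! r)) (P ! r)) (at_scale (q (P ! Suc r)) (P ! Suc r))"
      by (rule m'[OF p(1) p(1) adj_at_scale_same[OF adjP[OF Suc(2)]]]) (use q[OF in'(1), of 0] q[OF in'(2), of 0] in simp_all)
    from adj_at_scale_cases[OF this] have "q (P ! r) = q (P ! Suc r)"
      using adjP[OF Suc(2)] adj_not_replicate_True by metis
    then show ?case using Suc by simp
  qed simp
  have "carries h (at_scale (p + i) []) (at_scale (q (P ! 0) + i) [])" for i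
    unfolding carries_def
  proof
    fix x obtain r x' where r: "r < length P" "x = W (P ! r) x'" using tiling_cover[OF leaf_tiling[OF P]] .
    have "h (W (at_scale (p + i) (P ! r)) x') = W (at_scale (q (P ! 0) + i) (P ! r)) x'"
      using q[of "P ! r" i] qc[OF r(1)] r(1) by (simp add: carries_def)
    then show "h (W (at_scale (p + i) []) x) = W (at_scale (q (P ! 0) + i) []) x"
      unfolding r(2) by (metis W_append append_Nil at_scale_append)
  qed
  then show ?thesis unfolding h_def using k(1) N_inv G0_inv by blast
qed

text \<open>
  The blocks from scale \<open>p\<close> on, together with the base point, make up the cone \<open>0\<^sup>p\<close>.
\<close>

lemma end_reduction_prefix:
  assumes "g \<in> G" "g pt = pt"
  shows "\<exists>n\<in>N \<inter> G0. \<exists>p q. carries (n \<circ> g) (replicate p False) (replicate q False)"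
proof -
  obtain n p q where n: "n \<in> N \<inter> G0" "\<And>i. carries (n \<circ> g) (at_scale (p + i) []) (at_scale (q + i) [])"
    using end_reduction[OF assms] by blast
  have "(n \<circ> g) (W (replicate p False) z) = W (replicate q False) z" for z
  proof (cases "z = pt")
    case True
    then show ?thesis using assms(2) G0_pt n(1) by (simp add: W_zeros_pt)
  next
    case False
    then obtain i x where z: "z = W (at_scale i []) x" using pt_or by blast
    have "W (replicate k False) (W (at_scale i []) x) = W (at_scale (k + i) []) x" for k
      unfolding at_scale_def by (simp add: replicate_add)
    then show ?thesis unfolding z using n(2)[of i] by (simp add: carries_def)
  qed
  then show ?thesis using n(1) unfolding carries_def by blast
qed

text \<open>
  Applied to the reflection of the circle and to the exchange of letters on the Cantor set, which
  normalize \<open>G\<close> without lying in it.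
\<close>

lemma conjugate_normal:
  assumes inv: "\<And>x. \<phi> (\<phi> x) = x" and G: "\<And>f. f \<in> G \<Longrightarrow> \<phi> \<circ> f \<circ> \<phi> \<in> G"
  shows "normal_dyad_group y pt G G0 ((\<lambda>f. \<phi> \<circ> f \<circ> \<phi>) ` N)"
proof
  let ?c = "\<lambda>f. \<phi> \<circ> f \<circ> \<phi>"
  have cc: "?c (?c f) = f" for f by (auto simp: fun_eq_iff inv)
  have fi: "finv (?c f) = ?c (finv f)" if "bij f" for f
    by (rule inv_equality) (use that inv in auto)
  show "?c ` N \<subseteq> G" using N_sub G by blast
  show "id \<in> ?c ` N" using N_id inv by (intro image_eqI[of _ _ id]) auto
  show "f \<circ> g \<in> ?c ` N" if fg: "f \<in> ?c ` N" "g \<in> ?c ` N" for f g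
  proof -
    obtain k l where kl: "k \<in> N" "f = ?c k" "l \<in> N" "g = ?c l" using fg by blast
    then have "f \<circ> g = ?c (k \<circ> l)" by (auto simp: fun_eq_iff inv)
    then show ?thesis using N_comp[OF kl(1,3)] by blast
  qed
  show "finv f \<in> ?c ` N" if fN: "f \<in> ?c ` N" for f
  proof -
    obtain k where k: "k \<in> N" "f = ?c k" using fN by blast
    then have "finv f = ?c (finv k)" using fi N_sub G_bij by blast
    then show ?thesis using N_inv[OF k(1)] by blast
  qed
  show "g \<circ> f \<circ> finv g \<in> ?c ` N" if gf: "g \<in> G" "f \<in> ?c ` N" for f g
  proof -
    obtain k where k: "k \<in> N" "f = ?c k" using gf(2) by blast
    have "?c g \<circ> k \<circ> finv (?c g) \<in> N" using N_conj G gf(1) k(1) by blast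
    moreover have "g \<circ> f \<circ> finv g = ?c (?c g \<circ> k \<circ> finv (?c g))"
      unfolding k(2) fi[OF G_bij[OF gf(1)]] by (auto simp: fun_eq_iff inv)
    ultimately show ?thesis by blast
  qed
  obtain k where k: "k \<in> N" "k \<noteq> id" using N_nontriv by blast
  have "?c k \<noteq> id"
  proof
    assume "?c k = id"
    then have "?c (?c k) = ?c id" by simp
    then have "k = ?c id" by (simp only: cc)
    then show False using k(2) inv by auto
  qed
  then show "\<exists>f\<in>?c ` N. f \<noteq> id" using k(1) by blast
qed

end

section \<open>Permutations of cones\<close>

text \<open>
  Here \<open>G\<close> contains all of \<open>V\<close>: cones may be permuted regardless of their order.
\<close>

locale perm_dyad_group = normal_dyad_group y pt G G0 N
  for y :: "bool \<Rightarrow> 'x \<Rightarrow> 'x" and pt G G0 N +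
  assumes permG: "tiling P \<Longrightarrow> tiling Q \<Longrightarrow> list_all2 (carries f) P Q \<Longrightarrow> f \<in> G"
begin

lemma tiling_split:
  assumes "tiling (A @ c # B)" shows "tiling (A @ (c @ [False]) # (c @ [True]) # B)"
  unfolding tiling_def
proof (intro conjI allI)
  have "disj a (c @ [t])" if "disj a c" for a t using disj_append[OF that, of "[]"] by simp
  moreover have "disj (c @ [t]) a" if "disj c a" for a t using disj_append[OF that, of _ "[]"] by simp
  moreover have "disj (c @ [False]) (c @ [True])" by (auto simp: disj_iff)
  ultimately show "sorted_wrt disj (A @ (c @ [False]) # (c @ [True]) # B)"
    using assms unfolding tiling_def by (simp add: sorted_wrt_append)
  fix x
  obtain w z where w: "w \<in> set (A @ c # B)" "x = W w z" using assms unfolding tiling_def by blast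
  show "\<exists>w\<in>set (A @ (c @ [False]) # (c @ [True]) # B). x \<in> range (W w)"
  proof (cases "w = c")
    case True
    obtain t z' where "z = y t z'" using y_surj by blast
    then have "x = W (c @ [t]) z'" using w True by simp
    then show ?thesis by (cases t) auto
  next
    case False
    then show ?thesis using w by (intro bexI[of _ w]) auto
  qed
qed

text \<open>
  Let \<open>s\<close> exchange the first halves of the cones \<open>x\<close> and \<open>z\<close>, and let \<open>c\<close> exchange the two halves
  within each of them. Both are involutions, and their commutator \<open>s c s c\<close> exchanges \<open>x\<close> with \<open>z\<close>.
  Both \<open>s\<close> and \<open>c\<close> fix every other cone of the partition.
\<close>

lemma swap_N:
  assumes t: "tiling (A @ x # U @ z # V)" and ne: "A @ U @ V \<noteq> []"
  shows "\<exists>n\<in>N. list_all2 (carries n) (A @ x # U @ z # V) (A @ z # U @ x # V)"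
proof -
  define L where "L = A @ (x @ [False]) # (x @ [True]) # U @ (z @ [False]) # (z @ [True]) # V"
  define L1 where "L1 = A @ (z @ [False]) # (x @ [True]) # U @ (x @ [False]) # (z @ [True]) # V"
  define L2 where "L2 = A @ (x @ [True]) # (x @ [False]) # U @ (z @ [True]) # (z @ [False]) # V"
  have tL: "tiling L" unfolding L_def
    using tiling_split[of "A @ (x @ [False]) # (x @ [True]) # U" z V] tiling_split[OF t] by simp
  have tL12: "tiling L1" "tiling L2" by (rule tiling_mset[OF tL]; simp add: L_def L1_def L2_def)+
  obtain s where s: "list_all2 (carries s) L L1"
    using realization_exists[OF tL, of L1] by (auto simp: L_def L1_def)
  obtain c where c: "list_all2 (carries c) L L2"
    using realization_exists[OF tL, of L2] by (auto simp: L_def L2_def)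
  have sG: "s \<in> G" "c \<in> G" using permG[OF tL tL12(1) s] permG[OF tL tL12(2) c] .
  have s1: "list_all2 (carries s) A A" "list_all2 (carries s) U U" "list_all2 (carries s) V V"
    "carries s (x @ [False]) (z @ [False])" "carries s (x @ [True]) (x @ [True])"
    "carries s (z @ [False]) (x @ [False])" "carries s (z @ [True]) (z @ [True])"
    using s unfolding L_def L1_def by (simp_all add: list_all2_append)
  have c1: "list_all2 (carries c) A A" "list_all2 (carries c) U U" "list_all2 (carries c) V V"
    "carries c (x @ [False]) (x @ [True])" "carries c (x @ [True]) (x @ [False])"
    "carries c (z @ [False]) (z @ [True])" "carries c (z @ [True]) (z @ [False])"
    using c unfolding L_def L2_def by (simp_all add: list_all2_append)
  have "list_all2 (carries (s \<circ> s)) L L"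
    unfolding L_def using s1 list_all2_carries_comp carries_comp by (auto intro!: list_all2_appendI)
  then have ss: "s \<circ> s = id" using carries_cover_eq[OF tL, of "s \<circ> s" L id] by (auto simp: list_all2_same carries_id)
  have "list_all2 (carries (c \<circ> c)) L L"
    unfolding L_def using c1 list_all2_carries_comp carries_comp by (auto intro!: list_all2_appendI)
  then have cc: "c \<circ> c = id" using carries_cover_eq[OF tL, of "c \<circ> c" L id] by (auto simp: list_all2_same carries_id)
  have inv: "finv s = s" "finv c = c" using ss cc by (simp_all add: inv_unique_comp)
  obtain w where w: "w \<in> set (A @ U @ V)" using ne by (metis last_in_set)
  then have "carries s w w" "carries c w w" using s1(1-3) c1(1-3) by (auto simp: list_all2_same)
  then have "s \<circ> c \<circ> s \<circ> c \<in> N" using small_commutator[OF sG(1) _ sG(2)] inv by simp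
  moreover have "carries (s \<circ> c \<circ> s \<circ> c) w w" if "w \<in> set (A @ U @ V)" for w
    using that s1(1-3) c1(1-3) by (auto simp: list_all2_same carries_def)
  moreover have "carries (s \<circ> c \<circ> s \<circ> c) x z" "carries (s \<circ> c \<circ> s \<circ> c) z x"
  proof -
    have e: "s (W x (y False u)) = W z (y False u)" "s (W x (y True u)) = W x (y True u)"
      "s (W z (y False u)) = W x (y False u)" "s (W z (y True u)) = W z (y True u)"
      "c (W x (y False u)) = W x (y True u)" "c (W x (y True u)) = W x (y False u)"
      "c (W z (y False u)) = W z (y True u)" "c (W z (y True u)) = W z (y False u)" for u
      using s1(4-7) c1(4-7) by (simp_all add: carries_def)
    have "(s \<circ> c \<circ> s \<circ> c) (W x v) = W z v \<and> (s \<circ> c \<circ> s \<circ> c) (W z v) = W x v" for v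
    proof -
      obtain u where "v = y False u \<or> v = y True u" using y_range by blast
      then show ?thesis by (auto simp: e)
    qed
    then show "carries (s \<circ> c \<circ> s \<circ> c) x z" "carries (s \<circ> c \<circ> s \<circ> c) z x" unfolding carries_def by blast+
  qed
  ultimately show ?thesis
    by (intro bexI[of _ "s \<circ> c \<circ> s \<circ> c"]) (auto intro!: list_all2_appendI simp: list_all2_same)
qed

lemma reorder_N:
  "tiling (A @ X) \<Longrightarrow> mset X = mset Y \<Longrightarrow> 3 \<le> length (A @ X) \<Longrightarrow>
    \<exists>n\<in>N. list_all2 (carries n) (A @ X) (A @ Y)"
proof (induction "length X" arbitrary: A X Y)
  case 0
  then show ?case using N_id by (intro bexI[of _ id]) (auto simp: list_all2_same carries_def)
next
  case (Suc n)
  obtain x X' where X: "X = x # X'" using Suc(2) by (cases X) auto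
  obtain z Y' where Y: "Y = z # Y'" using Suc(4) X by (cases Y) auto
  show ?case
  proof (cases "x = z")
    case True
    then show ?thesis using Suc(1)[of X' "A @ [x]" Y'] Suc X Y by simp
  next
    case False
    have "z \<in> set X'" using Suc(4) X Y False by (metis list.set_intros(1) set_ConsD set_mset_mset)
    then obtain U V where X': "X' = U @ z # V" by (meson split_list)
    have ne: "A @ U @ V \<noteq> []" using Suc(5) X X' by auto
    obtain n1 where n1: "n1 \<in> N" "list_all2 (carries n1) (A @ x # U @ z # V) (A @ z # U @ x # V)"
      using swap_N[OF _ ne, of x z] Suc(3) X X' by auto
    have "tiling (A @ z # U @ x # V)" by (rule tiling_mset[OF Suc(3)]) (simp add: X X')
    then have "\<exists>n2\<in>N. list_all2 (carries n2) ((A @ [z]) @ (U @ x # V)) ((A @ [z]) @ Y')"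
      by (intro Suc(1)) (use Suc X X' Y \<open>tiling (A @ z # U @ x # V)\<close> in auto)
    then obtain n2 where n2: "n2 \<in> N" "list_all2 (carries n2) (A @ z # U @ x # V) (A @ Y)" using Y by auto
    show ?thesis using N_comp[OF n2(1) n1(1)] list_all2_carries_comp[OF n1(2) n2(2)] X X' by auto
  qed
qed

lemma tiling_N_aux:
  assumes P: "tiling P" and Q: "tiling Q" and f: "list_all2 (carries f) P Q" and len: "3 \<le> length P"
  shows "f \<in> N"
proof -
  have l: "length P = length Q" using f by (simp add: list_all2_lengthD)
  obtain P' where P': "leaf P'" "mset P' = mset P" using tiling_leaf[OF P] by blast
  obtain Q' where Q': "leaf Q'" "mset Q' = mset Q" using tiling_leaf[OF Q] by blast
  obtain a where a: "a \<in> N" "list_all2 (carries a) P P'" using reorder_N[of "[]" P P'] P P' len by auto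
  obtain b where b: "b \<in> N" "list_all2 (carries b) Q Q'" using reorder_N[of "[]" Q Q'] Q Q' len l by auto
  have "length P' = length Q'" using P' Q' l by (metis mset_eq_length)
  then obtain k where k: "list_all2 (carries k) P' Q'" using realization_exists[OF leaf_tiling[OF P'(1)]] by blast
  have "k \<in> N" by (rule cyc_N[OF cyc_leaf[OF P'(1)] cyc_leaf[OF Q'(1)] k])
  moreover have "bij b" using b N_sub G_bij by blast
  then have "list_all2 (carries (finv b \<circ> (k \<circ> a))) P Q"
    by (intro list_all2_carries_comp[OF list_all2_carries_comp[OF a(2) k]] list_all2_carries_inv b(2))
  then have "f = finv b \<circ> (k \<circ> a)" by (rule carries_cover_eq[OF P f])
  ultimately show ?thesis using a b N_comp N_inv by blast
qed

text \<open>
  Transpositions in \<open>N\<close> reorder source and target into leaf lists, and \<open>cyc_N\<close> applies to these.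
\<close>

theorem tiling_N:
  assumes "tiling P" "tiling Q" "list_all2 (carries f) P Q" shows "f \<in> N"
proof -
  define E where "E P = concat (map (\<lambda>w. map ((@) w) (unif 2)) P)" for P
  have f: "bij f" by (rule realization_bij[OF assms])
  obtain P' where P': "leaf P'" "mset P' = mset P" using tiling_leaf[OF assms(1)] by blast
  have *: "mset (E P) = \<Sum>\<^sub># (image_mset (\<lambda>w. mset (map ((@) w) (unif 2))) (mset P))" for P
    unfolding E_def by (induction P) auto
  have "mset (E P') = mset (E P)" unfolding * P'(2) ..
  moreover have "tiling (E P')" unfolding E_def by (rule leaf_tiling[OF leaf_refine[OF P'(1) leaf_unif]])
  ultimately have tE: "tiling (E P)" using tiling_mset by blast
  have l: "list_all2 (carries f) (E P) (E Q)" unfolding E_def by (rule carries_refine[OF assms(3)]) simp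
  have "P \<noteq> []" using assms(1) unfolding tiling_def by auto
  then have "3 \<le> length (E P)" unfolding E_def by (cases P) (auto simp: length_concat numeral_2_eq_2)
  then show ?thesis using tiling_N_aux[OF tE tiling_image[OF tE l f] l] by blast
qed

end

section \<open>Simple groups of bijections\<close>

lemma comp_group_simps [simp]:
  "carrier (comp_group X) = X" "mult (comp_group X) = (\<circ>)" "one (comp_group X) = id"
  by (simp_all add: comp_group_def)

lemma comp_group_group:
  assumes "id \<in> G" "\<And>f g. f \<in> G \<Longrightarrow> g \<in> G \<Longrightarrow> f \<circ> g \<in> G" "\<And>f. f \<in> G \<Longrightarrow> bij f" "\<And>f. f \<in> G \<Longrightarrow> finv f \<in> G"
  shows "group (comp_group G)" "\<And>f. f \<in> G \<Longrightarrow> m_inv (comp_group G) f = finv f"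
proof -
  have l: "finv f \<circ> f = id" if "f \<in> G" for f using assms(3)[OF that] by auto
  show g: "group (comp_group G)"
  proof (rule groupI)
    show "\<exists>y\<in>carrier (comp_group G). y \<otimes>\<^bsub>comp_group G\<^esub> x = \<one>\<^bsub>comp_group G\<^esub>" if "x \<in> carrier (comp_group G)" for x
      using assms(4) l that by (intro bexI[of _ "finv x"]) simp_all
  qed (use assms in \<open>auto simp: comp_assoc\<close>)
  show "m_inv (comp_group G) f = finv f" if "f \<in> G" for f
    using group.inv_equality[OF g, of "finv f" f] assms(4) l that by simp
qed

lemma simple_comp_groupI:
  assumes G: "id \<in> G" "\<And>f g. f \<in> G \<Longrightarrow> g \<in> G \<Longrightarrow> f \<circ> g \<in> G" "\<And>f. f \<in> G \<Longrightarrow> bij f" "\<And>f. f \<in> G \<Longrightarrow> finv f \<in> G"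
    and nt: "\<exists>f\<in>G. f \<noteq> id"
    and N: "\<And>N. N \<subseteq> G \<Longrightarrow> id \<in> N \<Longrightarrow> (\<And>f g. f \<in> N \<Longrightarrow> g \<in> N \<Longrightarrow> f \<circ> g \<in> N) \<Longrightarrow>
      (\<And>f. f \<in> N \<Longrightarrow> finv f \<in> N) \<Longrightarrow> (\<And>f g. g \<in> G \<Longrightarrow> f \<in> N \<Longrightarrow> g \<circ> f \<circ> finv g \<in> N) \<Longrightarrow>
      \<exists>f\<in>N. f \<noteq> id \<Longrightarrow> G \<subseteq> N"
  shows "is_simple_group (comp_group G)"
  unfolding is_simple_group_def
proof (intro conjI allI impI)
  show g: "group (comp_group G)" by (rule comp_group_group[OF G])
  have inv: "m_inv (comp_group G) f = finv f" if "f \<in> G" for f by (rule comp_group_group(2)[OF G that])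
  show "carrier (comp_group G) \<noteq> {one (comp_group G)}" using nt by auto
  fix N assume n: "N \<lhd> comp_group G"
  interpret n: normal N "comp_group G" by (rule n)
  have sub: "N \<subseteq> G" using n.subset by simp
  show "N = {one (comp_group G)} \<or> N = carrier (comp_group G)"
  proof (cases "\<exists>f\<in>N. f \<noteq> id")
    case True
    have "G \<subseteq> N"
    proof (rule N[OF sub _ _ _ _ True])
      show "id \<in> N" using subgroup.one_closed[OF n.subgroup_axioms] by simp
      show "f \<circ> g \<in> N" if "f \<in> N" "g \<in> N" for f g using subgroup.m_closed[OF n.subgroup_axioms that] by simp
      show "finv f \<in> N" if "f \<in> N" for f using subgroup.m_inv_closed[OF n.subgroup_axioms that] unfolding inv[OF subsetD[OF sub that]] .
      show "g \<circ> f \<circ> finv g \<in> N" if "g \<in> G" "f \<in> N" for f g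
        using n.inv_op_closed2[of g f] that inv by simp
    qed
    with sub show ?thesis by simp
  next
    case False
    have "id \<in> N" using subgroup.one_closed[OF n.subgroup_axioms] by simp
    with False show ?thesis by auto
  qed
qed

section \<open>Homeomorphisms, germs and singular points\<close>

lemma Homeo_iff: "f \<in> Homeo \<longleftrightarrow> bij f \<and> continuous_on UNIV f \<and> continuous_on UNIV (finv f)"
proof
  assume "f \<in> Homeo"
  then obtain g where g: "homeomorphism UNIV UNIV f g" unfolding Homeo_def by blast
  then have 1: "\<And>x. g (f x) = x" "\<And>x. f (g x) = x" unfolding homeomorphism_def by auto
  then have "bij f" by (intro o_bij[of g]) auto
  moreover have "finv f = g" using 1 by (intro inv_equality)
  ultimately show "bij f \<and> continuous_on UNIV f \<and> continuous_on UNIV (finv f)"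
    using g unfolding homeomorphism_def by auto
next
  assume h: "bij f \<and> continuous_on UNIV f \<and> continuous_on UNIV (finv f)"
  then have "homeomorphism UNIV UNIV f (finv f)"
    unfolding homeomorphism_def by (auto simp: bij_is_surj bij_imp_bij_inv)
  then show "f \<in> Homeo" unfolding Homeo_def by blast
qed

lemma Homeo_bij: "f \<in> Homeo \<Longrightarrow> bij f"
  by (simp add: Homeo_iff)

lemma Homeo_id: "id \<in> Homeo"
  by (simp add: Homeo_iff inv_id)

lemma Homeo_comp: assumes "f \<in> Homeo" "g \<in> Homeo" shows "f \<circ> g \<in> Homeo"
proof -
  have "bij f" "bij g" using assms Homeo_bij by auto
  then have "finv (f \<circ> g) = finv g \<circ> finv f" by (rule o_inv_distrib)
  then show ?thesis using assms unfolding Homeo_iff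
    by (metis bij_comp continuous_on_compose continuous_on_subset subset_UNIV)
qed

lemma Homeo_inv: "f \<in> Homeo \<Longrightarrow> finv f \<in> Homeo"
  unfolding Homeo_iff by (simp add: bij_imp_bij_inv inv_inv_eq)

lemma Homeo_isCont: "f \<in> Homeo \<Longrightarrow> isCont f x"
  unfolding Homeo_iff by (simp add: continuous_on_eq_continuous_at)

lemma Homeo_open_vimage: "f \<in> Homeo \<Longrightarrow> open U \<Longrightarrow> open (f -` U)"
  unfolding Homeo_iff using open_vimage by blast

lemma Homeo_tendsto: "f \<in> Homeo \<Longrightarrow> filterlim f (nhds (f x)) (nhds x)"
  by (rule topological_tendstoI) (auto simp: eventually_nhds intro!: exI[of _ "f -` _"] Homeo_open_vimage)

lemma Homeo_compactI:
  fixes f :: "'a::t2_space \<Rightarrow> 'a"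
  assumes "compact (UNIV :: 'a set)" "bij f" "continuous_on UNIV f" shows "f \<in> Homeo"
proof -
  have "continuous_on (f ` UNIV) (finv f)"
    by (rule continuous_on_inv[OF assms(3,1)]) (use assms(2) in simp)
  then show ?thesis using assms unfolding Homeo_iff by (simp add: bij_is_surj)
qed

lemma germ_eq_refl: "germ_eq p f f" unfolding germ_eq_def by simp
lemma germ_eq_sym: "germ_eq p f g \<Longrightarrow> germ_eq p g f"
  unfolding germ_eq_def by (simp add: eq_commute)
lemma germ_eq_trans: "germ_eq p f g \<Longrightarrow> germ_eq p g h \<Longrightarrow> germ_eq p f h"
  unfolding germ_eq_def by (elim eventually_rev_mp) (auto intro: always_eventually)
lemma germ_eq_at: "germ_eq p f g \<Longrightarrow> f p = g p"
  unfolding germ_eq_def by (rule eventually_nhds_x_imp_x)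
lemma germ_eq_left: "germ_eq p f g \<Longrightarrow> germ_eq p (h \<circ> f) (h \<circ> g)"
  unfolding germ_eq_def by (auto elim: eventually_mono)
lemma germ_eq_right: "germ_eq (h p) f g \<Longrightarrow> filterlim h (nhds (h p)) (nhds p) \<Longrightarrow> germ_eq p (f \<circ> h) (g \<circ> h)"
  unfolding germ_eq_def filterlim_iff by auto
lemma germ_eqI: "open U \<Longrightarrow> p \<in> U \<Longrightarrow> (\<And>x. x \<in> U \<Longrightarrow> f x = g x) \<Longrightarrow> germ_eq p f g"
  unfolding germ_eq_def eventually_nhds by blast
lemma germ_eqE:
  assumes "germ_eq p f g" obtains U where "open U" "p \<in> U" "\<And>x. x \<in> U \<Longrightarrow> f x = g x"
proof -
  have "\<exists>U. open U \<and> p \<in> U \<and> (\<forall>x\<in>U. f x = g x)" using assms unfolding germ_eq_def eventually_nhds .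
  then obtain U where "open U" "p \<in> U" "\<forall>x\<in>U. f x = g x" by blast
  then show ?thesis by (intro that[of U]) auto
qed

lemma germ_eq_comp_left_inv:
  assumes "germ_eq p f g" "bij f" "bij g" "f \<in> Homeo"
  shows "germ_eq (f p) (finv f) (finv g)"
proof -
  obtain U where U: "open U" "p \<in> U" "\<And>x. x \<in> U \<Longrightarrow> f x = g x" using germ_eqE[OF assms(1)] by blast
  have "open (finv f -` U)" using Homeo_open_vimage[OF Homeo_inv[OF assms(4)] U(1)] .
  then show ?thesis
  proof (rule germ_eqI)
    show "f p \<in> finv f -` U" using U(2) assms(2) by simp
    show "finv f x = finv g x" if "x \<in> finv f -` U" for x
      using U(3)[of "finv f x"] that assms(2,3) by (metis bij_simps vimageE)
  qed
qed

lemma sing_comp: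
  assumes H: "\<And>f g. f \<in> H \<Longrightarrow> g \<in> H \<Longrightarrow> f \<circ> g \<in> H" and g: "g \<in> Homeo"
  shows "sing H (f \<circ> g) \<subseteq> sing H g \<union> g -` sing H f"
proof
  fix p assume p: "p \<in> sing H (f \<circ> g)"
  show "p \<in> sing H g \<union> g -` sing H f"
  proof (rule ccontr)
    assume "p \<notin> sing H g \<union> g -` sing H f"
    then obtain h k where h: "h \<in> H" "germ_eq p g h" and k: "k \<in> H" "germ_eq (g p) f k"
      unfolding sing_def by blast
    have "germ_eq p (f \<circ> g) (k \<circ> g)" by (rule germ_eq_right[OF k(2) Homeo_tendsto[OF g]])
    moreover have "germ_eq p (k \<circ> g) (k \<circ> h)" by (rule germ_eq_left[OF h(2)])
    ultimately have "germ_eq p (f \<circ> g) (k \<circ> h)" by (rule germ_eq_trans)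
    then show False using p H[OF k(1) h(1)] unfolding sing_def by blast
  qed
qed

lemma sing_inv:
  assumes H: "\<And>f. f \<in> H \<Longrightarrow> finv f \<in> H" "H \<subseteq> Homeo" and f: "f \<in> Homeo"
  shows "sing H (finv f) \<subseteq> f ` sing H f"
proof
  fix q assume q: "q \<in> sing H (finv f)"
  define p where "p = finv f q"
  have qp: "q = f p" unfolding p_def using Homeo_bij[OF f] by simp
  have "p \<in> sing H f"
  proof (rule ccontr)
    assume "p \<notin> sing H f"
    then obtain h where h: "h \<in> H" "germ_eq p f h" unfolding sing_def by blast
    have "germ_eq q (finv f) (finv h)"
      unfolding qp by (rule germ_eq_comp_left_inv[OF h(2)]) (use h H f Homeo_bij in auto)
    then show False using q H(1)[OF h(1)] unfolding sing_def by blast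
  qed
  then show "q \<in> f ` sing H f" using qp by blast
qed

lemma sing_self: "f \<in> H \<Longrightarrow> sing H f = {}"
  unfolding sing_def using germ_eq_refl by blast

context dyad
begin

definition wordlike :: "('x \<Rightarrow> 'x) \<Rightarrow> bool" where
  "wordlike f \<longleftrightarrow> (\<exists>n. \<forall>w. n \<le> length w \<longrightarrow> (\<exists>u. carries f w u))"

lemma tiling_prefix:
  assumes "tiling P" "\<And>a. a \<in> set P \<Longrightarrow> length a \<le> length w"
  shows "\<exists>a\<in>set P. \<exists>v. w = a @ v"
proof -
  have "\<exists>a\<in>set P. W w undefined \<in> range (W a)" using assms(1) unfolding tiling_def by blast
  then obtain a z where a: "a \<in> set P" "W w undefined = W a z" by blast
  from W_eqD[OF a(2)] assms(2)[OF a(1)] have "\<exists>v. w = a @ v" by auto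
  then show ?thesis using a(1) by blast
qed

lemma wordlike_of_list:
  assumes "tiling P" "list_all2 (carries f) P Q" shows "wordlike f"
  unfolding wordlike_def
proof (rule exI[of _ "Max (length ` set P)"], intro allI impI)
  fix w :: "bool list" assume n: "Max (length ` set P) \<le> length w"
  have "length a \<le> length w" if "a \<in> set P" for a using that n
    by (meson List.finite_set Max_ge finite_imageI image_eqI le_trans)
  from tiling_prefix[OF assms(1) this] obtain a v where a: "a \<in> set P" "w = a @ v" by blast
  then obtain b where "carries f a b" using assms(2) by (metis in_set_conv_nth list_all2_conv_all_nth)
  then show "\<exists>u. carries f w u" using a carries_append by blast
qed

lemma wordlike_list:
  assumes "bij f" "wordlike f"
  obtains n Q where "tiling Q" "list_all2 (carries f) (unif n) Q"
proof -
  obtain n where n: "\<And>w. n \<le> length w \<Longrightarrow> \<exists>u. carries f w u" using assms(2) unfolding wordlike_def by blast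
  then obtain \<phi> where \<phi>: "\<And>w. n \<le> length w \<Longrightarrow> carries f w (\<phi> w)" by metis
  have "length (unif n ! i) = n" if "i < length (unif n)" for i
    using nth_mem[OF that] set_unif by blast
  then have l: "list_all2 (carries f) (unif n) (map \<phi> (unif n))" by (simp add: list_all2_conv_all_nth \<phi>)
  from that[OF tiling_image[OF leaf_tiling[OF leaf_unif] l assms(1)] l] show ?thesis .
qed

lemma wordlike_inv: assumes "bij f" "wordlike f" shows "wordlike (finv f)"
proof -
  obtain n Q where "tiling Q" "list_all2 (carries f) (unif n) Q" using wordlike_list[OF assms] .
  then show ?thesis using wordlike_of_list list_all2_carries_inv assms(1) by blast
qed

lemma wordlike_id: "wordlike id" unfolding wordlike_def using carries_id by blast

lemma wordlike_comp: assumes "bij f" "wordlike f" "wordlike g" shows "wordlike (f \<circ> g)"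
proof -
  obtain n where n: "\<And>w. n \<le> length w \<Longrightarrow> \<exists>u. carries f w u" using assms(2) unfolding wordlike_def by blast
  obtain m where m: "\<And>w. m \<le> length w \<Longrightarrow> \<exists>u. carries g w u" using assms(3) unfolding wordlike_def by blast
  have "\<exists>u. carries (f \<circ> g) w u" if w: "m + n \<le> length w" for w
  proof -
    obtain u where u: "carries g (take m w) u" using m[of "take m w"] w by auto
    have "carries g w (u @ drop m w)" using carries_append[OF u, of "drop m w"] by simp
    moreover have "n \<le> length (u @ drop m w)" using w by simp
    then obtain v where "carries f (u @ drop m w) v" using n by blast
    ultimately show ?thesis using carries_comp by blast
  qed
  then show ?thesis unfolding wordlike_def by blast
qed

lemma wordlike_koenig:
  assumes "\<And>x. \<exists>k u. carries f (map x [0..<k]) u" shows "wordlike f"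
  unfolding wordlike_def by (rule koenig) (use assms carries_append in blast)+

end

section \<open>Self-similar compact spaces\<close>

text \<open>
  The part of the topology that the argument needs. On the Cantor set cones are open and closed; on
  the circle they are half-open arcs, and a point may be the limit of a path of cones without
  being in them. This is why \<open>path_limit\<close> speaks of a limit point of a path of cones, \<open>avoid\<close>
  of closures, and why \<open>nbhd\<close> describes neighbourhoods of the base point only within the cone of \<open>0\<close>.
\<close>

locale top_dyad = dyad_pt y pt for y :: "bool \<Rightarrow> 'x::t2_space \<Rightarrow> 'x" and pt :: 'x +
  assumes cpt: "compact (UNIV :: 'x set)"
    and path_limit: "\<exists>p. \<forall>U. open U \<longrightarrow> p \<in> U \<longrightarrow> (\<exists>k0. \<forall>k\<ge>k0. range (W (map x [0..<k])) \<subseteq> U)"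
    and open_word: "open U \<Longrightarrow> U \<noteq> {} \<Longrightarrow> \<exists>w. range (W w) \<subseteq> U"
    and avoid: "\<exists>m0. \<forall>m\<ge>m0. p \<notin> closure (range (W (at_scale m [])))"
    and shrink: "open U \<Longrightarrow> pt \<in> U \<Longrightarrow> \<exists>M. range (W (replicate M False)) \<subseteq> U"
    and nbhd: "\<exists>V. open V \<and> pt \<in> V \<and> V \<inter> range (W [False]) \<subseteq> range (W (replicate M False))"
begin

definition word_homeo :: "('x \<Rightarrow> 'x) set" where "word_homeo = {f \<in> Homeo. wordlike f}"

lemma word_homeo_Homeo: "word_homeo \<subseteq> Homeo" unfolding word_homeo_def by blast

lemma word_homeo_comp: "f \<in> word_homeo \<Longrightarrow> g \<in> word_homeo \<Longrightarrow> f \<circ> g \<in> word_homeo"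
  unfolding word_homeo_def using Homeo_comp wordlike_comp Homeo_bij by blast

lemma word_homeo_inv: "f \<in> word_homeo \<Longrightarrow> finv f \<in> word_homeo"
  unfolding word_homeo_def using Homeo_inv wordlike_inv Homeo_bij by blast

lemma word_homeo_id: "id \<in> word_homeo"
  unfolding word_homeo_def using Homeo_id wordlike_id by blast

lemma sing_word_homeo_comp: "g \<in> Homeo \<Longrightarrow> sing word_homeo (f \<circ> g) \<subseteq> sing word_homeo g \<union> g -` sing word_homeo f"
  by (rule sing_comp[OF word_homeo_comp])

lemma sing_word_homeo_inv: "f \<in> Homeo \<Longrightarrow> sing word_homeo (finv f) \<subseteq> f ` sing word_homeo f"
  by (rule sing_inv[OF word_homeo_inv word_homeo_Homeo])

lemma finite_sing_comp:
  assumes "g \<in> Homeo" "finite (sing word_homeo f)" "finite (sing word_homeo g)" shows "finite (sing word_homeo (f \<circ> g))"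
  using sing_word_homeo_comp[OF assms(1), of f] assms finite_vimageI[OF assms(2), of g] Homeo_bij[OF assms(1)]
  by (meson bij_is_inj finite_UnI finite_subset)

text \<open>
  By the Hausdorff property a neighbourhood of a moved point is disjoint from its image.
\<close>

lemma displacement:
  assumes "f \<in> Homeo" "f \<noteq> id" shows "\<exists>w. f ` range (W w) \<inter> range (W w) = {}"
proof -
  obtain x where "f x \<noteq> x" using assms(2) by (auto simp: fun_eq_iff)
  then obtain U V where UV: "open U" "open V" "x \<in> U" "f x \<in> V" "U \<inter> V = {}"
    by (metis hausdorff)
  have "open (U \<inter> f -` V)" using UV Homeo_open_vimage[OF assms(1)] by blast
  then obtain w where "range (W w) \<subseteq> U \<inter> f -` V" using open_word[of "U \<inter> f -` V"] UV by blast
  then show ?thesis using UV(5) by blast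
qed

text \<open>
  The limit point of every path of cones below \<open>s\<close> is regular, so \<open>g\<close> is a prefix replacement on some cone of the
  path. Koenig's lemma makes the depth uniform.
\<close>

lemma regular_word:
  assumes "\<And>p. p \<in> closure (range (W s)) \<Longrightarrow> p \<notin> sing word_homeo g"
  shows "\<exists>n. \<forall>w. n \<le> length w \<longrightarrow> (\<exists>u. carries g (s @ w) u)"
proof (rule koenig)
  fix x :: "nat \<Rightarrow> bool"
  define x' where "x' i = (if i < length s then s ! i else x (i - length s))" for i
  have x': "map x' [0..<length s + k] = s @ map x [0..<k]" for k
    by (rule nth_equalityI) (auto simp: x'_def nth_append)
  obtain p where p: "\<And>U. open U \<Longrightarrow> p \<in> U \<Longrightarrow> \<exists>k0. \<forall>k\<ge>k0. range (W (map x' [0..<k])) \<subseteq> U"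
    using path_limit[of x'] by blast
  have "p \<in> closure (range (W s))"
    unfolding closure_iff_nhds_not_empty
  proof (intro allI impI)
    fix A U assume "U \<subseteq> A" "open U" "p \<in> U"
    then obtain k0 where "range (W (map x' [0..<length s + k0])) \<subseteq> U" using p[of U] by (metis le_add2)
    then have "W s (W (map x [0..<k0]) pt) \<in> U" unfolding x' by auto
    then show "range (W s) \<inter> A \<noteq> {}" using \<open>U \<subseteq> A\<close> by blast
  qed
  then obtain t where t: "t \<in> word_homeo" "germ_eq p g t" using assms unfolding sing_def by blast
  obtain U where U: "open U" "p \<in> U" "\<And>x. x \<in> U \<Longrightarrow> g x = t x" using germ_eqE[OF t(2)] by blast
  obtain n where n: "\<And>w. n \<le> length w \<Longrightarrow> \<exists>u. carries t w u" using t(1) unfolding word_homeo_def wordlike_def by blast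
  obtain k0 where k0: "\<And>k. k0 \<le> k \<Longrightarrow> range (W (map x' [0..<k])) \<subseteq> U" using p[OF U(1,2)] by blast
  define k where "k = k0 + n"
  have inU: "range (W (s @ map x [0..<k])) \<subseteq> U" using k0[of "length s + k"] unfolding x' k_def by simp
  have "n \<le> length (s @ map x [0..<k])" unfolding k_def by simp
  then obtain u where u: "carries t (s @ map x [0..<k]) u" using n by blast
  have "carries g (s @ map x [0..<k]) u" unfolding carries_def
  proof
    fix z have "W (s @ map x [0..<k]) z \<in> U" using inU by (rule subsetD) (rule rangeI)
    then show "g (W (s @ map x [0..<k]) z) = W u z" using U(3) u[unfolded carries_def] by metis
  qed
  then show "\<exists>k u. carries g (s @ map x [0..<k]) u" by blast
next
  show "\<And>w v. \<exists>u. carries g (s @ w) u \<Longrightarrow> \<exists>u. carries g (s @ w @ v) u" using carries_append by (metis append_assoc)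
qed

lemma nonsing_wordlike:
  assumes "sing word_homeo g = {}" shows "wordlike g"
  using regular_word[of "[]" g] assms unfolding wordlike_def by auto

lemma regular_scales:
  assumes "finite (sing word_homeo g)"
  shows "\<exists>m0. \<forall>m\<ge>m0. \<exists>n. \<forall>w. n \<le> length w \<longrightarrow> (\<exists>u. carries g (at_scale m w) u)"
proof -
  have "eventually (\<lambda>m. \<forall>p\<in>sing word_homeo g. p \<notin> closure (range (W (at_scale m [])))) sequentially"
  proof (rule eventually_ball_finite[OF assms], rule ballI)
    fix p show "eventually (\<lambda>m. p \<notin> closure (range (W (at_scale m [])))) sequentially"
      unfolding eventually_sequentially by (rule avoid)
  qed
  then obtain m0 where m0: "\<And>m. m0 \<le> m \<Longrightarrow> \<forall>p\<in>sing word_homeo g. p \<notin> closure (range (W (at_scale m [])))"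
    unfolding eventually_sequentially by blast
  have "\<exists>n. \<forall>w. n \<le> length w \<longrightarrow> (\<exists>u. carries g (at_scale m w) u)" if "m0 \<le> m" for m
    using regular_word[of "at_scale m []" g] m0[OF that] by auto
  then show ?thesis by blast
qed

text \<open>
  Continuity holds away from the base point by \<open>spread_approx\<close>, and at the base point because cones
  \<open>0\<^sup>m\<close> with \<open>m\<close> large are mapped into small ones, while points outside the cone of \<open>0\<close> do not move.
\<close>

lemma spread_Homeo:
  assumes cycH: "\<And>f P Q. cyc P \<Longrightarrow> cyc Q \<Longrightarrow> list_all2 (carries f) P Q \<Longrightarrow> f \<in> word_homeo"
    and h: "spread p q c d a"
  shows "a \<in> Homeo" "sing word_homeo a \<subseteq> {pt}"
proof -
  have loc: "\<exists>g\<in>word_homeo. germ_eq z a g" if "z \<noteq> pt" for z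
  proof -
    obtain U V where UV: "open U" "open V" "pt \<in> U" "z \<in> V" "U \<inter> V = {}"
      using hausdorff[OF \<open>z \<noteq> pt\<close>] by (metis inf_commute)
    obtain M where M: "range (W (replicate M False)) \<subseteq> U" using shrink UV by blast
    obtain g where g: "F_like g" "\<And>z. z \<notin> range (W (replicate M False)) \<Longrightarrow> a z = g z"
      using spread_approx[OF h] by blast
    have "g \<in> word_homeo" using g(1) cycH cyc_leaf unfolding F_like_def by blast
    moreover have "germ_eq z a g"
      by (rule germ_eqI[OF UV(2,4)]) (use g(2) M UV(5) in blast)
    ultimately show ?thesis by blast
  qed
  then show "sing word_homeo a \<subseteq> {pt}" unfolding sing_def by blast
  have "isCont a z" for z
  proof (cases "z = pt")
    case False
    then obtain g where g: "g \<in> word_homeo" "germ_eq z a g" using loc by blast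
    then have "isCont g z" using word_homeo_Homeo Homeo_isCont by blast
    then show ?thesis using g(2) isCont_cong unfolding germ_eq_def by blast
  next
    case True
    have "\<exists>A. open A \<and> pt \<in> A \<and> (\<forall>z\<in>A. a z \<in> U)" if U: "open U" "a pt \<in> U" for U
    proof -
      have ptU: "pt \<in> U" using U(2) spread_pt[OF h] by simp
      obtain M where M: "range (W (replicate M False)) \<subseteq> U" using shrink U(1) ptU by blast
      obtain V where V: "open V" "pt \<in> V" "V \<inter> range (W [False]) \<subseteq> range (W (replicate (M + p + q) False))"
        using nbhd by blast
      have "a z \<in> U" if "z \<in> V \<inter> U" for z
      proof (cases "z \<in> range (W [False])")
        case True
        then show ?thesis using spread_shrink[OF h] V(3) M that by blast
      next
        case False
        then show ?thesis using spread_off[OF h False] that by simp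
      qed
      then show ?thesis using V U ptU by (intro exI[of _ "V \<inter> U"]) auto
    qed
    then show ?thesis unfolding True continuous_at_open by blast
  qed
  then show "a \<in> Homeo"
    by (intro Homeo_compactI[OF cpt spread_bij[OF h]]) (simp add: continuous_on_eq_continuous_at)
qed

end

section \<open>The circle as a self-similar space\<close>

lemma circle_eq: "circle_of x = circle_of y \<longleftrightarrow> x - y \<in> \<int>"
  by (rule circle.abs_eq_iff)

definition rep01 :: "circle \<Rightarrow> real" where "rep01 z = frac (rep_circle z)"

lemma circle_of_rep: "circle_of (rep_circle z) = z"
  by (rule Quotient_abs_rep[OF Quotient_circle])

lemma circle_of_frac: "circle_of (frac x) = circle_of x"
  by (simp add: circle_eq frac_def)

lemma circle_of_rep01 [simp]: "circle_of (rep01 z) = z"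
  unfolding rep01_def circle_of_frac by (rule circle_of_rep)

lemma rep01_bounds: "0 \<le> rep01 z" "rep01 z < 1"
  unfolding rep01_def by (auto simp: frac_lt_1)

lemma circle_eq_small:
  assumes "circle_of x = circle_of y" "\<bar>x - y\<bar> < 1" shows "x = y"
  using assms unfolding circle_eq by (metis Ints_cases abs_less_iff eq_iff_diff_eq_0 of_int_abs of_int_less_1_iff zabs_less_one_iff of_int_0)

lemma rep01_circle_of: "0 \<le> x \<Longrightarrow> x < 1 \<Longrightarrow> rep01 (circle_of x) = x"
  by (rule circle_eq_small) (use rep01_bounds[of "circle_of x"] in auto)

lemma continuous_circle_of: "continuous_on UNIV circle_of"
  by (rule continuous_on_open_vimage[THEN iffD2]) (auto simp: open_circle_def)

lemma open_circle_image: assumes "open U" shows "open (circle_of ` U)"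
proof -
  have "circle_of -` circle_of ` U = (\<Union>n::int. (+) (of_int n) ` U)"
  proof (rule Set.set_eqI)
    fix x
    have "x \<in> circle_of -` circle_of ` U \<longleftrightarrow> (\<exists>u\<in>U. x - u \<in> \<int>)" by (auto simp: circle_eq)
    also have "\<dots> \<longleftrightarrow> (\<exists>n::int. \<exists>u\<in>U. x = of_int n + u)"
    proof
      assume "\<exists>u\<in>U. x - u \<in> \<int>"
      then obtain u n where "u \<in> U" "x - u = of_int n" by (auto elim: Ints_cases)
      then show "\<exists>n::int. \<exists>u\<in>U. x = of_int n + u" by (intro exI[of _ n] bexI[of _ u]) auto
    next
      assume "\<exists>n::int. \<exists>u\<in>U. x = of_int n + u"
      then obtain n u where "u \<in> U" "x = of_int n + u" by blast
      then show "\<exists>u\<in>U. x - u \<in> \<int>" by (intro bexI[of _ u]) auto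
    qed
    finally show "x \<in> circle_of -` circle_of ` U \<longleftrightarrow> x \<in> (\<Union>n::int. (+) (of_int n) ` U)" by auto
  qed
  then show ?thesis unfolding open_circle_def using assms by (auto intro!: open_UN open_translation)
qed

lemma circle_surj: obtains x where "z = circle_of x" "0 \<le> x" "x < 1"
  using that[of "rep01 z"] rep01_bounds by simp

instance circle :: t2_space
proof
  fix p q :: circle assume "p \<noteq> q"
  obtain x where x: "p = circle_of x" "0 \<le> x" "x < 1" by (rule circle_surj)
  obtain y where y: "q = circle_of y" "0 \<le> y" "y < 1" by (rule circle_surj)
  have d: "0 < \<bar>x - y\<bar>" "\<bar>x - y\<bar> < 1" using x y \<open>p \<noteq> q\<close> by auto
  define e where "e = min \<bar>x - y\<bar> (1 - \<bar>x - y\<bar>) / 2"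
  have e: "0 < e" unfolding e_def using d by simp
  have "circle_of ` ball x e \<inter> circle_of ` ball y e = {}"
  proof (rule ccontr)
    assume "\<not> ?thesis"
    then obtain a b where ab: "\<bar>x - a\<bar> < e" "\<bar>y - b\<bar> < e" "a - b \<in> \<int>"
    proof -
      obtain z where "z \<in> circle_of ` ball x e" "z \<in> circle_of ` ball y e"
        using \<open>\<not> circle_of ` ball x e \<inter> circle_of ` ball y e = {}\<close> by blast
      then obtain a b where "z = circle_of a" "a \<in> ball x e" "z = circle_of b" "b \<in> ball y e" by blast
      then show ?thesis using that[of a b] by (simp add: dist_real_def circle_eq[symmetric])
    qed
    then obtain n :: int where n: "a - b = of_int n" by (auto elim: Ints_cases)
    have "(x - y) - of_int n = (x - a) - (y - b)" using n by simp
    then have "\<bar>(x - y) - of_int n\<bar> < 2 * e" using abs_triangle_ineq4[of "x - a" "y - b"] ab by linarith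
    then have n2: "\<bar>(x - y) - of_int n\<bar> < \<bar>x - y\<bar>" "\<bar>(x - y) - of_int n\<bar> < 1 - \<bar>x - y\<bar>"
      unfolding e_def by auto
    have "\<bar>of_int n :: real\<bar> \<le> \<bar>(x - y) - of_int n\<bar> + \<bar>x - y\<bar>" by linarith
    with n2 have "\<bar>of_int n :: real\<bar> < 1" by linarith
    then have "n = 0" by linarith
    then show False using n2 by simp
  qed
  then show "\<exists>U V. open U \<and> open V \<and> p \<in> U \<and> q \<in> V \<and> U \<inter> V = {}"
    using open_circle_image[of "ball x e"] open_circle_image[of "ball y e"] x y e
    by (intro exI[of _ "circle_of ` ball x e"] exI[of _ "circle_of ` ball y e"]) auto
qed

lemma compact_circle: "compact (UNIV :: circle set)"
proof -
  have "circle_of ` {0..1} = UNIV"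
    by (auto intro!: image_eqI[of _ _ "rep01 _"] simp: rep01_bounds less_imp_le)
  then show ?thesis
    using compact_continuous_image[OF continuous_on_subset[OF continuous_circle_of subset_UNIV], of "{0..1}"] by simp
qed

text \<open>
  The two inverse branches of the doubling map. The cone of \<open>w\<close> is the half-open arc from \<open>0.w\<close> to
  \<open>0.w + 2\<^sup>-\<^sup>n\<close>, where \<open>n\<close> is the length of \<open>w\<close>.
\<close>

definition ycirc :: "bool \<Rightarrow> circle \<Rightarrow> circle" where
  "ycirc a z = circle_of ((of_bool a + rep01 z) / 2)"

interpretation circ: dyad ycirc
proof
  fix a b x z assume h: "ycirc a x = ycirc b z"
  have "(of_bool a + rep01 x) / 2 = (of_bool b + rep01 z) / 2"
  proof (rule circle_eq_small)
    show "circle_of ((of_bool a + rep01 x) / 2) = circle_of ((of_bool b + rep01 z) / 2)" using h unfolding ycirc_def .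
    show "\<bar>(of_bool a + rep01 x) / 2 - (of_bool b + rep01 z) / 2\<bar> < 1"
      using rep01_bounds[of x] rep01_bounds[of z] by (cases a; cases b) (auto simp: abs_if field_simps)
  qed
  then have "a = b \<and> rep01 x = rep01 z"
    using rep01_bounds[of x] rep01_bounds[of z] by (cases a; cases b) auto
  then show "a = b \<and> x = z" by (metis circle_of_rep01)
next
  fix x
  have "ycirc False (circle_of (2 * rep01 x)) = x" if "rep01 x < 1 / 2"
    unfolding ycirc_def using that rep01_bounds[of x] by (simp add: rep01_circle_of)
  moreover have "ycirc True (circle_of (2 * rep01 x - 1)) = x" if "\<not> rep01 x < 1 / 2"
    unfolding ycirc_def using that rep01_bounds[of x] by (simp add: rep01_circle_of)
  ultimately show "\<exists>a z. x = ycirc a z" by metis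
qed

text \<open>
  The number with binary expansion \<open>0.w\<close>.
\<close>

fun wval :: "bool list \<Rightarrow> real" where
  "wval [] = 0"
| "wval (a # w) = (of_bool a + wval w) / 2"

lemma wval_bounds: "0 \<le> wval w" "wval w + 1 / 2 ^ length w \<le> 1"
proof -
  have "0 \<le> wval w \<and> wval w + 1 / 2 ^ length w \<le> 1"
  proof (induction w)
    case (Cons a w)
    have "wval (a # w) + 1 / 2 ^ length (a # w) = (of_bool a + (wval w + 1 / 2 ^ length w)) / 2"
      by (simp add: field_simps)
    also have "(of_bool a + (wval w + 1 / 2 ^ length w)) / 2 \<le> (1 + 1) / (2::real)"
      by (intro divide_right_mono add_mono) (use Cons in auto)
    also have "(1 + 1) / (2::real) = 1" by simp
    finally have "wval (a # w) + 1 / 2 ^ length (a # w) \<le> 1" .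
    moreover have "0 \<le> wval (a # w)" using Cons by simp
    ultimately show ?case by blast
  qed simp
  then show "0 \<le> wval w" "wval w + 1 / 2 ^ length w \<le> 1" by auto
qed

lemma wval_less_1: "wval w < 1"
proof -
  have "0 < (1 / 2 ^ length w :: real)" by simp
  then show ?thesis using wval_bounds[of w] by linarith
qed

lemma wval_append: "wval (u @ v) = wval u + wval v / 2 ^ length u"
  by (induction u) (auto simp: field_simps)

lemma wval_replicate_False [simp]: "wval (replicate k False) = 0"
  by (induction k) auto

lemma wval_replicate_True [simp]: "wval (replicate k True) = 1 - 1 / 2 ^ k"
  by (induction k) (auto simp: field_simps)

lemma ycirc_circle_of: "0 \<le> x \<Longrightarrow> x < 1 \<Longrightarrow> ycirc a (circle_of x) = circle_of ((of_bool a + x) / 2)"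
  by (simp add: ycirc_def rep01_circle_of)

lemma circ_W: "0 \<le> t \<Longrightarrow> t < 1 \<Longrightarrow> circ.W w (circle_of t) = circle_of (wval w + t / 2 ^ length w)"
proof (induction w)
  case (Cons a w)
  have "t / 2 ^ length w < 1 / 2 ^ length w" using Cons by (simp add: divide_strict_right_mono)
  then have "0 \<le> wval w + t / 2 ^ length w" "wval w + t / 2 ^ length w < 1"
    using wval_bounds[of w] Cons by (auto intro: add_nonneg_nonneg)
  then have "circ.W (a # w) (circle_of t) = circle_of ((of_bool a + (wval w + t / 2 ^ length w)) / 2)"
    using Cons by (simp add: ycirc_circle_of)
  also have "(of_bool a + (wval w + t / 2 ^ length w)) / 2 = wval (a # w) + t / 2 ^ length (a # w)"
    by (simp add: field_simps)
  finally show ?case .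
qed simp

lemma circ_range: "range (circ.W w) = circle_of ` {wval w..<wval w + 1 / 2 ^ length w}"
proof
  show "range (circ.W w) \<subseteq> circle_of ` {wval w..<wval w + 1 / 2 ^ length w}"
  proof (rule image_subsetI)
    fix z obtain t where "z = circle_of t" "0 \<le> t" "t < 1" by (rule circle_surj)
    then show "circ.W w z \<in> circle_of ` {wval w..<wval w + 1 / 2 ^ length w}"
      by (auto simp: circ_W divide_strict_right_mono intro!: imageI)
  qed
  show "circle_of ` {wval w..<wval w + 1 / 2 ^ length w} \<subseteq> range (circ.W w)"
  proof (rule image_subsetI)
    fix x assume x: "x \<in> {wval w..<wval w + 1 / 2 ^ length w}"
    define t where "t = (x - wval w) * 2 ^ length w"
    have "0 \<le> t" "t < 1" using x unfolding t_def by (auto simp: field_simps)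
    then have "circ.W w (circle_of t) = circle_of x" by (simp add: circ_W t_def)
    then show "circle_of x \<in> range (circ.W w)" by (metis rangeI)
  qed
qed

lemma circ_closure_range: "closure (range (circ.W w)) \<subseteq> circle_of ` {wval w..wval w + 1 / 2 ^ length w}"
proof (rule closure_minimal)
  show "range (circ.W w) \<subseteq> circle_of ` {wval w..wval w + 1 / 2 ^ length w}" unfolding circ_range by auto
  show "closed (circle_of ` {wval w..wval w + 1 / 2 ^ length w})"
    by (intro compact_imp_closed compact_continuous_image continuous_on_subset[OF continuous_circle_of]) auto
qed

lemma wval_at_scale: "wval (at_scale i a) = (1 + wval a) / 2 ^ Suc i"
  unfolding at_scale_def by (simp add: wval_append)

lemma length_at_scale: "length (at_scale i a) = Suc (i + length a)"
  unfolding at_scale_def by simp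

lemma circ_scale_ex: "1 / 2 ^ n \<le> (x::real) \<Longrightarrow> x < 1 \<Longrightarrow> \<exists>i. 1 / 2 ^ Suc i \<le> x \<and> x < 1 / 2 ^ i"
proof (induction n)
  case (Suc n)
  then show ?case by (cases "1 / 2 ^ n \<le> x") auto
qed simp

lemma small_power: "0 < (e::real) \<Longrightarrow> \<exists>n. 1 / 2 ^ n < e"
  using real_arch_pow_inv[of e "1 / 2"] by (auto simp: power_one_over)

lemma power_mono_half: "m \<le> n \<Longrightarrow> 1 / 2 ^ n \<le> (1 / 2 ^ m :: real)"
  by (simp add: frac_le)

interpretation circ: top_dyad ycirc "circle_of 0"
proof
  show "ycirc False (circle_of 0) = circle_of 0" by (simp add: ycirc_def rep01_circle_of)
  show "z = circle_of 0 \<or> (\<exists>i x. z = circ.W (at_scale i []) x)" for z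
  proof (cases "rep01 z = 0")
    case True
    then show ?thesis by (metis circle_of_rep01)
  next
    case False
    then have "0 < rep01 z" using rep01_bounds[of z] by simp
    then obtain n where "1 / 2 ^ n < rep01 z" using small_power by blast
    then obtain i where i: "1 / 2 ^ Suc i \<le> rep01 z" "rep01 z < 1 / 2 ^ i"
      using circ_scale_ex[of n "rep01 z"] rep01_bounds by auto
    have "circle_of (rep01 z) \<in> range (circ.W (at_scale i []))"
      unfolding circ_range using i by (intro imageI) (simp add: wval_at_scale length_at_scale field_simps)
    then show ?thesis by auto
  qed
  show "compact (UNIV :: circle set)" by (rule compact_circle)
  show "\<exists>p. \<forall>U. open U \<longrightarrow> p \<in> U \<longrightarrow> (\<exists>k0. \<forall>k\<ge>k0. range (circ.W (map x [0..<k])) \<subseteq> U)" for x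
  proof -
    define v where "v k = wval (map x [0..<k])" for k
    have mono: "v k \<le> v l \<and> v l \<le> v k + 1 / 2 ^ k" if "k \<le> l" for k l
    proof -
      have "map x [0..<l] = map x [0..<k] @ map x [k..<l]"
        using upt_add_eq_append[of 0 k "l - k"] that by simp
      then have "v l = v k + wval (map x [k..<l]) / 2 ^ k" unfolding v_def by (simp add: wval_append)
      then show ?thesis using wval_bounds[of "map x [k..<l]"] wval_less_1[of "map x [k..<l]"]
        by (auto simp: divide_right_mono less_imp_le)
    qed
    define L where "L = (SUP k. v k)"
    have bdd: "bdd_above (range v)" by (intro bdd_aboveI[of _ 1]) (auto simp: v_def less_imp_le wval_less_1)
    have L: "v k \<le> L \<and> L \<le> v k + 1 / 2 ^ k" for k
    proof
      show "v k \<le> L" unfolding L_def by (rule cSUP_upper[OF _ bdd]) simp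
      show "L \<le> v k + 1 / 2 ^ k" unfolding L_def
      proof (rule cSUP_least)
        show "v l \<le> v k + 1 / 2 ^ k" for l
          using mono[of k l] mono[of l k] by (cases "k \<le> l") (auto intro: order_trans[of _ "v k"])
      qed simp
    qed
    show ?thesis
    proof (intro exI[of _ "circle_of L"] allI impI)
      fix U assume U: "open U" "circle_of L \<in> U"
      then obtain e where e: "0 < e" "ball L e \<subseteq> circle_of -` U"
        unfolding open_circle_def open_contains_ball by blast
      obtain k0 where k0: "1 / 2 ^ k0 < e" using small_power e by blast
      show "\<exists>k0. \<forall>k\<ge>k0. range (circ.W (map x [0..<k])) \<subseteq> U"
      proof (intro exI[of _ k0] allI impI)
        fix k assume "k0 \<le> k"
        then have "1 / 2 ^ k < e" using power_mono_half k0 by (meson order_le_less_trans)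
        then have "{v k..<v k + 1 / 2 ^ k} \<subseteq> ball L e" using L[of k] by (auto simp: dist_real_def abs_if)
        then show "range (circ.W (map x [0..<k])) \<subseteq> U" unfolding circ_range using e(2) by (auto simp: v_def)
      qed
    qed
  qed
  show "\<exists>w. range (circ.W w) \<subseteq> U" if U: "open U" "U \<noteq> {}" for U
  proof -
    obtain z where "z \<in> U" using U by blast
    then obtain e where e: "0 < e" "ball (rep01 z) e \<subseteq> circle_of -` U"
      using U(1) unfolding open_circle_def open_contains_ball by (metis circle_of_rep01 vimageI)
    obtain n where n: "1 / 2 ^ n < e" using small_power e by blast
    obtain w where w: "length w = n" "z \<in> range (circ.W w)"
    proof -
      have "\<exists>w\<in>set (unif n). z \<in> range (circ.W w)"
        using circ.leaf_tiling[OF leaf_unif[of n]] unfolding circ.tiling_def by blast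
      then show ?thesis using that unfolding set_unif by blast
    qed
    then obtain x where x: "z = circle_of x" "wval w \<le> x" "x < wval w + 1 / 2 ^ n" unfolding circ_range by auto
    then have "x = rep01 z" using wval_bounds[of w] w rep01_circle_of[of x] by simp
    then have "{wval w..<wval w + 1 / 2 ^ n} \<subseteq> ball (rep01 z) e" using x n by (auto simp: dist_real_def abs_if)
    then show ?thesis using e(2) w(1) by (intro exI[of _ w]) (auto simp: circ_range)
  qed
  show "\<exists>m0. \<forall>m\<ge>m0. p \<notin> closure (range (circ.W (at_scale m [])))" for p
  proof -
    have "0 < (if rep01 p = 0 then 1 else rep01 p)" using rep01_bounds[of p] by (auto simp: less_le)
    then obtain m0 where m0: "1 / 2 ^ m0 < (if rep01 p = 0 then 1 else rep01 p)" using small_power by blast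
    have "p \<notin> closure (range (circ.W (at_scale m [])))" if "m0 \<le> m" for m
    proof
      assume "p \<in> closure (range (circ.W (at_scale m [])))"
      then obtain x where x: "p = circle_of x" "1 / 2 ^ Suc m \<le> x" "x \<le> 1 / 2 ^ m"
        using circ_closure_range[of "at_scale m []"] by (auto simp: wval_at_scale length_at_scale field_simps)
      have lt: "1 / 2 ^ m < (if rep01 p = 0 then 1 else rep01 p)" using m0 power_mono_half[OF that] by (rule order_le_less_trans[rotated])
      have "(if rep01 p = 0 then 1 else rep01 p) \<le> 1" using rep01_bounds[of p] by auto
      then have "x < 1" using x(3) lt by linarith
      moreover have "0 < x" using x(2) by (rule less_le_trans[rotated]) simp
      ultimately have "rep01 p = x" using x rep01_circle_of by simp
      then show False using lt x \<open>0 < x\<close> by simp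
    qed
    then show ?thesis by blast
  qed
  show "\<exists>M. range (circ.W (replicate M False)) \<subseteq> U" if "open U" "circle_of 0 \<in> U" for U
  proof -
    have "open (circle_of -` U)" "0 \<in> circle_of -` U" using that by (simp_all add: open_circle_def)
    then obtain e where e: "0 < e" "ball 0 e \<subseteq> circle_of -` U"
      unfolding open_contains_ball by blast
    obtain n where n: "1 / 2 ^ n < e" using small_power e by blast
    have sub: "{0..<1 / 2 ^ n} \<subseteq> circle_of -` U"
    proof
      fix x :: real assume "x \<in> {0..<1 / 2 ^ n}"
      then have "0 \<le> x" "x < e" using n by auto
      then have "x \<in> ball 0 e" by (simp add: dist_real_def)
      then show "x \<in> circle_of -` U" using e(2) by (rule subsetD[rotated])
    qed
    have "range (circ.W (replicate n False)) = circle_of ` {0..<1 / 2 ^ n}" by (simp add: circ_range)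
    then show ?thesis using sub by (intro exI[of _ n]) auto
  qed
  show "\<exists>V. open V \<and> circle_of 0 \<in> V \<and> V \<inter> range (circ.W [False]) \<subseteq> range (circ.W (replicate M False))" for M
  proof (intro exI conjI)
    let ?V = "circle_of ` {- (1 / 2 ^ Suc M)<..<1 / 2 ^ Suc M}"
    show "open ?V" by (rule open_circle_image) simp
    show "circle_of 0 \<in> ?V" by (rule imageI) simp
    show "?V \<inter> range (circ.W [False]) \<subseteq> range (circ.W (replicate M False))"
    proof
      fix z assume z: "z \<in> ?V \<inter> range (circ.W [False])"
      then obtain x u where xu: "z = circle_of x" "z = circle_of u" "\<bar>x\<bar> < 1 / 2 ^ Suc M" "0 \<le> u" "u < 1 / 2"
      proof -
        obtain x where x0: "z = circle_of x" "x \<in> {- (1 / 2 ^ Suc M)<..<1 / 2 ^ Suc M}" using z by blast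
        then have x: "z = circle_of x" "- (1 / 2 ^ Suc M) < x" "x < 1 / 2 ^ Suc M" by simp_all
        obtain u where "z = circle_of u" "0 \<le> u" "u < 1 / 2" using z unfolding circ_range by auto
        then show ?thesis using that[of x u] x by (simp add: abs_less_iff)
      qed
      have "1 / 2 ^ Suc M \<le> (1 / 2 :: real)" using power_mono_half[of 1 "Suc M"] by simp
      then have "\<bar>x - u\<bar> < 1" using xu(3-5) by linarith
      then have "x = u" using xu(1,2) by (intro circle_eq_small) auto
      then show "z \<in> range (circ.W (replicate M False))"
        unfolding circ_range using xu by (auto intro!: imageI simp: field_simps)
    qed
  qed
qed

section \<open>Thompson's group on the circle by words\<close>

lemma circle_of_shift: "circle_of x = circle_of y \<Longrightarrow> circle_of (x + s) = circle_of (y + s)"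
  by (simp add: circle_eq)

lemma circle_of_add_int [simp]: "circle_of (x + of_int k) = circle_of x"
  by (simp add: circle_eq)

lemma dyadic_add: assumes "dyadic x" "dyadic y" shows "dyadic (x + y)"
proof -
  obtain a b k l where xy: "x = of_int a / 2 ^ k" "y = of_int b / 2 ^ l" using assms unfolding dyadic_def by blast
  have "x + y = of_int (a * 2 ^ l + b * 2 ^ k) / 2 ^ (k + l)" unfolding xy by (simp add: field_simps power_add)
  then show ?thesis unfolding dyadic_def by blast
qed

lemma dyadic_mult: assumes "dyadic x" "dyadic y" shows "dyadic (x * y)"
proof -
  obtain a b k l where xy: "x = of_int a / 2 ^ k" "y = of_int b / 2 ^ l" using assms unfolding dyadic_def by blast
  have "x * y = of_int (a * b) / 2 ^ (k + l)" unfolding xy by (simp add: field_simps power_add)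
  then show ?thesis unfolding dyadic_def by blast
qed

lemma dyadic_of_int: "dyadic (of_int a)"
  unfolding dyadic_def by (intro exI[of _ a] exI[of _ 0]) simp

lemma dyadic_half_power: "dyadic (1 / 2 ^ k)"
  unfolding dyadic_def by (intro exI[of _ 1] exI[of _ k]) simp

lemma dyadic_power: "dyadic (2 ^ k)"
  using dyadic_of_int[of "2 ^ k"] by simp

lemma dyadic_uminus: "dyadic x \<Longrightarrow> dyadic (- x)"
  using dyadic_mult[OF dyadic_of_int[of "-1"]] by simp

lemma dyadic_diff: "dyadic x \<Longrightarrow> dyadic y \<Longrightarrow> dyadic (x - y)"
  using dyadic_add[OF _ dyadic_uminus] by fastforce

lemma dyadic_powi: "dyadic (2 powi n)"
  using dyadic_power[of "nat n"] dyadic_half_power[of "nat (- n)"]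
  by (cases "0 \<le> n") (simp_all add: power_int_def field_simps)

lemma wval_int: "\<exists>j::int. wval w = of_int j / 2 ^ length w"
proof (induction w)
  case (Cons a w)
  then obtain j :: int where "wval w = of_int j / 2 ^ length w" by blast
  then have "wval (a # w) = of_int (of_bool a * 2 ^ length w + j) / 2 ^ length (a # w)"
    by (simp add: field_simps)
  then show ?case by blast
qed simp

lemma dyadic_wval: "dyadic (wval w)"
  using wval_int unfolding dyadic_def by blast

lemma circle_dyadic_iff: "circle_of x \<in> circle_of ` Collect dyadic \<longleftrightarrow> dyadic x"
proof
  assume "circle_of x \<in> circle_of ` Collect dyadic"
  then obtain y where y: "dyadic y" "x - y \<in> \<int>" by (auto simp: circle_eq)
  then obtain k :: int where "x - y = of_int k" by (auto elim: Ints_cases)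
  then have "x = y + of_int k" by simp
  then show "dyadic x" using dyadic_add y dyadic_of_int by simp
qed simp

lemma circ_word_of_point:
  obtains w x k where "length w = n" "circle_of r = circle_of x" "r = x + of_int k" "wval w \<le> x" "x < wval w + 1 / 2 ^ n"
proof -
  have "\<exists>w\<in>set (unif n). circle_of r \<in> range (circ.W w)"
    using circ.leaf_tiling[OF leaf_unif[of n]] unfolding circ.tiling_def by blast
  then obtain w where w: "length w = n" "circle_of r \<in> range (circ.W w)" unfolding set_unif by blast
  then obtain x where x: "circle_of r = circle_of x" "wval w \<le> x" "x < wval w + 1 / 2 ^ n"
    unfolding circ_range by auto
  then obtain k :: int where "r - x = of_int k" unfolding circle_eq by (auto elim: Ints_cases)
  then show ?thesis using that[of w x k] w x by simp
qed

text \<open>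
  Used to recognize as a cone an arc of length \<open>2\<^sup>-\<^sup>n\<close> that starts at a multiple of \<open>2\<^sup>-\<^sup>n\<close>.
\<close>

lemma circ_word_of_int: "\<exists>w. length w = n \<and> circle_of (wval w) = circle_of (of_int J / 2 ^ n)"
proof -
  obtain w x k where w: "length w = n" "circle_of (of_int J / 2 ^ n) = circle_of x" "of_int J / 2 ^ n = x + of_int k"
    "wval w \<le> x" "x < wval w + 1 / 2 ^ n" by (rule circ_word_of_point)
  obtain j :: int where j: "wval w = of_int j / 2 ^ n" using wval_int[of w] w(1) by blast
  have x: "x = of_int (J - k * 2 ^ n) / 2 ^ n" using w(3) by (simp add: field_simps)
  have "of_int j \<le> (of_int (J - k * 2 ^ n) :: real)" using w(4) unfolding x j by (simp add: divide_le_cancel)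
  moreover have "(of_int (J - k * 2 ^ n) :: real) < of_int j + 1"
    using w(5) unfolding x j by (simp add: divide_less_cancel flip: add_divide_distrib)
  ultimately have "J - k * 2 ^ n = j" by linarith
  then have "x = wval w" unfolding x j by simp
  then show ?thesis using w by auto
qed

lemma adj_wval: "adj a b \<Longrightarrow> wval b = wval a + 1 / 2 ^ length a"
  unfolding adj_def by (auto simp: wval_append field_simps power_add)

lemma wval_0: "wval w = 0 \<Longrightarrow> w = replicate (length w) False"
proof (induction w)
  case (Cons a w)
  then show ?case using wval_bounds(1)[of w] by (cases a) auto
qed simp

lemma wval_1: "wval w + 1 / 2 ^ length w = 1 \<Longrightarrow> w = replicate (length w) True"
proof (induction w)
  case (Cons a w)
  have e: "wval (a # w) + 1 / 2 ^ length (a # w) = (of_bool a + (wval w + 1 / 2 ^ length w)) / 2"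
    by (simp add: field_simps)
  with Cons(2) have "of_bool a + (wval w + 1 / 2 ^ length w) = 2" by simp
  moreover have "wval w + 1 / 2 ^ length w \<le> 1" by (rule wval_bounds)
  ultimately have "a" "wval w + 1 / 2 ^ length w = 1" by (cases a; simp)+
  then show ?case using Cons(1) by simp
qed simp

lemma wval_adj: "wval b = wval a + 1 / 2 ^ length a \<Longrightarrow> adj a b"
proof (induction a arbitrary: b)
  case Nil
  then show ?case using wval_less_1[of b] by simp
next
  case (Cons s a)
  have e: "wval (s # a) + 1 / 2 ^ length (s # a) = (of_bool s + (wval a + 1 / 2 ^ length a)) / 2"
    by (simp add: field_simps)
  have p: "0 < (1 / 2 ^ length a :: real)" by simp
  show ?case
  proof (cases b)
    case Nil
    with Cons(2) have "(of_bool s + (wval a + 1 / 2 ^ length a)) / 2 = 0" unfolding e by simp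
    moreover have "0 \<le> (of_bool s :: real)" by simp
    then have "0 < of_bool s + (wval a + 1 / 2 ^ length a)" using wval_bounds(1)[of a] p by linarith
    ultimately show ?thesis by simp
  next
    case (Cons t b')
    with Cons.prems have *: "of_bool t + wval b' = of_bool s + (wval a + 1 / 2 ^ length a)" unfolding e by simp
    consider "s = t" | "\<not> s" "t" | "s" "\<not> t" by blast
    then show ?thesis
    proof cases
      case 1
      then show ?thesis using * Cons Cons.IH adj_Cons by simp
    next
      case 2
      then have "wval b' = 0" "wval a + 1 / 2 ^ length a = 1"
        using * wval_bounds(1)[of b'] wval_bounds(2)[of a] by auto
      then show ?thesis unfolding Cons adj_def using 2 wval_0[of b'] wval_1[of a] by (metis append_Nil)
    next
      case 3
      then show ?thesis using * wval_bounds(1)[of a] wval_less_1[of b'] p by simp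
    qed
  qed
qed

text \<open>
  Cyclic adjacency is a statement about endpoints of arcs, so every homeomorphism that acts on two
  arcs by prefix replacement preserves it.
\<close>

lemma cadj_iff: "cadj a b \<longleftrightarrow> circle_of (wval b) = circle_of (wval a + 1 / 2 ^ length a)"
proof
  assume "cadj a b"
  then show "circle_of (wval b) = circle_of (wval a + 1 / 2 ^ length a)"
    unfolding cadj_def using adj_wval by (auto simp: circle_eq)
next
  assume "circle_of (wval b) = circle_of (wval a + 1 / 2 ^ length a)"
  then obtain k :: int where k: "wval b - (wval a + 1 / 2 ^ length a) = of_int k"
    unfolding circle_eq by (auto elim: Ints_cases)
  have "0 < (1 / 2 ^ length a :: real)" by simp
  then have "(-2::real) < of_int k" "of_int k < (1::real)"
    using k wval_bounds[of a] wval_bounds[of b] wval_less_1[of b] by linarith+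
  then have "k = 0 \<or> k = -1" by linarith
  then show "cadj a b"
  proof
    assume "k = 0"
    then have "wval b = wval a + 1 / 2 ^ length a" using k by simp
    then show ?thesis using wval_adj unfolding cadj_def by blast
  next
    assume "k = -1"
    then have "wval b = 0" "wval a + 1 / 2 ^ length a = 1"
      using k wval_bounds[of a] wval_bounds[of b] by linarith+
    then show ?thesis using wval_0 wval_1 unfolding cadj_def by metis
  qed
qed

lemma circ_W_0: "circ.W w (circle_of 0) = circle_of (wval w)"
  by (simp add: circ_W)

lemma circ_carries_affine:
  assumes "circ.carries f a u" "x \<in> {wval a..<wval a + 1 / 2 ^ length a}"
  shows "f (circle_of x) = circle_of (wval u + (x - wval a) * 2 ^ length a / 2 ^ length u)"
proof -
  define t where "t = (x - wval a) * 2 ^ length a"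
  have t: "0 \<le> t" "t < 1" "x = wval a + t / 2 ^ length a" using assms(2) unfolding t_def by (auto simp: field_simps)
  have "f (circ.W a (circle_of t)) = circ.W u (circle_of t)" using assms(1) unfolding circ.carries_def by blast
  then have "f (circle_of x) = circle_of (wval u + t / 2 ^ length u)" using t by (simp add: circ_W)
  then show ?thesis unfolding t_def .
qed

lemma circ_carries_I:
  assumes "\<And>t. 0 \<le> t \<Longrightarrow> t < 1 \<Longrightarrow> f (circle_of (wval a + t / 2 ^ length a)) = circle_of (wval u + t / 2 ^ length u)"
  shows "circ.carries f a u"
  unfolding circ.carries_def
proof
  fix z obtain t where "z = circle_of t" "0 \<le> t" "t < 1" by (rule circle_surj)
  then show "f (circ.W a z) = circ.W u z" using assms by (simp add: circ_W)
qed

text \<open>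
  By continuity the affine formula extends to the right end of the arc.
\<close>

lemma circ_carries_affine_closed:
  assumes f: "f \<in> Homeo" and r: "circ.carries f a u" and x: "x \<in> {wval a..wval a + 1 / 2 ^ length a}"
  shows "f (circle_of x) = circle_of (wval u + (x - wval a) * 2 ^ length a / 2 ^ length u)"
proof -
  let ?S = "{x. f (circle_of x) = circle_of (wval u + (x - wval a) * 2 ^ length a / 2 ^ length u)}"
  have cf: "continuous_on UNIV f" using f unfolding Homeo_iff by blast
  have "closed ?S"
    by (intro closed_Collect_eq continuous_on_compose2[OF cf] continuous_on_compose2[OF continuous_circle_of]
        continuous_intros) auto
  moreover have "{wval a..<wval a + 1 / 2 ^ length a} \<subseteq> ?S" using circ_carries_affine[OF r] by blast
  ultimately have "closure {wval a..<wval a + 1 / 2 ^ length a} \<subseteq> ?S" by (rule closure_minimal[rotated])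
  moreover have "closure {wval a..<wval a + 1 / 2 ^ length a} = {wval a..wval a + 1 / 2 ^ length a}"
    by (rule closure_atLeastLessThan) simp
  ultimately show ?thesis using x by blast
qed

lemma circ_carries_end:
  assumes "f \<in> Homeo" "circ.carries f a u"
  shows "f (circle_of (wval a + 1 / 2 ^ length a)) = circle_of (wval u + 1 / 2 ^ length u)"
  using circ_carries_affine_closed[OF assms, of "wval a + 1 / 2 ^ length a"] by simp

lemma circ_carries_start: "circ.carries f a u \<Longrightarrow> f (circle_of (wval a)) = circle_of (wval u)"
  unfolding circ.carries_def by (metis circ_W_0)

lemma circ_cadj_preserved:
  assumes "f \<in> Homeo" "circ.carries f a u" "circ.carries f b v" "cadj a b" shows "cadj u v"
  using circ_carries_end[OF assms(1,2)] circ_carries_start[OF assms(3)] assms(4) unfolding cadj_iff by simp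

lemma cyc_next:
  assumes "cyc P" "i < length P" shows "cadj (P ! i) (P ! (Suc i mod length P))"
proof (cases "length P = 1")
  case True
  then obtain w where P: "P = [w]" by (metis One_nat_def length_0_conv length_Suc_conv)
  obtain A B where AB: "leaf (A @ B)" "P = B @ A" using cycE[OF assms(1)] .
  have "length (A @ B) = 1" using AB(2) True by (metis add.commute length_append)
  then have "A @ B = [[]]" using leaf_length_1[OF AB(1)] by blast
  then have "w = []" using AB(2) P by (auto simp: append_eq_Cons_conv)
  then show ?thesis using P assms(2) by (simp add: cadj_def exI[of _ 0])
next
  case False
  have n: "0 < length P" using assms(2) by linarith
  define R where "R = rotate i P"
  have R: "cyc R" "length R = length P" "2 \<le> length R" using cyc_rotate assms False n unfolding R_def by auto
  then obtain a b M where abM: "R = a # b # M" by (metis Suc_le_length_iff numeral_2_eq_2)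
  have "cadj a b" using cyc_cadj R(1) abM by metis
  moreover have "a = P ! i" using abM nth_rotate[of 0 P i] n assms(2) unfolding R_def by auto
  moreover have "b = P ! (Suc i mod length P)"
    using abM nth_rotate[of 1 P i] R unfolding R_def by (auto simp: add.commute)
  ultimately show ?thesis by simp
qed

text \<open>
  The affine pieces agree at common endpoints because both lists are in cyclic order. Hence the map
  is continuous on each of finitely many closed arcs.
\<close>

lemma circ_cyc_word_homeo:
  assumes P: "cyc P" and Q: "cyc Q" and f: "list_all2 (circ.carries f) P Q"
  shows "f \<in> circ.word_homeo"
proof -
  have len: "length P = length Q" using f by (simp add: list_all2_lengthD)
  have b: "bij f" by (rule circ.realization_bij[OF circ.cyc_tiling[OF P] circ.cyc_tiling[OF Q] f])
  define aff where "aff i x = wval (Q ! i) + (x - wval (P ! i)) * 2 ^ length (P ! i) / 2 ^ length (Q ! i)" for i x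
  have fP: "circ.carries f (P ! i) (Q ! i)" if "i < length P" for i using f that by (simp add: list_all2_conv_all_nth)
  define I where "I i = {wval (P ! i)..wval (P ! i) + 1 / 2 ^ length (P ! i)}" for i
  have aff: "f (circle_of x) = circle_of (aff i x)" if i: "i < length P" and x: "x \<in> I i" for i x
  proof (cases "x = wval (P ! i) + 1 / 2 ^ length (P ! i)")
    case True
    define j where "j = Suc i mod length P"
    have j: "j < length P" unfolding j_def by (rule mod_less_divisor) (use i in linarith)
    have "circle_of x = circle_of (wval (P ! j))"
      using cyc_next[OF P i] unfolding True cadj_iff j_def by simp
    then have "f (circle_of x) = circle_of (wval (Q ! j))" using circ_carries_start[OF fP[OF j]] by simp
    also have "\<dots> = circle_of (wval (Q ! i) + 1 / 2 ^ length (Q ! i))"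
      using cyc_next[OF Q, of i] i unfolding cadj_iff j_def len by simp
    also have "\<dots> = circle_of (aff i x)" unfolding aff_def True by simp
    finally show ?thesis .
  next
    case False
    then show ?thesis unfolding aff_def using x by (intro circ_carries_affine[OF fP[OF i]]) (auto simp: I_def)
  qed
  have "continuous_on UNIV f"
  proof (rule continuous_on_closed_vimage[OF closed_UNIV, THEN iffD2], intro allI impI)
    fix C :: "circle set" assume C: "closed C"
    have "f -` C = (\<Union>i<length P. circle_of ` (I i \<inter> (\<lambda>x. circle_of (aff i x)) -` C))"
    proof (rule Set.set_eqI)
      fix z
      obtain i t where i: "i < length P" "z = circ.W (P ! i) t" using circ.tiling_cover[OF circ.cyc_tiling[OF P]] .
      then have "z \<in> circle_of ` {wval (P ! i)..<wval (P ! i) + 1 / 2 ^ length (P ! i)}" using circ_range by blast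
      then obtain x where x: "z = circle_of x" "x \<in> I i" unfolding I_def by auto
      show "z \<in> f -` C \<longleftrightarrow> z \<in> (\<Union>i<length P. circle_of ` (I i \<inter> (\<lambda>x. circle_of (aff i x)) -` C))"
      proof
        assume "z \<in> f -` C"
        then show "z \<in> (\<Union>i<length P. circle_of ` (I i \<inter> (\<lambda>x. circle_of (aff i x)) -` C))"
          using i(1) x aff[OF i(1) x(2)] by auto
      next
        assume "z \<in> (\<Union>i<length P. circle_of ` (I i \<inter> (\<lambda>x. circle_of (aff i x)) -` C))"
        then obtain i' x' where "i' < length P" "z = circle_of x'" "x' \<in> I i'" "circle_of (aff i' x') \<in> C" by blast
        then show "z \<in> f -` C" using aff[of i' x'] by simp
      qed
    qed
    moreover have "closed (circle_of ` (I i \<inter> (\<lambda>x. circle_of (aff i x)) -` C))" for i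
    proof -
      have "continuous_on UNIV (\<lambda>x. circle_of (aff i x))"
        unfolding aff_def by (intro continuous_on_compose2[OF continuous_circle_of] continuous_intros) auto
      then have "closed ((\<lambda>x. circle_of (aff i x)) -` C)" using C by (simp add: closed_vimage)
      then have "compact (I i \<inter> (\<lambda>x. circle_of (aff i x)) -` C)" unfolding I_def by (intro compact_Int_closed) auto
      then show ?thesis
        by (intro compact_imp_closed compact_continuous_image continuous_on_subset[OF continuous_circle_of]) auto
    qed
    ultimately show "closed (f -` C \<inter> UNIV)" by (auto intro: closed_UN)
  qed
  then have "f \<in> Homeo" by (rule Homeo_compactI[OF compact_circle b])
  then show ?thesis unfolding circ.word_homeo_def using circ.wordlike_of_list[OF circ.cyc_tiling[OF P] f] by blast
qed

lemma grid_avoids: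
  assumes b: "b \<in> circle_of ` Collect dyadic"
  shows "eventually (\<lambda>m. \<forall>w. length w = m \<longrightarrow> b \<notin> circle_of ` {wval w<..<wval w + 1 / 2 ^ m}) sequentially"
proof -
  obtain c :: int and k where c: "b = circle_of (of_int c / 2 ^ k)" using b unfolding dyadic_def by auto
  have "b \<notin> circle_of ` {wval w<..<wval w + 1 / 2 ^ m}" if "k \<le> m" and lw: "length w = m" for m w
  proof
    assume "b \<in> circle_of ` {wval w<..<wval w + 1 / 2 ^ m}"
    then obtain x where x: "b = circle_of x" "wval w < x" "x < wval w + 1 / 2 ^ m" by auto
    then obtain r :: int where r: "of_int c / 2 ^ k - x = of_int r" using c unfolding circle_eq by (metis Ints_cases circle_eq)
    obtain j :: int where j: "wval w = of_int j / 2 ^ m" using wval_int[of w] lw by blast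
    have "(2::real) ^ m = 2 ^ k * 2 ^ (m - k)" using that by (simp flip: power_add)
    then have xe: "x = of_int (c * 2 ^ (m - k) - r * 2 ^ m) / 2 ^ m" using r by (simp add: field_simps)

    define X where "X = c * 2 ^ (m - k) - r * 2 ^ m"
    have "(of_int j :: real) < of_int X"
      using x(2) unfolding j xe X_def[symmetric] by (simp add: divide_less_cancel)
    moreover have "(of_int X :: real) < of_int j + 1"
      using x(3) unfolding j xe X_def[symmetric] by (simp add: divide_less_cancel flip: add_divide_distrib)
    ultimately have "real_of_int j < real_of_int X" "real_of_int X < real_of_int (j + 1)" by simp_all
    then have "j < X" "X < j + 1" by (simp_all only: of_int_less_iff)
    then show False by simp
  qed
  then show ?thesis unfolding eventually_sequentially by blast
qed

lemma ThompsonT_breakpoints: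
  assumes "f \<in> ThompsonT"
  shows "\<exists>B. finite B \<and> B \<subseteq> circle_of ` Collect dyadic \<and> (\<forall>s t. s < t \<longrightarrow> circle_of ` {s<..<t} \<inter> B = {} \<longrightarrow>
        (\<exists>(n::int) b. dyadic b \<and> (\<forall>x\<in>{s..t}. f (circle_of x) = circle_of (2 powi n * x + b))))"
  using assms unfolding ThompsonT_def mem_Collect_eq imp_conjL by (rule conjunct2)

text \<open>
  Deep dyadic arcs contain no breakpoint in their interior. On such an arc the map is affine with
  dyadic coefficients, and on still deeper arcs the image arc is a standard dyadic one. The depth
  is uniform by Koenig's lemma.
\<close>

lemma ThompsonT_wordlike:
  assumes "f \<in> ThompsonT" shows "circ.wordlike f"
proof (rule circ.wordlike_koenig)
  fix x :: "nat \<Rightarrow> bool"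
  obtain B where BB: "finite B \<and> B \<subseteq> circle_of ` Collect dyadic \<and> (\<forall>s t. s < t \<longrightarrow> circle_of ` {s<..<t} \<inter> B = {} \<longrightarrow>
        (\<exists>(n::int) b. dyadic b \<and> (\<forall>x\<in>{s..t}. f (circle_of x) = circle_of (2 powi n * x + b))))"
    using ThompsonT_breakpoints[OF assms] ..
  then have B: "finite B" "B \<subseteq> circle_of ` Collect dyadic" by simp_all
  note B3 = BB[THEN conjunct2, THEN conjunct2, rule_format]
  have "eventually (\<lambda>m. \<forall>b\<in>B. \<forall>w. length w = m \<longrightarrow> b \<notin> circle_of ` {wval w<..<wval w + 1 / 2 ^ m}) sequentially"
    by (intro eventually_ball_finite[OF B(1)] ballI grid_avoids subsetD[OF B(2)])
  then obtain m where mm: "\<forall>n\<ge>m. \<forall>b\<in>B. \<forall>w. length w = n \<longrightarrow> b \<notin> circle_of ` {wval w<..<wval w + 1 / 2 ^ n}"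
    unfolding eventually_sequentially by blast
  have m: "b \<notin> circle_of ` {wval w<..<wval w + 1 / 2 ^ m}" if "b \<in> B" "length w = m" for b w
    by (rule mm[rule_format, OF order_refl that])
  define w where "w = map x [0..<m]"
  have lw: "length w = m" unfolding w_def by simp
  have "circle_of ` {wval w<..<wval w + 1 / 2 ^ m} \<inter> B = {}" using m lw by blast
  then obtain n :: int and b where nb: "dyadic b"
    "\<And>x. x \<in> {wval w..wval w + 1 / 2 ^ m} \<Longrightarrow> f (circle_of x) = circle_of (2 powi n * x + b)"
    using B3[of "wval w" "wval w + 1 / 2 ^ m"] by auto
  obtain c :: int and k where c: "b = of_int c / 2 ^ k" using nb(1) unfolding dyadic_def by blast
  \<comment> \<open>An arc of length \<open>2\<^sup>-\<^sup>L\<close> is mapped to one of length \<open>2\<^sup>n\<^sup>-\<^sup>L\<close>. With \<open>L\<close> so large the number \<open>N = L - n\<close>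
    is at least \<open>k\<close>, so the image starts at a multiple of \<open>2\<^sup>-\<^sup>N\<close>.\<close>
  define L where "L = m + (k + nat \<bar>n\<bar>)"
  define N where "N = nat (int L - n)"
  have N: "int N = int L - n" "k \<le> N" unfolding N_def L_def by auto
  define v where "v = map x [0..<L]"
  have lv: "length v = L" unfolding v_def by simp
  have vw: "v = w @ map x [m..<L]" unfolding v_def w_def L_def by (metis le_add1 upt_add_eq_append map_append zero_le)
  obtain j :: int where j: "wval v = of_int j / 2 ^ L" using wval_int[of v] lv by blast
  have "n = int L - int N" using N by simp
  then have p: "2 powi n = (2 ^ L / 2 ^ N :: real)" by (simp add: power_int_diff)
  define J where "J = j + c * 2 ^ (N - k)"
  have "(2::real) ^ N = 2 ^ k * 2 ^ (N - k)" using N by (simp flip: power_add)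
  then have J: "2 powi n * wval v + b = of_int J / 2 ^ N" unfolding p j c J_def by (simp add: field_simps)
  obtain u where u: "length u = N" "circle_of (wval u) = circle_of (of_int J / 2 ^ N)" using circ_word_of_int by blast
  have "circ.carries f v u"
  proof (rule circ_carries_I)
    fix t :: real assume t: "0 \<le> t" "t < 1"
    let ?v' = "map x [m..<L]"
    have l': "length ?v' = L - m" "L = m + (L - m)" unfolding L_def by auto
    have p2: "(2::real) ^ L = 2 ^ m * 2 ^ (L - m)" using l'(2) by (metis power_add)
    have e: "wval v + t / 2 ^ L = wval w + (wval ?v' + t / 2 ^ (L - m)) / 2 ^ m"
      unfolding vw wval_append lw p2 by (simp add: field_simps)
    have "t / 2 ^ (L - m) \<le> 1 / 2 ^ (L - m)" using t by (simp add: divide_right_mono)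
    then have "0 \<le> wval ?v' + t / 2 ^ (L - m)" "wval ?v' + t / 2 ^ (L - m) \<le> 1"
      using wval_bounds[of ?v'] t l'(1) by (auto intro: add_nonneg_nonneg)
    then have "wval v + t / 2 ^ L \<in> {wval w..wval w + 1 / 2 ^ m}" unfolding e by (auto simp: divide_right_mono)
    then have "f (circle_of (wval v + t / 2 ^ L)) = circle_of (2 powi n * (wval v + t / 2 ^ L) + b)" by (rule nb(2))
    also have "2 powi n * (wval v + t / 2 ^ L) + b = of_int J / 2 ^ N + t / 2 ^ N"
      unfolding J[symmetric] p by (simp add: field_simps)
    also have "circle_of \<dots> = circle_of (wval u + t / 2 ^ N)" by (rule circle_of_shift[OF u(2)[symmetric]])
    finally show "f (circle_of (wval v + t / 2 ^ length v)) = circle_of (wval u + t / 2 ^ length u)"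
      using lv u(1) by simp
  qed
  then show "\<exists>k u. circ.carries f (map x [0..<k]) u" unfolding v_def by blast
qed

text \<open>
  The endpoints of the arcs of a fixed depth serve as breakpoints.
\<close>

lemma word_homeo_ThompsonT:
  assumes "f \<in> circ.word_homeo" shows "f \<in> ThompsonT"
proof -
  have fH: "f \<in> Homeo" using assms circ.word_homeo_Homeo by blast
  obtain n where n: "\<And>w. n \<le> length w \<Longrightarrow> \<exists>u. circ.carries f w u"
    using assms unfolding circ.word_homeo_def circ.wordlike_def by blast
  define B where "B = (\<lambda>w. circle_of (wval w)) ` set (unif n)"
  have "finite B" unfolding B_def by simp
  moreover have "B \<subseteq> circle_of ` Collect dyadic" unfolding B_def using dyadic_wval by auto
  moreover have "\<exists>(l::int) b. dyadic b \<and> (\<forall>x\<in>{s..t}. f (circle_of x) = circle_of (2 powi l * x + b))"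
    if st: "s < t" "circle_of ` {s<..<t} \<inter> B = {}" for s t
  proof -
    obtain w x k where w: "length w = n" "circle_of ((s + t) / 2) = circle_of x" "(s + t) / 2 = x + of_int k"
      "wval w \<le> x" "x < wval w + 1 / 2 ^ n" by (rule circ_word_of_point)
    have inB: "circle_of (wval w') \<in> B" if "length w' = n" for w' unfolding B_def set_unif using that by blast
    have 1: "wval w + of_int k \<le> s"
    proof (rule ccontr)
      assume "\<not> ?thesis"
      then have "wval w + of_int k \<in> {s<..<t}" using w(3,4) st(1) by auto
      then have "circle_of (wval w) \<in> circle_of ` {s<..<t}" by (metis circle_of_add_int imageI)
      then show False using inB[OF w(1)] st(2) by blast
    qed
    have 2: "t \<le> wval w + 1 / 2 ^ n + of_int k"
    proof (rule ccontr)
      assume "\<not> ?thesis"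
      then have "wval w + 1 / 2 ^ n + of_int k \<in> {s<..<t}" using w(3,5) st(1) by auto
      then have "circle_of (wval w + 1 / 2 ^ n) \<in> circle_of ` {s<..<t}" by (metis circle_of_add_int imageI)
      moreover obtain j :: int where "wval w = of_int j / 2 ^ n" using wval_int[of w] w(1) by blast
      then have "wval w + 1 / 2 ^ n = of_int (j + 1) / 2 ^ n" by (simp add: add_divide_distrib)
      then obtain w' where "length w' = n" "circle_of (wval w') = circle_of (wval w + 1 / 2 ^ n)"
        using circ_word_of_int[of n "j + 1"] by auto
      ultimately show False using inB[of w'] st(2) by (metis IntI empty_iff)
    qed
    obtain u where u: "circ.carries f w u" using n w(1) by blast
    define b where "b = wval u - (of_int k + wval w) * (2 ^ n * (1 / 2 ^ length u))"
    have "dyadic b" unfolding b_def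
      by (intro dyadic_diff dyadic_mult dyadic_add dyadic_wval dyadic_of_int dyadic_power dyadic_half_power)
    moreover have "f (circle_of x') = circle_of (2 powi (int n - int (length u)) * x' + b)" if x': "x' \<in> {s..t}" for x'
    proof -
      have "circle_of x' = circle_of (x' - of_int k)" using circle_of_add_int[of "x' - of_int k" k] by simp
      also have "f \<dots> = circle_of (wval u + (x' - of_int k - wval w) * 2 ^ n / 2 ^ length u)"
        using circ_carries_affine_closed[OF fH u, of "x' - of_int k"] x' 1 2 w(1) by auto
      also have "wval u + (x' - of_int k - wval w) * 2 ^ n / 2 ^ length u = 2 powi (int n - int (length u)) * x' + b"
        unfolding b_def by (simp add: power_int_diff field_simps)
      finally show ?thesis .
    qed
    ultimately show ?thesis by blast
  qed
  ultimately have "finite B \<and> B \<subseteq> circle_of ` Collect dyadic \<and> (\<forall>s t. s < t \<and> circle_of ` {s<..<t} \<inter> B = {} \<longrightarrow>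
        (\<exists>(n::int) b. dyadic b \<and> (\<forall>x\<in>{s..t}. f (circle_of x) = circle_of (2 powi n * x + b))))"
    by simp
  then have "\<exists>B. finite B \<and> B \<subseteq> circle_of ` Collect dyadic \<and> (\<forall>s t. s < t \<and> circle_of ` {s<..<t} \<inter> B = {} \<longrightarrow>
        (\<exists>(n::int) b. dyadic b \<and> (\<forall>x\<in>{s..t}. f (circle_of x) = circle_of (2 powi n * x + b))))"
    by (rule exI[of _ B])
  then show ?thesis unfolding ThompsonT_def using fH by simp
qed

theorem ThompsonT_eq: "ThompsonT = circ.word_homeo"
proof
  have "ThompsonT \<subseteq> Homeo" unfolding ThompsonT_def by (rule Collect_subset[THEN order_trans]) simp
  then show "ThompsonT \<subseteq> circ.word_homeo" using ThompsonT_wordlike unfolding circ.word_homeo_def by blast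
qed (use word_homeo_ThompsonT in blast)

section \<open>Circle homeomorphisms with doubling-equivariant germs\<close>

abbreviation "circ0 \<equiv> circle_of 0"
abbreviation "dyadic_pts \<equiv> circle_of ` Collect dyadic"
abbreviation "Tsing \<equiv> sing ThompsonT"

lemma circle_continuousI: "continuous_on UNIV (\<lambda>x. f (circle_of x)) \<Longrightarrow> continuous_on UNIV (f :: circle \<Rightarrow> 'b::topological_space)"
  by (auto simp: continuous_on_open_vimage open_circle_def vimage_def)

lemma circle_L_eq: "circle_L (circle_of a) (circle_of x) = circle_of (2 * x - a)"
  using circle_L_circle_of[of a "x - a"] by (simp add: algebra_simps)

lemma circle_L_fixed [simp]: "circle_L p p = p"
  by (rule circle_surj[of p]) (simp add: circle_L_eq)

lemma circle_L_continuous: "continuous_on UNIV (circle_L p)"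
proof -
  obtain a where "p = circle_of a" by (rule circle_surj)
  then show ?thesis
    by (intro circle_continuousI)
      (simp add: circle_L_eq, intro continuous_on_compose2[OF continuous_circle_of] continuous_intros, auto)
qed

lemma circle_L_tendsto: "filterlim (circle_L p) (nhds p) (nhds p)"
proof (rule topological_tendstoI)
  fix S assume S: "open S" "p \<in> S"
  have "open (circle_L p -` S)" using circle_L_continuous S(1) open_vimage by blast
  then show "eventually (\<lambda>x. circle_L p x \<in> S) (nhds p)"
    unfolding eventually_nhds using S(2) by (intro exI[of _ "circle_L p -` S"]) auto
qed

text \<open>
  The condition that \<open>TA\<close> imposes at singular points. Elements of \<open>T\<close> satisfy it at every point, being
  affine on both sides; so \<open>TA\<close> may be defined by requiring it everywhere, and in
  this form it is visibly stable under composition and inversion.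
\<close>

definition equiv_at :: "(circle \<Rightarrow> circle) \<Rightarrow> circle \<Rightarrow> bool" where
  "equiv_at f p \<longleftrightarrow> germ_eq p (circle_L (f p) \<circ> f) (f \<circ> circle_L p)"

lemma equiv_at_comp:
  assumes "equiv_at g p" "equiv_at f (g p)" "g \<in> Homeo" shows "equiv_at (f \<circ> g) p"
proof -
  have "germ_eq p ((circle_L (f (g p)) \<circ> f) \<circ> g) ((f \<circ> circle_L (g p)) \<circ> g)"
    by (rule germ_eq_right[OF _ Homeo_tendsto[OF assms(3)]]) (use assms(2) in \<open>simp add: equiv_at_def\<close>)
  moreover have "germ_eq p (f \<circ> (circle_L (g p) \<circ> g)) (f \<circ> (g \<circ> circle_L p))"
    by (rule germ_eq_left) (use assms(1) in \<open>simp add: equiv_at_def\<close>)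
  ultimately show ?thesis unfolding equiv_at_def using germ_eq_trans by (metis comp_apply comp_assoc)
qed

lemma equiv_at_inv:
  assumes "equiv_at f p" "f \<in> Homeo" shows "equiv_at (finv f) (f p)"
proof -
  have b: "bij f" using assms Homeo_bij by blast
  obtain U where U: "open U" "p \<in> U" "\<And>x. x \<in> U \<Longrightarrow> (circle_L (f p) \<circ> f) x = (f \<circ> circle_L p) x"
    using germ_eqE assms(1) unfolding equiv_at_def by blast
  have "open (finv f -` U)" using Homeo_open_vimage[OF Homeo_inv[OF assms(2)] U(1)] .
  then show ?thesis unfolding equiv_at_def
  proof (rule germ_eqI)
    show "f p \<in> finv f -` U" using U(2) b by simp
    fix z assume "z \<in> finv f -` U"
    then have "circle_L (f p) z = f (circle_L p (finv f z))" using U(3)[of "finv f z"] b by simp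
    then show "(circle_L (finv f (f p)) \<circ> finv f) z = (finv f \<circ> circle_L (f p)) z" using b by simp
  qed
qed

lemma equiv_at_cong: assumes "germ_eq p f t" "equiv_at t p" shows "equiv_at f p"
proof -
  have e: "f p = t p" by (rule germ_eq_at[OF assms(1)])
  have "germ_eq p (circle_L (t p) \<circ> f) (circle_L (t p) \<circ> t)" by (rule germ_eq_left[OF assms(1)])
  moreover have "germ_eq p (t \<circ> circle_L p) (f \<circ> circle_L p)"
    by (rule germ_eq_right) (simp_all add: germ_eq_sym[OF assms(1)] circle_L_tendsto)
  ultimately show ?thesis using assms(2) germ_eq_trans unfolding equiv_at_def e by blast
qed

lemma circle_gap:
  assumes "finite B" shows "\<exists>e>0. circle_of ` {x<..<x + e} \<inter> B = {} \<and> circle_of ` {x - e<..<x} \<inter> B = {}"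
proof -
  have "closed (B - {circle_of x})" using assms by (simp add: finite_imp_closed)
  then have "open (circle_of -` (- (B - {circle_of x})))" using open_circle_def by blast
  moreover have "x \<in> circle_of -` (- (B - {circle_of x}))" by simp
  ultimately obtain e where e: "0 < e" "ball x e \<subseteq> circle_of -` (- (B - {circle_of x}))"
    unfolding open_contains_ball by blast
  define d where "d = min e (1 / 2)"
  have d: "0 < d" "d \<le> e" "d \<le> 1 / 2" unfolding d_def using e by auto
  have "circle_of y \<notin> B" if "y \<noteq> x" "\<bar>y - x\<bar> < d" for y
  proof -
    have "y \<in> ball x e" using that d by (simp add: dist_real_def abs_minus_commute)
    then have "circle_of y \<notin> B - {circle_of x}" using e by blast
    moreover have "circle_of y \<noteq> circle_of x" using circle_eq_small[of y x] that d by auto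
    ultimately show ?thesis by blast
  qed
  then show ?thesis using d(1) by (intro exI[of _ d]) auto
qed

lemma ThompsonT_local:
  assumes "f \<in> ThompsonT"
  shows "\<exists>e>0. \<exists>n n' :: int. \<exists>b b'. dyadic b \<and> dyadic b' \<and>
    (\<forall>y\<in>{x..x + e}. f (circle_of y) = circle_of (2 powi n * y + b)) \<and>
    (\<forall>y\<in>{x - e..x}. f (circle_of y) = circle_of (2 powi n' * y + b'))"
proof -
  obtain B where BB: "finite B \<and> B \<subseteq> circle_of ` Collect dyadic \<and> (\<forall>s t. s < t \<longrightarrow> circle_of ` {s<..<t} \<inter> B = {} \<longrightarrow>
        (\<exists>(n::int) b. dyadic b \<and> (\<forall>x\<in>{s..t}. f (circle_of x) = circle_of (2 powi n * x + b))))"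
    using ThompsonT_breakpoints[OF assms] ..
  note B3 = BB[THEN conjunct2, THEN conjunct2, rule_format]
  obtain e where e: "0 < e" "circle_of ` {x<..<x + e} \<inter> B = {}" "circle_of ` {x - e<..<x} \<inter> B = {}"
    using circle_gap[OF conjunct1[OF BB], of x] by blast
  have lt: "x < x + e" "x - e < x" using e(1) by simp_all
  obtain n b where n: "dyadic b" "\<forall>y\<in>{x..x + e}. f (circle_of y) = circle_of (2 powi n * y + b)"
    using B3[OF lt(1) e(2)] by blast
  obtain n' b' where n': "dyadic b'" "\<forall>y\<in>{x - e..x}. f (circle_of y) = circle_of (2 powi n' * y + b')"
    using B3[OF lt(2) e(3)] by blast
  show ?thesis
    by (rule exI[of _ e], intro conjI e(1), rule exI[of _ n], rule exI[of _ n'], rule exI[of _ b], rule exI[of _ b'])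
      (intro conjI n n')
qed

lemma ThompsonT_equiv_at: assumes "f \<in> ThompsonT" shows "equiv_at f p"
proof -
  obtain x where x: "p = circle_of x" by (rule circle_surj)
  obtain e n n' b b' where e: "0 < e" "\<And>y. y \<in> {x..x + e} \<Longrightarrow> f (circle_of y) = circle_of (2 powi n * y + b)"
    "\<And>y. y \<in> {x - e..x} \<Longrightarrow> f (circle_of y) = circle_of (2 powi n' * y + b')"
    using ThompsonT_local[OF assms, of x] by blast
  show ?thesis unfolding equiv_at_def
  proof (rule germ_eqI)
    show "open (circle_of ` {x - e / 2<..<x + e / 2})" by (rule open_circle_image) simp
    show "p \<in> circle_of ` {x - e / 2<..<x + e / 2}" unfolding x using e(1) by (intro imageI) auto
    fix z assume "z \<in> circle_of ` {x - e / 2<..<x + e / 2}"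
    then obtain y where y: "z = circle_of y" "x - e / 2 < y" "y < x + e / 2" by auto
    show "(circle_L (f p) \<circ> f) z = (f \<circ> circle_L p) z"
    proof (cases "x \<le> y")
      case True
      then have "f z = circle_of (2 powi n * y + b)" "f p = circle_of (2 powi n * x + b)"
        "f (circle_of (2 * y - x)) = circle_of (2 powi n * (2 * y - x) + b)"
        using y e(1) x by (auto intro!: e(2))
      then show ?thesis unfolding x y by (simp add: circle_L_eq algebra_simps)
    next
      case False
      then have "f z = circle_of (2 powi n' * y + b')" "f p = circle_of (2 powi n' * x + b')"
        "f (circle_of (2 * y - x)) = circle_of (2 powi n' * (2 * y - x) + b')"
        using y e(1) x by (auto intro!: e(3))
      then show ?thesis unfolding x y by (simp add: circle_L_eq algebra_simps)
    qed
  qed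
qed

lemma ThompsonT_dyadic: assumes "f \<in> ThompsonT" shows "f p \<in> dyadic_pts \<longleftrightarrow> p \<in> dyadic_pts"
proof -
  obtain x where x: "p = circle_of x" by (rule circle_surj)
  obtain e n b where e: "0 < e" "dyadic b" "\<And>y. y \<in> {x..x + e} \<Longrightarrow> f (circle_of y) = circle_of (2 powi n * y + b)"
    using ThompsonT_local[OF assms, of x] by blast
  have "f p = circle_of (2 powi n * x + b)" unfolding x using e(1) by (intro e(3)) simp
  moreover have "dyadic (2 powi n * x + b) \<longleftrightarrow> dyadic x"
  proof
    assume "dyadic (2 powi n * x + b)"
    then have "dyadic (2 powi (- n) * (2 powi n * x + b - b))"
      by (intro dyadic_mult dyadic_powi dyadic_diff e(2))
    then show "dyadic x" by (simp add: power_int_minus field_simps)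
  qed (intro dyadic_add dyadic_mult dyadic_powi e(2))
  ultimately show ?thesis unfolding x by (simp only: circle_dyadic_iff)
qed

lemma TA_iff: "f \<in> TA \<longleftrightarrow> f \<in> Homeo \<and> finite (Tsing f) \<and> Tsing f \<subseteq> dyadic_pts \<and> (\<forall>p. equiv_at f p)"
proof
  assume f: "f \<in> TA"
  have "equiv_at f p" for p
  proof (cases "p \<in> Tsing f")
    case True
    then show ?thesis using f unfolding TA_def equiv_at_def by blast
  next
    case False
    then obtain t where "t \<in> ThompsonT" "germ_eq p f t" unfolding sing_def by blast
    then show ?thesis using equiv_at_cong ThompsonT_equiv_at by blast
  qed
  then show "f \<in> Homeo \<and> finite (Tsing f) \<and> Tsing f \<subseteq> dyadic_pts \<and> (\<forall>p. equiv_at f p)"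
    using f unfolding TA_def by simp
qed (simp add: TA_def equiv_at_def)

lemma TA_Homeo: "f \<in> TA \<Longrightarrow> f \<in> Homeo" by (simp add: TA_iff)

lemma ThompsonT_TA: "f \<in> ThompsonT \<Longrightarrow> f \<in> TA"
  using ThompsonT_equiv_at sing_self[of f ThompsonT] circ.word_homeo_Homeo unfolding TA_iff ThompsonT_eq by auto

text \<open>
  Only a singular point \<open>p\<close> needs an argument. For a small dyadic \<open>h\<close> the points \<open>p + h\<close> and
  \<open>p + 2h\<close> are regular, so their images \<open>v\<close> and \<open>v'\<close> are dyadic, and the relation
  \<open>v' = 2v - f(p)\<close> makes \<open>f(p)\<close> dyadic as well.
\<close>

lemma TA_dyadic: assumes f: "f \<in> TA" shows "f p \<in> dyadic_pts \<longleftrightarrow> p \<in> dyadic_pts"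
proof -
  have reg: "f q \<in> dyadic_pts \<longleftrightarrow> q \<in> dyadic_pts" if "q \<notin> Tsing f" for q
  proof -
    have "\<exists>t\<in>ThompsonT. germ_eq q f t" using that unfolding sing_def by blast
    then show ?thesis using ThompsonT_dyadic germ_eq_at by metis
  qed
  show ?thesis
  proof (cases "p \<in> Tsing f")
    case True
    then have pD: "p \<in> dyadic_pts" using f unfolding TA_iff by blast
    then obtain x where x: "p = circle_of x" "dyadic x" by blast
    obtain e where e: "0 < e" "circle_of ` {x<..<x + e} \<inter> Tsing f = {}"
      using circle_gap[of "Tsing f" x] f unfolding TA_iff by blast
    obtain U where U: "open U" "p \<in> U" "\<And>z. z \<in> U \<Longrightarrow> (circle_L (f p) \<circ> f) z = (f \<circ> circle_L p) z"
      using germ_eqE[of p "circle_L (f p) \<circ> f" "f \<circ> circle_L p"] f unfolding TA_iff equiv_at_def by metis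
    obtain d where d: "0 < d" "ball x d \<subseteq> circle_of -` U"
      using U(1,2) x(1) unfolding open_circle_def open_contains_ball by blast
    obtain k where k: "1 / 2 ^ k < min d (e / 2)" using small_power[of "min d (e / 2)"] d e by auto
    define h where "h = (1 / 2 ^ k :: real)"
    have h: "0 < h" "h < d" "2 * h < e" "dyadic h" using k dyadic_half_power unfolding h_def by auto
    have "circle_of y \<notin> Tsing f" if "x < y" "y < x + e" for y
      using e(2) that by (metis IntI empty_iff greaterThanLessThan_iff imageI)
    then have ns: "circle_of (x + h) \<notin> Tsing f" "circle_of (x + 2 * h) \<notin> Tsing f" using h by simp_all
    have dd: "circle_of (x + h) \<in> dyadic_pts" "circle_of (x + 2 * h) \<in> dyadic_pts"
      using x(2) h(4) dyadic_add dyadic_mult[OF dyadic_power[of 1]] by (auto intro!: imageI)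
    obtain v where v: "f (circle_of (x + h)) = circle_of v" "dyadic v" using reg[OF ns(1)] dd by blast
    obtain v' where v': "f (circle_of (x + 2 * h)) = circle_of v'" "dyadic v'" using reg[OF ns(2)] dd by blast
    obtain q where q: "f p = circle_of q" by (rule circle_surj)
    have "circle_of (x + h) \<in> U" using d(2) h by (auto simp: dist_real_def subset_iff)
    from U(3)[OF this] have "circle_of (2 * v - q) = circle_of v'"
      using v v' q x(1) by (simp add: circle_L_eq algebra_simps)
    then have "dyadic (2 * v - q)" using circle_dyadic_iff v'(2) by metis
    moreover have "dyadic (2 * v)" using dyadic_mult[OF dyadic_power[of 1] v(2)] by simp
    ultimately have "dyadic (2 * v - (2 * v - q))" using dyadic_diff by blast
    then have "dyadic q" by simp
    then show ?thesis using q pD by simp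
  qed (rule reg)
qed

lemma TA_comp: assumes "f \<in> TA" "g \<in> TA" shows "f \<circ> g \<in> TA"
proof -
  have gh: "g \<in> Homeo" and fh: "f \<in> Homeo" using assms TA_Homeo by auto
  have "Tsing (f \<circ> g) \<subseteq> Tsing g \<union> g -` Tsing f" using circ.sing_word_homeo_comp[OF gh] unfolding ThompsonT_eq .
  moreover have "g -` Tsing f \<subseteq> dyadic_pts" using assms TA_dyadic[OF assms(2)] unfolding TA_iff by blast
  moreover have "finite (Tsing (f \<circ> g))"
    using circ.finite_sing_comp[OF gh, of f] assms unfolding TA_iff ThompsonT_eq by blast
  ultimately show ?thesis using assms Homeo_comp equiv_at_comp gh unfolding TA_iff by blast
qed

lemma TA_inv: assumes "f \<in> TA" shows "finv f \<in> TA"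
proof -
  have fh: "f \<in> Homeo" and b: "bij f" using assms TA_Homeo Homeo_bij by auto
  have s: "Tsing (finv f) \<subseteq> f ` Tsing f" using circ.sing_word_homeo_inv[OF fh] unfolding ThompsonT_eq .
  then have "finite (Tsing (finv f))" using assms finite_subset unfolding TA_iff by blast
  moreover have "Tsing (finv f) \<subseteq> dyadic_pts" using s TA_dyadic[OF assms] assms unfolding TA_iff by blast
  moreover have "equiv_at (finv f) p" for p
    using equiv_at_inv[OF _ fh, of "finv f p"] assms b unfolding TA_iff by simp
  ultimately show ?thesis using Homeo_inv[OF fh] unfolding TA_iff by blast
qed

lemma TA_id: "id \<in> TA"
  using circ.word_homeo_id ThompsonT_TA ThompsonT_eq by blast

lemma TA_cadj: "f \<in> TA \<Longrightarrow> circ.carries f a u \<Longrightarrow> circ.carries f b v \<Longrightarrow> cadj a b \<Longrightarrow> cadj u v"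
  using circ_cadj_preserved TA_Homeo by blast

lemma TA_adj_near:
  assumes g: "g \<in> TA" "g circ0 = circ0" and r: "circ.carries g (at_scale i a) u" "circ.carries g (at_scale j b) v" and ad: "adj (at_scale i a) (at_scale j b)"
  shows "adj u v"
proof -
  have "cadj u v" using TA_cadj[OF g(1) r] ad unfolding cadj_def by blast
  moreover have "v \<noteq> replicate l False" for l
  proof
    assume "v = replicate l False"
    then have "g (circ.W (at_scale j b) circ0) = g circ0" using r(2) g(2) by (simp add: circ.carries_def circ.W_zeros_pt)
    then show False using circ.W_at_scale_neq_pt TA_Homeo[OF g(1)] Homeo_bij by (metis bij_simps(2))
  qed
  ultimately show ?thesis unfolding cadj_def by blast
qed

lemma equivariant_nbhd:
  assumes "g \<in> TA" "g circ0 = circ0"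
  obtains M where "\<And>w. w \<in> range (circ.W (replicate M False)) \<Longrightarrow> circle_L circ0 (g w) = g (circle_L circ0 w)"
proof -
  obtain U where U: "open U" "circ0 \<in> U" "\<And>z. z \<in> U \<Longrightarrow> (circle_L (g circ0) \<circ> g) z = (g \<circ> circle_L circ0) z"
    using germ_eqE[of circ0 "circle_L (g circ0) \<circ> g" "g \<circ> circle_L circ0"] assms(1) unfolding TA_iff equiv_at_def by metis
  obtain M where M: "range (circ.W (replicate M False)) \<subseteq> U" using circ.shrink U by blast
  show ?thesis by (rule that[of M]) (use U(3)[OF subsetD[OF M]] assms(2) in simp)
qed

text \<open>
  The element \<open>g\<close> maps the block \<open>[x, 2x]\<close> with \<open>x = 2\<^sup>-\<^sup>m\<^sup>-\<^sup>1\<close> by increasing affine pieces onto an arc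
  \<open>[\<alpha>, \<beta>]\<close> in \<open>[0, 1]\<close>. Commuting with doubling gives \<open>\<beta> \<equiv> 2\<alpha>\<close> modulo \<open>1\<close>, and continuity puts \<open>\<alpha>\<close> close
  to \<open>0\<close> modulo \<open>1\<close>. For \<open>\<alpha>\<close> slightly below \<open>1\<close> this would require \<open>\<beta> = 2\<alpha> - 1 < \<alpha>\<close>; so \<open>\<alpha>\<close> is small
  and \<open>\<beta> = 2\<alpha>\<close>, and the arc lies to the right of the base point.
\<close>

lemma right_side:
  assumes g: "g \<in> TA" "g circ0 = circ0"
  shows "\<exists>m0. \<forall>m\<ge>m0. \<forall>z. g (circ.W (at_scale m []) z) \<in> range (circ.W [False])"
proof -
  have gh: "g \<in> Homeo" using TA_Homeo g by blast
  have bg: "bij g" using gh Homeo_bij by blast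
  have "finite (sing circ.word_homeo g)" using g(1) unfolding TA_iff ThompsonT_eq by blast
  then obtain m1 where m1: "\<And>m. m1 \<le> m \<Longrightarrow> \<exists>n. \<forall>w. n \<le> length w \<longrightarrow> (\<exists>u. circ.carries g (at_scale m w) u)"
    using circ.regular_scales by blast
  obtain M where M: "\<And>w. w \<in> range (circ.W (replicate M False)) \<Longrightarrow> circle_L circ0 (g w) = g (circle_L circ0 w)"
    using equivariant_nbhd[OF g] by blast
  have "open (g -` (circle_of ` {-1/4<..<1/4}))"
    by (intro Homeo_open_vimage[OF gh] open_circle_image) simp
  moreover have "circ0 \<in> g -` (circle_of ` {-1/4<..<1/4})" using g(2) by (auto intro!: imageI)
  ultimately obtain M2 where M2: "range (circ.W (replicate M2 False)) \<subseteq> g -` (circle_of ` {-1/4<..<1/4})"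
    using circ.shrink by blast
  have "g (circ.W (at_scale m []) z) \<in> range (circ.W [False])" if m: "max m1 (max M M2) \<le> m" for m z
  proof -
    obtain n where n: "\<And>w. n \<le> length w \<Longrightarrow> \<exists>u. circ.carries g (at_scale m w) u" using m1 m by (metis max.bounded_iff)
    define P where "P = unif n"
    have P: "leaf P" unfolding P_def by (rule leaf_unif)
    define N where "N = length P"
    have N0: "0 < N" unfolding N_def using leaf_nonempty[OF P] by simp
    have "\<exists>u. circ.carries g (at_scale m w) u" if "w \<in> set P" for w
      using n that unfolding P_def set_unif by simp
    then obtain \<phi> where \<phi>: "\<And>w. w \<in> set P \<Longrightarrow> circ.carries g (at_scale m w) (\<phi> w)" by metis
    define u where "u r = \<phi> (P ! r)" for r
    have u: "circ.carries g (at_scale m (P ! r)) (u r)" if "r < N" for r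
      unfolding u_def using \<phi> that unfolding N_def by simp
    have uadj: "adj (u r) (u (Suc r))" if "Suc r < N" for r
    proof -
      have "adj (P ! r) (P ! Suc r)" using leaf_successively_adj[OF P] that unfolding N_def by (simp add: successively_conv_nth)
      then show ?thesis using TA_adj_near[OF g u u adj_at_scale_same] that by simp
    qed
    \<comment> \<open>\<open>e r\<close> is the start of the image of the \<open>r\<close>-th piece, and \<open>e N\<close> the end of the last one.\<close>
    define e where "e r = (if r < N then wval (u r) else wval (u (N - 1)) + 1 / 2 ^ length (u (N - 1)))" for r
    have e_Suc: "e (Suc r) = e r + 1 / 2 ^ length (u r)" if "r < N" for r
    proof (cases "Suc r < N")
      case True
      then show ?thesis using adj_wval[OF uadj[OF True]] unfolding e_def by simp
    next
      case False
      then have "r = N - 1" using that by simp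
      then show ?thesis using N0 unfolding e_def by simp
    qed
    have mono: "e r \<le> e s" if "r \<le> s" "s \<le> N" for r s
      using that
    proof (induction s rule: dec_induct)
      case (step s)
      have "0 < (1 / 2 ^ length (u s) :: real)" by simp
      moreover have "e r \<le> e s" "e (Suc s) = e s + 1 / 2 ^ length (u s)" using step e_Suc[of s] by simp_all
      ultimately show ?case by linarith
    qed simp
    define \<alpha> \<beta> where "\<alpha> = e 0" and "\<beta> = e N"
    have "e 0 < e (Suc 0)" using e_Suc[OF N0] by simp
    then have ab: "\<alpha> < \<beta>" using mono[of "Suc 0" N] N0 unfolding \<alpha>_def \<beta>_def by simp
    have \<beta>1: "\<beta> \<le> 1" unfolding \<beta>_def e_def using wval_bounds by simp
    have \<alpha>0: "0 \<le> \<alpha>" unfolding \<alpha>_def e_def using N0 wval_bounds by simp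
    define x0 where "x0 = (1 / 2 ^ Suc m :: real)"
    obtain l where l: "P ! 0 = replicate l False" using leaf_hd[OF P] N0 unfolding N_def by (metis hd_conv_nth length_greater_0_conv)
    have "g (circle_of (wval (at_scale m (P ! 0)))) = circle_of (wval (u 0))" by (rule circ_carries_start[OF u[OF N0]])
    then have g0: "g (circle_of x0) = circle_of \<alpha>" using N0 unfolding x0_def \<alpha>_def e_def l by (simp add: wval_at_scale)
    obtain k where k: "P ! (N - 1) = replicate k True"
      using leaf_last[OF P] N0 unfolding N_def by (metis last_conv_nth length_greater_0_conv)
    have "g (circle_of (wval (at_scale m (P ! (N - 1))) + 1 / 2 ^ length (at_scale m (P ! (N - 1))))) = circle_of \<beta>"
      using circ_carries_end[OF gh u[of "N - 1"]] N0 unfolding \<beta>_def e_def by simp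
    moreover have "wval (at_scale m (P ! (N - 1))) + 1 / 2 ^ length (at_scale m (P ! (N - 1))) = 2 * x0"
      unfolding k x0_def wval_at_scale length_at_scale by (simp add: field_simps power_add)
    ultimately have g1: "g (circle_of (2 * x0)) = circle_of \<beta>" by simp
    have x0W: "circle_of x0 = circ.W (at_scale m []) circ0" unfolding x0_def circ_W_0 wval_at_scale by simp
    have "circle_of x0 \<in> range (circ.W (replicate M False))" unfolding x0W using m circ.at_scale_in_zeros by simp
    from M[OF this] have eq: "circle_of (2 * \<alpha>) = circle_of \<beta>" using g0 g1 by (simp add: circle_L_eq)
    have "circle_of x0 \<in> range (circ.W (replicate M2 False))" unfolding x0W using m circ.at_scale_in_zeros by simp
    then obtain t where t: "circle_of \<alpha> = circle_of t" "-1/4 < t" "t < 1/4" using M2 g0 by force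
    have \<alpha>n0: "\<alpha> \<noteq> 0"
    proof
      assume "\<alpha> = 0"
      then have "g (circ.W (at_scale m []) circ0) = g circ0" using g0 g(2) x0W by simp
      then show False using circ.W_at_scale_neq_pt bg by (metis bij_simps(2))
    qed
    obtain j :: int where j: "\<alpha> - t = of_int j" using t(1) unfolding circle_eq by (auto elim: Ints_cases)
    obtain i :: int where i: "2 * \<alpha> - \<beta> = of_int i" using eq unfolding circle_eq by (auto elim: Ints_cases)
    have "of_int i < (1::real)" "(-1::real) < of_int i" using i ab \<beta>1 \<alpha>0 \<alpha>n0 by linarith+
    then have "i = 0" by linarith
    then have b2: "\<beta> = 2 * \<alpha>" using i by simp
    have "\<alpha> \<le> 1/2" using b2 \<beta>1 by simp
    then have "of_int j < (1::real)" "(-1::real) < of_int j" using j t(2,3) \<alpha>0 by linarith+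
    then have "j = 0" by linarith
    then have "\<alpha> < 1/4" using j t by simp
    then have \<beta>2: "\<beta> < 1/2" using b2 by simp
    obtain r z' where r: "r < N" "z = circ.W (P ! r) z'" using circ.tiling_cover[OF circ.leaf_tiling[OF P]] unfolding N_def by blast
    have "g (circ.W (at_scale m []) z) = g (circ.W (at_scale m (P ! r)) z')" unfolding r(2) by (metis append_Nil circ.W_append circ.at_scale_append)
    also have "\<dots> = circ.W (u r) z'" using u[OF r(1)] unfolding circ.carries_def by blast
    finally have "g (circ.W (at_scale m []) z) \<in> range (circ.W (u r))" by simp
    then obtain y where y: "g (circ.W (at_scale m []) z) = circle_of y" "wval (u r) \<le> y" "y < wval (u r) + 1 / 2 ^ length (u r)"
      unfolding circ_range by auto
    have "e (Suc r) \<le> \<beta>" unfolding \<beta>_def using mono r(1) by simp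
    then have "y < 1/2" using y(3) e_Suc[OF r(1)] r(1) \<beta>2 unfolding e_def by simp
    moreover have "0 \<le> y" using y(2) wval_bounds[of "u r"] by linarith
    ultimately show ?thesis unfolding y(1) circ_range by (auto intro!: imageI)
  qed
  then show ?thesis by blast
qed

text \<open>
  Continuity makes the images small, and \<open>right_side\<close> keeps them on the right.
\<close>

lemma TA_shrink:
  assumes g: "g \<in> TA" "g circ0 = circ0"
  shows "\<exists>m. g ` range (circ.W (replicate m False)) \<subseteq> range (circ.W (replicate M False))"
proof -
  have gh: "g \<in> Homeo" using TA_Homeo g by blast
  obtain m0 where m0: "\<And>m z. m0 \<le> m \<Longrightarrow> g (circ.W (at_scale m []) z) \<in> range (circ.W [False])" using right_side[OF g] by blast
  obtain V where V: "open V" "circ0 \<in> V" "V \<inter> range (circ.W [False]) \<subseteq> range (circ.W (replicate M False))" using circ.nbhd by blast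
  have "open (g -` V)" using Homeo_open_vimage[OF gh V(1)] .
  then obtain j where j: "range (circ.W (replicate j False)) \<subseteq> g -` V" using circ.shrink[of "g -` V"] V(2) g(2) by auto
  have "g z \<in> range (circ.W (replicate M False))" if z: "z \<in> range (circ.W (replicate (max j m0) False))" for z
  proof (cases "z = circ0")
    case True
    then show ?thesis using g(2) circ.W_zeros_pt by (metis rangeI)
  next
    case False
    then obtain i x where ix: "z = circ.W (at_scale i []) x" using circ.pt_or by blast
    then have "max j m0 \<le> i" using z circ.at_scale_in_zeros_iff by blast
    then have "g z \<in> range (circ.W [False])" using m0 ix by simp
    moreover have "g z \<in> V" using j z circ.zeros_antimono[of j "max j m0"] by auto
    ultimately show ?thesis using V(3) by blast
  qed
  then show ?thesis by blast
qed

lemma circle_L_ycirc [simp]: "circle_L circ0 (ycirc False z) = z"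
  unfolding ycirc_def by (simp add: circle_L_eq)

lemma TA_commute:
  assumes g: "g \<in> TA" "g circ0 = circ0"
  shows "\<exists>m. \<forall>z\<in>range (circ.W (replicate m False)). g (ycirc False z) = ycirc False (g z)"
proof -
  obtain M where M: "\<And>w. w \<in> range (circ.W (replicate M False)) \<Longrightarrow> circle_L circ0 (g w) = g (circle_L circ0 w)"
    using equivariant_nbhd[OF g] by blast
  obtain m where m: "g ` range (circ.W (replicate m False)) \<subseteq> range (circ.W (replicate 1 False))" using TA_shrink[OF g] by blast
  have "g (ycirc False z) = ycirc False (g z)" if z: "z \<in> range (circ.W (replicate (max M m) False))" for z
  proof -
    have "ycirc False z \<in> range (circ.W (replicate (Suc (max M m)) False))" using z by auto
    then have w: "ycirc False z \<in> range (circ.W (replicate M False))" "ycirc False z \<in> range (circ.W (replicate m False))"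
      using subsetD[OF circ.zeros_antimono[of M "Suc (max M m)"]] subsetD[OF circ.zeros_antimono[of m "Suc (max M m)"]]
      by (simp_all del: replicate_Suc)
    have e: "circle_L circ0 (g (ycirc False z)) = g z" using M[OF w(1)] by simp
    obtain v where "g (ycirc False z) = ycirc False v" using m w(2) by auto
    then show ?thesis using e by simp
  qed
  then show ?thesis by blast
qed

definition TA0 :: "(circle \<Rightarrow> circle) set" where
  "TA0 = {g \<in> TA. g circ0 = circ0 \<and> Tsing g \<subseteq> {circ0} \<and> (\<forall>z. z \<notin> range (circ.W [False]) \<longrightarrow> g z = z)}"

text \<open>
  On the right of the base point the map commutes with doubling by \<open>spread_commute\<close>; on the left it is the
  identity.
\<close>

lemma spread_TA0: assumes h: "circ.spread p q c d a" shows "a \<in> TA0"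
proof -
  have ah: "a \<in> Homeo" and s: "Tsing a \<subseteq> {circ0}"
    using circ.spread_Homeo[OF circ_cyc_word_homeo h] unfolding ThompsonT_eq by auto
  have "equiv_at a circ0" unfolding equiv_at_def
  proof (rule germ_eqI)
    let ?U = "circle_of ` {-1/4<..<1 / 2 ^ Suc (p + q)}"
    show "open ?U" by (rule open_circle_image) simp
    show "circ0 \<in> ?U" by (rule imageI) simp
    fix w assume "w \<in> ?U"
    then obtain x where x: "w = circle_of x" "-1/4 < x" "x < 1 / 2 ^ Suc (p + q)" by auto
    show "(circle_L (a circ0) \<circ> a) w = (a \<circ> circle_L circ0) w"
    proof (cases "0 \<le> x")
      case True
      have p1: "1 / 2 ^ (p + q) \<le> (1::real)" by simp
      have x2: "2 * x < 1 / 2 ^ (p + q)" using x(3) by (simp add: field_simps)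
      then have "2 * x < 1" using p1 by linarith
      then have "w = ycirc False (circle_of (2 * x))" using True x(1) by (simp add: ycirc_circle_of)
      moreover have "circle_of (2 * x) \<in> range (circ.W (replicate (p + q) False))"
        unfolding circ_range using x2 True by (intro imageI) simp
      ultimately show ?thesis using circ.spread_commute[OF h] circ.spread_pt[OF h] by simp
    next
      case False
      have out: "circle_of y \<notin> range (circ.W [False])" if y: "-1/2 < y" "y < 0" for y
      proof
        assume "circle_of y \<in> range (circ.W [False])"
        then obtain v where v: "circle_of y = circle_of v" "0 \<le> v" "v < 1/2" unfolding circ_range by auto
        then have "y = v" using y by (intro circle_eq_small) auto
        then show False using v y by simp
      qed
      have "a w = w" using circ.spread_off[OF h out[of x]] x False by simp
      moreover have "a (circle_of (2 * x)) = circle_of (2 * x)" using circ.spread_off[OF h out[of "2 * x"]] x False by simp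
      ultimately show ?thesis using circ.spread_pt[OF h] x(1) by (simp add: circle_L_eq)
    qed
  qed
  then have "a \<in> TA" unfolding TA_def equiv_at_def using ah s finite_subset[OF s] dyadic_of_int[of 0] by auto
  then show ?thesis unfolding TA0_def using s circ.spread_pt[OF h] circ.spread_off[OF h] by blast
qed

interpretation TA: dyad_group ycirc circ0 TA TA0
proof
  show "bij f" if "f \<in> TA" for f using that TA_Homeo Homeo_bij by blast
  show "id \<in> TA" by (rule TA_id)
  show "f \<circ> g \<in> TA" if "f \<in> TA" "g \<in> TA" for f g using that by (rule TA_comp)
  show "finv f \<in> TA" if "f \<in> TA" for f using that by (rule TA_inv)
  show "TA0 \<subseteq> TA" unfolding TA0_def by blast
  show "id \<in> TA0" unfolding TA0_def using TA_id sing_self[of id circ.word_homeo] circ.word_homeo_id ThompsonT_eq by auto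
  show "f \<circ> g \<in> TA0" if fg: "f \<in> TA0" "g \<in> TA0" for f g
  proof -
    have gh: "g \<in> Homeo" using fg TA_Homeo unfolding TA0_def by blast
    have gp: "g circ0 = circ0" using fg unfolding TA0_def by blast
    have "z = circ0" if "g z = circ0" for z using gp that Homeo_bij[OF gh] by (metis bij_simps(2))
    then have "g -` {circ0} \<subseteq> {circ0}" by blast
    then have "Tsing (f \<circ> g) \<subseteq> {circ0}"
      using circ.sing_word_homeo_comp[OF gh, of f] fg unfolding TA0_def ThompsonT_eq by blast
    then show ?thesis using fg TA_comp unfolding TA0_def by simp
  qed
  show "finv f \<in> TA0" if f: "f \<in> TA0" for f
  proof -
    have fh: "f \<in> Homeo" and b: "bij f" using f TA_Homeo Homeo_bij unfolding TA0_def by auto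
    have "Tsing (finv f) \<subseteq> f ` Tsing f" using circ.sing_word_homeo_inv[OF fh] unfolding ThompsonT_eq .
    also have "\<dots> \<subseteq> {circ0}" using f unfolding TA0_def by auto
    finally have "Tsing (finv f) \<subseteq> {circ0}" .
    moreover have "finv f circ0 = circ0" "\<And>z. z \<notin> range (circ.W [False]) \<Longrightarrow> finv f z = z"
    proof -
      have 1: "f circ0 = circ0" "\<And>z. z \<notin> range (circ.W [False]) \<Longrightarrow> f z = z" using f unfolding TA0_def by blast+
      show "finv f circ0 = circ0" using 1(1) b by (metis bij_simps(2))
      show "finv f z = z" if "z \<notin> range (circ.W [False])" for z using 1(2)[OF that] b by (metis bij_simps(2))
    qed
    ultimately show ?thesis using f TA_inv unfolding TA0_def by blast
  qed
  show "f circ0 = circ0" if "f \<in> TA0" for f using that unfolding TA0_def by blast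
  show "f \<in> TA" if "cyc P" "cyc Q" "list_all2 (circ.carries f) P Q" for P Q f
    using circ_cyc_word_homeo[OF that] ThompsonT_TA ThompsonT_eq by blast
  show "\<exists>w. f ` range (circ.W w) \<inter> range (circ.W w) = {}" if "f \<in> TA" "f \<noteq> id" for f
    using circ.displacement TA_Homeo that by blast
  show "a \<in> TA0" if "circ.spread p q c d a" for p q c d a using that by (rule spread_TA0)
  show "\<exists>m\<ge>m0. \<exists>n. \<forall>w. n \<le> length w \<longrightarrow> (\<exists>u. circ.carries g (at_scale m w) u)" if "g \<in> TA" for g m0
  proof -
    have "finite (sing circ.word_homeo g)" using that unfolding TA_iff ThompsonT_eq by blast
    from circ.regular_scales[OF this] show ?thesis by (metis nle_le)
  qed
  show "\<exists>m. \<forall>z\<in>range (circ.W (replicate m False)). g (ycirc False z) = ycirc False (g z)" if "g \<in> TA" "g circ0 = circ0" for g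
    using that by (rule TA_commute)
  show "\<exists>m. \<forall>i j a b u v. m \<le> i \<longrightarrow> m \<le> j \<longrightarrow> adj (at_scale i a) (at_scale j b) \<longrightarrow>
       circ.carries g (at_scale i a) u \<longrightarrow> circ.carries g (at_scale j b) v \<longrightarrow> adj u v" if "g \<in> TA" "g circ0 = circ0" for g
    using TA_adj_near[OF that] by blast
  show "\<exists>m. g ` range (circ.W (replicate m False)) \<subseteq> range (circ.W (replicate M False))" if "g \<in> TA" "g circ0 = circ0" for g M
    using that by (rule TA_shrink)
qed

section \<open>Simplicity on the circle\<close>

definition rotation :: "real \<Rightarrow> circle \<Rightarrow> circle" where "rotation \<theta> z = circle_of (rep01 z + \<theta>)"
definition circle_flip :: "circle \<Rightarrow> circle" where "circle_flip z = circle_of (- rep01 z)"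

lemma rotation_circle_of [simp]: "rotation \<theta> (circle_of x) = circle_of (x + \<theta>)"
  unfolding rotation_def by (rule circle_of_shift) simp

lemma circle_flip_circle_of [simp]: "circle_flip (circle_of x) = circle_of (- x)"
proof -
  have "circle_of (rep01 (circle_of x)) = circle_of x" by simp
  then have "rep01 (circle_of x) - x \<in> \<int>" by (simp only: circle_eq)
  then have "- rep01 (circle_of x) - (- x) \<in> \<int>" using Ints_minus by fastforce
  then show ?thesis unfolding circle_flip_def circle_eq .
qed

lemma rotation_ThompsonT: assumes "dyadic \<theta>" shows "rotation \<theta> \<in> ThompsonT"
proof -
  have inv: "rotation (- \<theta>) (rotation \<theta> z) = z" "rotation \<theta> (rotation (- \<theta>) z) = z" for z \<theta>
    by (rule circle_surj[of z], simp)+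
  have "bij (rotation \<theta>)" by (rule o_bij[of "rotation (- \<theta>)"]) (use inv in auto)
  moreover have "continuous_on UNIV (rotation \<theta>)"
    by (rule circle_continuousI) (simp, intro continuous_on_compose2[OF continuous_circle_of] continuous_intros, auto)
  ultimately have "rotation \<theta> \<in> Homeo" by (rule Homeo_compactI[OF compact_circle])
  moreover have "\<exists>(n::int) b. dyadic b \<and> (\<forall>x\<in>{s..t}. rotation \<theta> (circle_of x) = circle_of (2 powi n * x + b))" for s t
    by (intro exI[of _ 0] exI[of _ \<theta>]) (simp add: assms)
  ultimately show ?thesis unfolding ThompsonT_def by (intro CollectI conjI exI[of _ "{}"]) auto
qed

lemma circle_flip_circle_flip [simp]: "circle_flip (circle_flip z) = z"
  by (rule circle_surj[of z]) simp

lemma circle_flip_comp [simp]: "circle_flip \<circ> circle_flip = id" by auto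

lemma bij_circle_flip: "bij circle_flip" by (rule o_bij[of circle_flip]) auto

lemma circle_flip_Homeo: "circle_flip \<in> Homeo"
proof (rule Homeo_compactI[OF compact_circle bij_circle_flip])
  show "continuous_on UNIV circle_flip"
    by (rule circle_continuousI) (simp, intro continuous_on_compose2[OF continuous_circle_of] continuous_intros, auto)
qed

abbreviation flip_conj :: "(circle \<Rightarrow> circle) \<Rightarrow> circle \<Rightarrow> circle" where "flip_conj f \<equiv> circle_flip \<circ> f \<circ> circle_flip"

lemma flip_conj_flip_conj: "flip_conj (flip_conj f) = f" by (auto simp: fun_eq_iff)

lemma flip_conj_ThompsonT: assumes "f \<in> ThompsonT" shows "flip_conj f \<in> ThompsonT"
proof -
  have "f \<in> Homeo" using assms circ.word_homeo_Homeo ThompsonT_eq by blast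
  then have h: "flip_conj f \<in> Homeo" by (intro Homeo_comp circle_flip_Homeo)
  obtain B where BB: "finite B \<and> B \<subseteq> circle_of ` Collect dyadic \<and> (\<forall>s t. s < t \<longrightarrow> circle_of ` {s<..<t} \<inter> B = {} \<longrightarrow>
        (\<exists>(n::int) b. dyadic b \<and> (\<forall>x\<in>{s..t}. f (circle_of x) = circle_of (2 powi n * x + b))))"
    using ThompsonT_breakpoints[OF assms] ..
  note B3 = BB[THEN conjunct2, THEN conjunct2, rule_format]
  have "finite (circle_flip ` B)" using BB by blast
  moreover have "circle_flip ` B \<subseteq> dyadic_pts"
  proof -
    have "B \<subseteq> dyadic_pts" using BB by blast
    then show ?thesis using dyadic_uminus by (auto intro!: imageI)
  qed
  moreover have "\<exists>(n::int) b. dyadic b \<and> (\<forall>x\<in>{s..t}. flip_conj f (circle_of x) = circle_of (2 powi n * x + b))"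
    if st: "s < t" "circle_of ` {s<..<t} \<inter> circle_flip ` B = {}" for s t
  proof -
    have "circle_of ` {- t<..<- s} \<inter> B = {}"
    proof (rule ccontr)
      assume "circle_of ` {- t<..<- s} \<inter> B \<noteq> {}"
      then obtain y where y: "y \<in> {- t<..<- s}" "circle_of y \<in> B" by blast
      then have "circle_of (- y) \<in> circle_flip ` B" using imageI[of "circle_of y" B circle_flip] by simp
      moreover have "circle_of (- y) \<in> circle_of ` {s<..<t}" using y by (intro imageI) auto
      ultimately show False using st(2) by blast
    qed
    then obtain n b where nb: "dyadic b" "\<forall>x\<in>{- t..- s}. f (circle_of x) = circle_of (2 powi n * x + b)"
      using B3[of "- t" "- s"] st(1) by auto
    show ?thesis
    proof (intro exI[of _ n] exI[of _ "- b"] conjI ballI)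
      show "dyadic (- b)" using nb dyadic_uminus by blast
      fix x assume "x \<in> {s..t}"
      then have "- x \<in> {- t..- s}" by auto
      then show "flip_conj f (circle_of x) = circle_of (2 powi n * x + - b)" using nb(2) by simp
    qed
  qed
  ultimately have "\<exists>B. finite B \<and> B \<subseteq> circle_of ` Collect dyadic \<and> (\<forall>s t. s < t \<and> circle_of ` {s<..<t} \<inter> B = {} \<longrightarrow>
        (\<exists>(n::int) b. dyadic b \<and> (\<forall>x\<in>{s..t}. flip_conj f (circle_of x) = circle_of (2 powi n * x + b))))"
    by (intro exI[of _ "circle_flip ` B"] conjI allI impI) simp_all
  then show ?thesis unfolding ThompsonT_def using h by simp
qed

lemma flip_conj_sing: "Tsing (flip_conj f) \<subseteq> circle_flip ` Tsing f"
proof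
  fix p assume p: "p \<in> Tsing (flip_conj f)"
  have "circle_flip p \<in> Tsing f"
  proof (rule ccontr)
    assume "circle_flip p \<notin> Tsing f"
    then obtain t where t: "t \<in> ThompsonT" "germ_eq (circle_flip p) f t" unfolding sing_def by blast
    have "germ_eq p (f \<circ> circle_flip) (t \<circ> circle_flip)" by (rule germ_eq_right[OF t(2) Homeo_tendsto[OF circle_flip_Homeo]])
    then have "germ_eq p (circle_flip \<circ> (f \<circ> circle_flip)) (circle_flip \<circ> (t \<circ> circle_flip))" by (rule germ_eq_left)
    then show False using p flip_conj_ThompsonT[OF t(1)] unfolding sing_def by (auto simp: comp_assoc)
  qed
  then show "p \<in> circle_flip ` Tsing f" by (rule image_eqI[rotated]) simp
qed

lemma circle_flip_dyadic_pts: "circle_flip p \<in> dyadic_pts \<longleftrightarrow> p \<in> dyadic_pts"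
proof -
  obtain x where "p = circle_of x" by (rule circle_surj)
  then show ?thesis using circle_dyadic_iff dyadic_uminus[of x] dyadic_uminus[of "- x"] by auto
qed

lemma equiv_at_circle_flip: "equiv_at circle_flip p"
proof -
  obtain x where "p = circle_of x" by (rule circle_surj)
  then have "circle_L (circle_flip p) (circle_flip z) = circle_flip (circle_L p z)" for z
    by (rule_tac circle_surj[of z]) (simp add: circle_L_eq)
  then show ?thesis unfolding equiv_at_def germ_eq_def by simp
qed

lemma flip_conj_TA: assumes "f \<in> TA" shows "flip_conj f \<in> TA"
  unfolding TA_iff
proof (intro conjI allI)
  have fh: "f \<in> Homeo" using assms TA_Homeo by blast
  show "flip_conj f \<in> Homeo" by (intro Homeo_comp circle_flip_Homeo fh)
  have "finite (circle_flip ` Tsing f)" using assms unfolding TA_iff by simp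
  then show "finite (Tsing (flip_conj f))" by (rule finite_subset[OF flip_conj_sing])
  show "Tsing (flip_conj f) \<subseteq> dyadic_pts" using flip_conj_sing[of f] assms circle_flip_dyadic_pts unfolding TA_iff by blast
  show "equiv_at (flip_conj f) p" for p
    using equiv_at_comp[OF equiv_at_circle_flip equiv_at_comp[OF _ equiv_at_circle_flip fh] circle_flip_Homeo, of p] assms
    unfolding TA_iff by (simp add: comp_assoc)
qed

abbreviation "normalTA \<equiv> normal_dyad_group ycirc circ0 TA TA0"

lemma normalTA_flip_conj: "normalTA N \<Longrightarrow> normalTA (flip_conj ` N)"
  by (rule normal_dyad_group.conjugate_normal) (use flip_conj_TA in auto)

text \<open>
  Used to match a homeomorphism that is a prefix replacement on each side of the base point. The
  bounds make sure that both cyclic lists have an entry left to be split.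
\<close>

lemma two_sided:
  assumes "2 \<le> a" "2 \<le> b" "1 \<le> c" "1 \<le> d"
  shows "\<exists>t\<in>ThompsonT. circ.carries t (replicate a False) (replicate b False) \<and> circ.carries t (replicate c True) (replicate d True)"
proof -
  have ex: "\<exists>X. X \<noteq> [] \<and> cyc ([replicate c True, replicate a False] @ X)" if ac: "2 \<le> a" "1 \<le> c" for a c
  proof -
    obtain a' c' where a': "a = Suc a'" "c = Suc c'" "1 \<le> a'" using ac by (cases a; cases c) auto
    obtain A where A: "leaf (replicate a' False # A)" using leaf_spine_False by blast
    obtain B where B: "leaf (B @ [replicate c' True])" using leaf_spine_True by blast
    have "A \<noteq> []" using leaf_length_1[OF A] a'(3) by auto
    have "cyc ((replicate a False # map ((#) False) A @ map ((#) True) B) @ [replicate c True])"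
      using cyc_leaf[OF leaf_node[OF A B]] a' by simp
    from cyc_swap[OF this] have "cyc ([replicate c True, replicate a False] @ (map ((#) False) A @ map ((#) True) B))" by simp
    with \<open>A \<noteq> []\<close> show ?thesis by (intro exI[of _ "map ((#) False) A @ map ((#) True) B"]) simp
  qed
  obtain X where X: "X \<noteq> []" "cyc ([replicate c True, replicate a False] @ X)" using ex assms by blast
  obtain Y where Y: "Y \<noteq> []" "cyc ([replicate d True, replicate b False] @ Y)" using ex assms by blast
  define n where "n = max (length X) (length Y)"
  obtain X' where X': "cyc ([replicate c True, replicate a False] @ X')" "length X' = n"
    using cyc_extend[OF X(2,1), of n] unfolding n_def by auto
  obtain Y' where Y': "cyc ([replicate d True, replicate b False] @ Y')" "length Y' = n"
    using cyc_extend[OF Y(2,1), of n] unfolding n_def by auto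
  have "length ([replicate c True, replicate a False] @ X') = length ([replicate d True, replicate b False] @ Y')"
    using X' Y' by simp
  then obtain t where t: "list_all2 (circ.carries t) ([replicate c True, replicate a False] @ X') ([replicate d True, replicate b False] @ Y')"
    using circ.realization_exists[OF circ.cyc_tiling[OF X'(1)]] by blast
  have "t \<in> ThompsonT" unfolding ThompsonT_eq by (rule circ_cyc_word_homeo[OF X'(1) Y'(1) t])
  then show ?thesis using t by auto
qed

lemma left_out: assumes "0 < y" "y < 1 / 2" shows "circle_of (- y) \<notin> range (circ.W [False])"
proof
  assume "circle_of (- y) \<in> range (circ.W [False])"
  then obtain v where v: "circle_of (- y) = circle_of v" "0 \<le> v" "v < 1/2" unfolding circ_range by auto
  then have "- y = v" using assms by (intro circle_eq_small) auto
  then show False using v assms by simp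
qed

text \<open>
  Make \<open>g\<close> a prefix replacement on the right of the base point by \<open>n\<^sub>1\<close>, then on the left by \<open>n\<^sub>2\<close>, the
  reflection of an element supported on the right; \<open>n\<^sub>2\<close> does not disturb the right side.
  The result is affine on both sides and so agrees near the base point with an element
  of \<open>T\<close>.
\<close>

lemma remove_singularity:
  assumes N: "normalTA N" and g: "g \<in> TA" "g circ0 = circ0"
  shows "\<exists>n\<in>N. Tsing (n \<circ> g) \<subseteq> Tsing g - {circ0}"
proof -
  interpret n: normal_dyad_group ycirc circ0 TA TA0 N by (rule N)
  interpret n': normal_dyad_group ycirc circ0 TA TA0 "flip_conj ` N" by (rule normalTA_flip_conj[OF N])
  obtain n1 p q where n1: "n1 \<in> N" "n1 \<in> TA0" "circ.carries (n1 \<circ> g) (replicate p False) (replicate q False)"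
    using n.end_reduction_prefix[OF g] by blast
  define h1 where "h1 = n1 \<circ> g"
  have h1: "h1 \<in> TA" "h1 circ0 = circ0" unfolding h1_def using n1 g TA_comp n.N_sub TA.G0_pt by auto
  have h1': "flip_conj h1 \<in> TA" "flip_conj h1 circ0 = circ0" using h1 flip_conj_TA by auto
  obtain n2' p' q' where n2': "n2' \<in> flip_conj ` N" "n2' \<in> TA0" "circ.carries (n2' \<circ> flip_conj h1) (replicate p' False) (replicate q' False)"
    using n'.end_reduction_prefix[OF h1'] by blast
  define n2 where "n2 = flip_conj n2'"
  have n2: "n2 \<in> N" using n2'(1) unfolding n2_def by (auto simp: flip_conj_flip_conj simp del: comp_apply)
  define h2 where "h2 = n2 \<circ> h1"
  have Homeos: "g \<in> Homeo" "h1 \<in> Homeo" using g h1 TA_Homeo by auto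
  have circ0_vimage: "f -` {circ0} \<subseteq> {circ0}" if "f \<in> TA" "f circ0 = circ0" for f
  proof -
    have "z = circ0" if "f z = circ0" for z using \<open>f circ0 = circ0\<close> that TA.G_bij[OF \<open>f \<in> TA\<close>] by (metis bij_simps(2))
    then show ?thesis by blast
  qed
  have "Tsing h1 \<subseteq> Tsing g \<union> g -` Tsing n1"
    unfolding h1_def using circ.sing_word_homeo_comp[OF Homeos(1)] unfolding ThompsonT_eq .
  then have s1: "Tsing h1 \<subseteq> Tsing g \<union> {circ0}" using n1(2) circ0_vimage[OF g] unfolding TA0_def by blast
  have "Tsing n2 \<subseteq> circle_flip ` Tsing n2'" unfolding n2_def by (rule flip_conj_sing)
  then have "Tsing n2 \<subseteq> {circ0}" using n2'(2) unfolding TA0_def by fastforce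
  moreover have "Tsing h2 \<subseteq> Tsing h1 \<union> h1 -` Tsing n2"
    unfolding h2_def using circ.sing_word_homeo_comp[OF Homeos(2)] unfolding ThompsonT_eq .
  ultimately have s2: "Tsing h2 \<subseteq> Tsing g \<union> {circ0}" using s1 circ0_vimage[OF h1] by blast
  have right1: "h1 (circle_of x) = circle_of (x * 2 ^ p / 2 ^ q)" if "0 \<le> x" "x < 1 / 2 ^ p" for x
    using circ_carries_affine[OF n1(3)[folded h1_def], of x] that by simp
  have n2fix: "n2 (circle_of y) = circle_of y" if "0 \<le> y" "y < 1 / 2" for y
  proof (cases "y = 0")
    case True
    then show ?thesis unfolding n2_def using TA.G0_pt[OF n2'(2)] by simp
  next
    case False
    then have "n2' (circle_of (- y)) = circle_of (- y)" using left_out[of y] that n2'(2) unfolding TA0_def by auto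
    then show ?thesis unfolding n2_def by simp
  qed
  have h2': "flip_conj h2 = n2' \<circ> flip_conj h1" unfolding h2_def n2_def by (auto simp: fun_eq_iff)
  have left2: "h2 (circle_of (- x)) = circle_of (- (x * 2 ^ p' / 2 ^ q'))" if "0 \<le> x" "x < 1 / 2 ^ p'" for x
  proof -
    have "flip_conj h2 (circle_of x) = circle_of (x * 2 ^ p' / 2 ^ q')"
      using circ_carries_affine[OF n2'(3)[folded h2'], of x] that by simp
    then have "circle_flip (circle_flip (h2 (circle_of (- x)))) = circle_flip (circle_of (x * 2 ^ p' / 2 ^ q'))" by simp
    then show ?thesis by simp
  qed
  obtain t where t: "t \<in> ThompsonT" "circ.carries t (replicate (p + 2) False) (replicate (q + 2) False)"
    "circ.carries t (replicate (p' + 2) True) (replicate (q' + 2) True)"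
    using two_sided[of "p + 2" "q + 2" "p' + 2" "q' + 2"] by auto
  \<comment> \<open>Within distance \<open>d\<close> both affine formulas are valid, and \<open>h1\<close> maps the right side into the
    cone of \<open>0\<close>, where \<open>n2\<close> is the identity.\<close>
  define d where "d = min (1 / 2 ^ (p + 2)) (min (1 / 2 ^ (p' + 2)) (2 ^ q / 2 ^ p / 2 :: real))"
  have d0: "0 < d" unfolding d_def by simp
  have "germ_eq circ0 h2 t"
  proof (rule germ_eqI)
    show "open (circle_of ` {- d<..<d})" by (rule open_circle_image) simp
    show "circ0 \<in> circle_of ` {- d<..<d}" using d0 by (intro imageI) simp
    fix z assume "z \<in> circle_of ` {- d<..<d}"
    then obtain x where x: "z = circle_of x" "- d < x" "x < d" by auto
    show "h2 z = t z"
    proof (cases "0 \<le> x")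
      case True
      have b: "x < 1 / 2 ^ (p + 2)" "x < 2 ^ q / 2 ^ p / 2" using x(3) unfolding d_def by auto
      have "1 / 2 ^ (p + 2) \<le> (1 / 2 ^ p :: real)" by (rule power_mono_half) simp
      then have "x < 1 / 2 ^ p" using b(1) by linarith
      then have "h1 z = circle_of (x * 2 ^ p / 2 ^ q)" unfolding x(1) using right1 True by blast
      moreover have "x * 2 ^ p / 2 ^ q < 1 / 2" using b(2) by (simp add: field_simps)
      ultimately have "h2 z = circle_of (x * 2 ^ p / 2 ^ q)" unfolding h2_def using n2fix True by simp
      moreover have "t z = circle_of (x * 2 ^ (p + 2) / 2 ^ (q + 2))"
        unfolding x(1) using circ_carries_affine[OF t(2), of x] True b(1) by (simp del: replicate_Suc add_2_eq_Suc')
      ultimately show ?thesis by (simp add: power_add)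
    next
      case False
      define y where "y = - x"
      have y: "0 \<le> y" "y < 1 / 2 ^ (p' + 2)" "0 < y" using False x(2) unfolding y_def d_def by auto
      have "1 / 2 ^ (p' + 2) \<le> (1 / 2 ^ p' :: real)" by (rule power_mono_half) simp
      then have "y < 1 / 2 ^ p'" using y(2) by linarith
      then have 1: "h2 z = circle_of (- (y * 2 ^ p' / 2 ^ q'))" using left2[OF y(1)] unfolding x(1) y_def by simp
      have "t (circle_of (1 - y)) = circle_of (1 - 1 / 2 ^ (q' + 2) + (1 - y - (1 - 1 / 2 ^ (p' + 2))) * 2 ^ (p' + 2) / 2 ^ (q' + 2))"
        using circ_carries_affine[OF t(3), of "1 - y"] y by (simp del: replicate_Suc add_2_eq_Suc' power_Suc)
      also have "1 - 1 / 2 ^ (q' + 2) + (1 - y - (1 - 1 / 2 ^ (p' + 2))) * 2 ^ (p' + 2) / 2 ^ (q' + 2) =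
          - (y * 2 ^ p' / 2 ^ q') + of_int 1"
        by (simp add: field_simps power_add)
      also have "circle_of (- (y * 2 ^ p' / 2 ^ q') + of_int 1) = circle_of (- (y * 2 ^ p' / 2 ^ q'))" by (rule circle_of_add_int)
      also have "circle_of (1 - y) = z" unfolding x(1) y_def using circle_of_add_int[of x 1] by (simp add: add.commute)
      finally show ?thesis using 1 by simp
    qed
  qed
  then have "circ0 \<notin> Tsing h2" using t(1) unfolding sing_def by blast
  then have "Tsing h2 \<subseteq> Tsing g - {circ0}" using s2 by blast
  moreover have "h2 = (n2 \<circ> n1) \<circ> g" unfolding h2_def h1_def by (simp add: comp_assoc)
  moreover have "n2 \<circ> n1 \<in> N" using n.N_comp n1(1) n2 by blast
  ultimately show ?thesis by (metis)
qed

text \<open>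
  Induction on the number of singular points. Dyadic rotations, which are in \<open>N\<close>, move a singular
  point and its image to the base point.
\<close>

theorem normalTA_full: assumes N: "normalTA N" shows "TA \<subseteq> N"
proof -
  interpret n: normal_dyad_group ycirc circ0 TA TA0 N by (rule N)
  have base: "g \<in> N" if g: "g \<in> TA" "Tsing g = {}" for g
  proof -
    have "circ.wordlike g" using circ.nonsing_wordlike g(2) unfolding ThompsonT_eq by blast
    then obtain k where k: "\<And>w. k \<le> length w \<Longrightarrow> \<exists>u. circ.carries g w u" unfolding circ.wordlike_def by blast
    obtain P Q where "cyc P" "cyc Q" "list_all2 (circ.carries g) P Q"
      using circ.word_map_cyc[OF TA.G_bij[OF g(1)], of k] k TA_cadj[OF g(1)] by blast
    then show ?thesis by (rule n.cyc_N)
  qed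
  have rotationN: "rotation \<theta> \<in> N" "rotation \<theta> \<in> TA" "Tsing (rotation \<theta>) = {}" if "dyadic \<theta>" for \<theta>
    using base[of "rotation \<theta>"] rotation_ThompsonT[OF that] ThompsonT_TA sing_self by auto
  have "g \<in> TA \<Longrightarrow> g \<in> N" for g
  proof (induction "card (Tsing g)" arbitrary: g rule: less_induct)
    case less
    have fin: "finite (Tsing g)" using less(2) unfolding TA_iff by blast
    show ?case
    proof (cases "Tsing g = {}")
      case True
      then show ?thesis using base less(2) by blast
    next
      case False
      then obtain p where p: "p \<in> Tsing g" by blast
      then have pD: "p \<in> dyadic_pts" using less(2) unfolding TA_iff by blast
      then obtain x where x: "p = circle_of x" "dyadic x" by blast
      obtain x' where x': "g p = circle_of x'" "dyadic x'" using pD TA_dyadic[OF less(2)] by blast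
      define g1 where "g1 = rotation (- x') \<circ> (g \<circ> rotation x)"
      have d: "dyadic (- x')" "dyadic (- x)" using x x' dyadic_uminus by auto
      have g1: "g1 \<in> TA" "g1 circ0 = circ0" unfolding g1_def using TA_comp rotationN(2) d x x' less(2) by auto
      obtain k where k: "k \<in> N" "Tsing (k \<circ> g1) \<subseteq> Tsing g1 - {circ0}" using remove_singularity[OF N g1] by blast
      have "g \<circ> rotation x \<in> Homeo" "rotation x \<in> Homeo" using TA_Homeo TA_comp rotationN(2) x less(2) by blast+
      then have "Tsing g1 \<subseteq> Tsing (g \<circ> rotation x) \<union> (g \<circ> rotation x) -` Tsing (rotation (- x'))"
        "Tsing (g \<circ> rotation x) \<subseteq> Tsing (rotation x) \<union> rotation x -` Tsing g"
        unfolding g1_def ThompsonT_eq using circ.sing_word_homeo_comp by blast+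
      then have "Tsing g1 \<subseteq> rotation x -` Tsing g" using rotationN(3) d x by auto
      moreover have ri: "rotation (- x) (rotation x z) = z" for z by (rule circle_surj[of z]) simp
      have "z \<in> rotation (- x) ` (Tsing g - {p})" if "z \<in> rotation x -` Tsing g - {circ0}" for z
      proof -
        have "rotation x z \<noteq> p"
        proof
          assume "rotation x z = p"
          then have "z = rotation (- x) p" using ri by metis
          then show False using that x by simp
        qed
        then show ?thesis using that ri[of z] by (intro image_eqI[of _ _ "rotation x z"]) auto
      qed
      ultimately have "Tsing (k \<circ> g1) \<subseteq> rotation (- x) ` (Tsing g - {p})" using k(2) by blast
      then have "card (Tsing (k \<circ> g1)) \<le> card (Tsing g - {p})"
        using fin by (meson card_image_le card_mono finite_Diff finite_imageI le_trans)
      also have "\<dots> < card (Tsing g)" using fin p by (meson card_Diff1_less)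
      finally have "k \<circ> g1 \<in> N" using less(1) k(1) g1(1) TA_comp n.N_sub by blast
      then have "finv k \<circ> (k \<circ> g1) \<in> N" using n.N_comp n.N_inv k(1) by blast
      moreover have "finv k \<circ> (k \<circ> g1) = g1" using TA.G_bij n.N_sub k(1) by (auto simp: fun_eq_iff)
      ultimately have "g1 \<in> N" by simp
      then have "rotation x' \<circ> (g1 \<circ> rotation (- x)) \<in> N" using n.N_comp rotationN(1) x' d by blast
      moreover have "rotation x' \<circ> (g1 \<circ> rotation (- x)) = g"
      proof
        fix z
        have "rotation x (rotation (- x) z) = z" by (rule circle_surj[of z]) simp
        moreover have "rotation x' (rotation (- x') w) = w" for w by (rule circle_surj[of w]) simp
        ultimately show "(rotation x' \<circ> (g1 \<circ> rotation (- x))) z = g z" unfolding g1_def by simp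
      qed
      ultimately show ?thesis by simp
    qed
  qed
  then show ?thesis by blast
qed

theorem TA_simple: "is_simple_group (comp_group TA)"
proof (rule simple_comp_groupI)
  show "id \<in> TA" by (rule TA_id)
  show "f \<circ> g \<in> TA" if "f \<in> TA" "g \<in> TA" for f g using that by (rule TA_comp)
  show "bij f" if "f \<in> TA" for f using that by (rule TA.G_bij)
  show "finv f \<in> TA" if "f \<in> TA" for f using that by (rule TA_inv)
  obtain f where f: "f \<in> TA" "circ.carries f [False] [True]" using TA.word_transitive by blast
  then have "f \<noteq> id" unfolding circ.carries_def by (auto dest: spec[of _ circ0])
  then show "\<exists>f\<in>TA. f \<noteq> id" using f(1) by blast
next
  fix N assume "N \<subseteq> TA" "id \<in> N" "\<And>f g. f \<in> N \<Longrightarrow> g \<in> N \<Longrightarrow> f \<circ> g \<in> N"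
    "\<And>f. f \<in> N \<Longrightarrow> finv f \<in> N" "\<And>f g. g \<in> TA \<Longrightarrow> f \<in> N \<Longrightarrow> g \<circ> f \<circ> finv g \<in> N" "\<exists>f\<in>N. f \<noteq> id"
  then have "normalTA N" by unfold_locales
  then show "TA \<subseteq> N" by (rule normalTA_full)
qed

section \<open>The Cantor set as a self-similar space\<close>

text \<open>
  The discrete metric. It induces a metric on infinite words, so these form a Hausdorff space.
\<close>

instantiation bool :: metric_space
begin

definition dist_bool :: "bool \<Rightarrow> bool \<Rightarrow> real" where "dist_bool a b = of_bool (a \<noteq> b)"

definition uniformity_bool :: "(bool \<times> bool) filter" where
  "uniformity_bool = (INF e\<in>{0<..}. principal {(x, y). dist x y < e})"

instance
proof
  show "uniformity = (INF e\<in>{0<..}. principal {(x :: bool, y). dist x y < e})" by (rule uniformity_bool_def)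
  show "open U \<longleftrightarrow> (\<forall>x\<in>U. eventually (\<lambda>(x', y). x' = x \<longrightarrow> y \<in> U) uniformity)" for U :: "bool set"
  proof -
    have "(uniformity :: (bool \<times> bool) filter) \<le> principal {(x, y). dist x y < 1}"
      unfolding uniformity_bool_def by (rule INF_lower) simp
    moreover have "eventually (\<lambda>(x', y). x' = x \<longrightarrow> y \<in> U) (principal {(x, y). dist x y < 1})" if "x \<in> U" for x
      using that by (auto simp: eventually_principal dist_bool_def)
    ultimately show ?thesis using filter_leD by (auto simp: open_discrete)
  qed
  show "dist x y = 0 \<longleftrightarrow> x = y" for x y :: bool by (simp add: dist_bool_def)
  show "dist x y \<le> dist x z + dist y z" for x y z :: bool by (simp add: dist_bool_def)
qed

end

definition ycan :: "bool \<Rightarrow> cantor \<Rightarrow> cantor" where "ycan a x = [a] \<frown> x"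

lemma ycan_0 [simp]: "ycan a x 0 = a" by (simp add: ycan_def)
lemma ycan_Suc [simp]: "ycan a x (Suc n) = x n" by (simp add: ycan_def)

interpretation can: dyad ycan
proof
  show "a = b \<and> x = z" if "ycan a x = ycan b z" for a b x z
    using fun_cong[OF that, of 0] fun_cong[OF that, of "Suc _"] by auto
  show "\<exists>a z. x = ycan a z" for x
  proof (intro exI[of _ "x 0"] exI[of _ "\<lambda>n. x (Suc n)"] ext)
    show "x n = ycan (x 0) (\<lambda>n. x (Suc n)) n" for n by (cases n) simp_all
  qed
qed

lemma ycan_conc: "ycan a (w \<frown> x) = (a # w) \<frown> x"
  by (simp add: ycan_def)

lemma can_W: "can.W w x = w \<frown> x"
  by (induction w) (simp_all add: ycan_conc)

lemma cone_iff: "x \<in> range (can.W w) \<longleftrightarrow> (\<forall>i<length w. x i = w ! i)"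
proof
  assume h: "\<forall>i<length w. x i = w ! i"
  have "x = can.W w (suffix (length w) x)"
    unfolding can_W by (rule ext) (use h in \<open>auto simp: conc_def suffix_def\<close>)
  then show "x \<in> range (can.W w)" by blast
qed (auto simp: can_W)

lemma open_cone: "open (range (can.W w))"
proof -
  have "range (can.W w) = (\<Inter>i<length w. (\<lambda>x. x i) -` {w ! i})"
    using cone_iff by (intro Set.set_eqI) auto
  moreover have "open ((\<lambda>x :: cantor. x i) -` {w ! i})" for i
    by (intro open_vimage continuous_on_product_coordinates) (simp add: open_discrete)
  ultimately show ?thesis by (simp add: open_INT)
qed

lemma closed_cone: "closed (range (can.W w))"
proof -
  have "range (can.W w) = (\<Inter>i<length w. (\<lambda>x. x i) -` {w ! i})"
    using cone_iff by (intro Set.set_eqI) auto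
  moreover have "closed ((\<lambda>x :: cantor. x i) -` {w ! i})" for i
    by (intro closed_vimage continuous_on_product_coordinates) simp
  ultimately show ?thesis by (simp add: closed_INT)
qed

definition wcut :: "cantor \<Rightarrow> nat \<Rightarrow> bool list" where "wcut x n = map x [0..<n]"

lemma length_wcut [simp]: "length (wcut x n) = n" by (simp add: wcut_def)

lemma in_cone_wcut: "z \<in> range (can.W (wcut x n)) \<longleftrightarrow> (\<forall>i<n. z i = x i)"
  unfolding cone_iff by (simp add: wcut_def)

lemma cone_wcut_mono: "m \<le> n \<Longrightarrow> range (can.W (wcut x n)) \<subseteq> range (can.W (wcut x m))"
  by (rule subsetI) (simp only: in_cone_wcut, auto)

lemma cone_basis:
  assumes "open U" "x \<in> U" shows "\<exists>n. range (can.W (wcut x n)) \<subseteq> U"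
proof -
  obtain X where X: "x \<in> Pi\<^sub>E UNIV X" "finite {i. X i \<noteq> UNIV}" "Pi\<^sub>E UNIV X \<subseteq> U"
    using product_topology_open_contains_basis[of "\<lambda>i. euclidean" UNIV U x] assms unfolding open_fun_def by auto
  define n where "n = (if {i. X i \<noteq> UNIV} = {} then 0 else Suc (Max {i. X i \<noteq> UNIV}))"
  have n: "i < n" if "X i \<noteq> UNIV" for i
    using Max_ge[OF X(2), of i] that unfolding n_def by (auto simp: less_Suc_eq_le)
  have "range (can.W (wcut x n)) \<subseteq> Pi\<^sub>E UNIV X"
  proof
    fix z assume "z \<in> range (can.W (wcut x n))"
    then have z: "\<forall>i<n. z i = x i" unfolding in_cone_wcut .
    have "z i \<in> X i" for i using z n[of i] X(1) by (cases "X i = UNIV") (auto simp: PiE_iff)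
    then show "z \<in> Pi\<^sub>E UNIV X" by auto
  qed
  then show ?thesis using X(3) by blast
qed

lemma compact_cantor: "compact (UNIV :: cantor set)"
proof -
  have "compact_space (euclidean :: bool topology)" by (simp add: compact_space_def finite_imp_compact)
  then have "compact_space (product_topology (\<lambda>i::nat. euclidean :: bool topology) UNIV)"
    unfolding compact_space_product_topology by blast
  then show ?thesis unfolding euclidean_product_topology compact_space_def by simp
qed

abbreviation "zero \<equiv> (\<lambda>_. False) :: cantor"

lemma wcut_append: "k \<le> n \<Longrightarrow> \<exists>v. wcut x n = wcut x k @ v"
  unfolding wcut_def by (metis le_add_diff_inverse map_append upt_add_eq_append zero_le)

interpretation can: top_dyad ycan zero
proof
  show "ycan False zero = zero" by (auto simp: fun_eq_iff ycan_def conc_def)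
  show "z = zero \<or> (\<exists>i x. z = can.W (at_scale i []) x)" for z
  proof (cases "\<exists>i. z i")
    case True
    define i where "i = (LEAST i. z i)"
    have "z i" "\<And>j. j < i \<Longrightarrow> \<not> z j" unfolding i_def using True by (auto intro: LeastI_ex dest: not_less_Least)
    then have "z \<in> range (can.W (at_scale i []))" unfolding cone_iff by (auto simp: at_scale_def nth_append less_Suc_eq)
    then show ?thesis by auto
  next
    case False
    then show ?thesis by auto
  qed
  show "compact (UNIV :: cantor set)" by (rule compact_cantor)
  show "\<exists>p. \<forall>U. open U \<longrightarrow> p \<in> U \<longrightarrow> (\<exists>k0. \<forall>k\<ge>k0. range (can.W (map x [0..<k])) \<subseteq> U)" for x
    using cone_basis[of _ x] cone_wcut_mono[of _ _ x] unfolding wcut_def by (intro exI[of _ x]) (meson subset_trans)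
  show "\<exists>w. range (can.W w) \<subseteq> U" if "open U" "U \<noteq> {}" for U using cone_basis that by blast
  show "\<exists>m0. \<forall>m\<ge>m0. p \<notin> closure (range (can.W (at_scale m [])))" for p
  proof -
    have c: "closure (range (can.W w)) = range (can.W w)" for w using closed_cone by (rule closure_closed)
    show ?thesis unfolding c
    proof (cases "\<exists>i x. p = can.W (at_scale i []) x")
      case True
      then obtain i x where "p = can.W (at_scale i []) x" by blast
      then have "p \<notin> range (can.W (at_scale m []))" if "Suc i \<le> m" for m
        using that can.W_at_scale_eqD[of i "[]" x m "[]"] by auto
      then show "\<exists>m0. \<forall>m\<ge>m0. p \<notin> range (can.W (at_scale m []))" by blast
    qed blast
  qed
  show "\<exists>M. range (can.W (replicate M False)) \<subseteq> U" if "open U" "zero \<in> U" for U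
    using cone_basis[OF that] by (simp add: wcut_def map_replicate_const)
  show "\<exists>V. open V \<and> zero \<in> V \<and> V \<inter> range (can.W [False]) \<subseteq> range (can.W (replicate M False))" for M
    using open_cone[of "replicate M False"] by (intro exI[of _ "range (can.W (replicate M False))"]) (auto simp: cone_iff simp del: image_iff)
qed

lemma carries_wcut_basis:
  assumes "can.carries f a u" "p \<in> range (can.W a)" "open V" "f p \<in> V"
  shows "\<exists>n\<ge>length a. f ` range (can.W (wcut p n)) \<subseteq> V"
proof -
  obtain \<psi> where p: "p = can.W a \<psi>" using assms(2) by blast
  have fp: "f p = can.W u \<psi>" using assms(1) p unfolding can.carries_def by simp
  obtain k where k: "range (can.W (wcut (f p) k)) \<subseteq> V" using cone_basis[OF assms(3,4)] by blast
  have "f z \<in> V" if "z \<in> range (can.W (wcut p (length a + k)))" for z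
  proof -
    have z: "\<forall>i<length a + k. z i = p i" using that unfolding in_cone_wcut .
    have "z \<in> range (can.W a)" using z unfolding cone_iff p can_W by auto
    then obtain \<theta> where c: "z = can.W a \<theta>" by blast
    have "\<theta> i = \<psi> i" if "i < k" for i
      using z[rule_format, of "length a + i"] that unfolding c p can_W by simp
    then have "\<forall>i<k. (u \<frown> \<theta>) i = (u \<frown> \<psi>) i" by (auto simp: conc_def)
    then have "f z \<in> range (can.W (wcut (f p) k))"
      unfolding in_cone_wcut fp using assms(1) c unfolding can.carries_def can_W by simp
    then show ?thesis using k by blast
  qed
  then show ?thesis by (intro exI[of _ "length a + k"]) auto
qed

lemma can_tiling_word_homeo:
  assumes P: "can.tiling P" and Q: "can.tiling Q" and f: "list_all2 (can.carries f) P Q"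
  shows "f \<in> can.word_homeo"
proof -
  have b: "bij f" by (rule can.realization_bij[OF P Q f])
  have "isCont f p" for p
    unfolding continuous_at_open
  proof (intro allI impI)
    fix V assume V: "open V \<and> f p \<in> V"
    obtain i z where i: "i < length P" "p = can.W (P ! i) z" using can.tiling_cover[OF P] .
    have r: "can.carries f (P ! i) (Q ! i)" using f i(1) by (simp add: list_all2_conv_all_nth)
    have "p \<in> range (can.W (P ! i))" using i(2) by blast
    from carries_wcut_basis[OF r this] V obtain n where "f ` range (can.W (wcut p n)) \<subseteq> V" by blast
    moreover have "p \<in> range (can.W (wcut p n))" by (simp add: in_cone_wcut)
    ultimately show "\<exists>S. open S \<and> p \<in> S \<and> (\<forall>x'\<in>S. f x' \<in> V)"
      using open_cone by (intro exI[of _ "range (can.W (wcut p n))"]) blast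
  qed
  then have "f \<in> Homeo"
    by (intro Homeo_compactI[OF compact_cantor b]) (simp add: continuous_on_eq_continuous_at)
  then show ?thesis unfolding can.word_homeo_def using can.wordlike_of_list[OF P f] by blast
qed

lemma can_cyc_word_homeo: "cyc P \<Longrightarrow> cyc Q \<Longrightarrow> list_all2 (can.carries f) P Q \<Longrightarrow> f \<in> can.word_homeo"
  using can_tiling_word_homeo can.cyc_tiling by blast

theorem ThompsonV_eq: "ThompsonV = can.word_homeo"
proof
  show "ThompsonV \<subseteq> can.word_homeo"
  proof
    fix f assume f: "f \<in> ThompsonV"
    have "can.wordlike f"
    proof (rule can.wordlike_koenig)
      fix x :: cantor
      obtain \<alpha> \<beta> where ab: "x \<in> range ((\<frown>) \<alpha>)" "germ_eq x f (prefix_repl \<alpha> \<beta>)"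
        using f unfolding ThompsonV_def by blast
      obtain U where U: "open U" "x \<in> U" "\<And>z. z \<in> U \<Longrightarrow> f z = prefix_repl \<alpha> \<beta> z"
        using germ_eqE[OF ab(2)] by blast
      obtain k where k: "range (can.W (wcut x k)) \<subseteq> U" using cone_basis U by blast
      define n where "n = length \<alpha> + k"
      have "wcut x (length \<alpha>) = \<alpha>" using ab(1) by (intro nth_equalityI) (auto simp: wcut_def)
      then obtain \<gamma> where \<gamma>: "wcut x n = \<alpha> @ \<gamma>" using wcut_append[of "length \<alpha>" n x] unfolding n_def by auto
      have "can.carries f (wcut x n) (\<beta> @ \<gamma>)" unfolding can.carries_def
      proof
        fix z
        have "can.W (wcut x n) z \<in> U" using k cone_wcut_mono[of k n x] unfolding n_def by auto
        then have "f (can.W (wcut x n) z) = prefix_repl \<alpha> \<beta> (\<alpha> \<frown> (\<gamma> \<frown> z))" using U(3) unfolding \<gamma> can_W by simp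
        then show "f (can.W (wcut x n) z) = can.W (\<beta> @ \<gamma>) z" unfolding prefix_repl_conc can_W by simp
      qed
      then show "\<exists>k u. can.carries f (map x [0..<k]) u" unfolding wcut_def by blast
    qed
    then show "f \<in> can.word_homeo" using f unfolding ThompsonV_def can.word_homeo_def by blast
  qed
  show "can.word_homeo \<subseteq> ThompsonV"
  proof
    fix f assume f: "f \<in> can.word_homeo"
    obtain n where n: "\<And>w. n \<le> length w \<Longrightarrow> \<exists>u. can.carries f w u" using f unfolding can.word_homeo_def can.wordlike_def by blast
    have "\<exists>\<alpha> \<beta>. p \<in> range ((\<frown>) \<alpha>) \<and> f p \<in> range ((\<frown>) \<beta>) \<and> germ_eq p f (prefix_repl \<alpha> \<beta>)" for p
    proof -
      obtain u where u: "can.carries f (wcut p n) u" using n[of "wcut p n"] by auto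
      have p: "p \<in> range (can.W (wcut p n))" by (simp add: in_cone_wcut)
      have "germ_eq p f (prefix_repl (wcut p n) u)"
        by (rule germ_eqI[OF open_cone p]) (use u in \<open>auto simp: can.carries_def can_W prefix_repl_conc simp del: length_wcut\<close>)
      moreover have "f p \<in> range ((\<frown>) u)"
      proof -
        obtain x where "p = can.W (wcut p n) x" using p by blast
        then have "f p = u \<frown> x" using u unfolding can.carries_def can_W by metis
        then show ?thesis by blast
      qed
      moreover have "p \<in> range ((\<frown>) (wcut p n))" using p unfolding can_W by simp
      ultimately show ?thesis by blast
    qed
    then show "f \<in> ThompsonV" using f can.word_homeo_Homeo unfolding ThompsonV_def by blast
  qed
qed

section \<open>Lexicographic order and neighbouring cones\<close>

abbreviation "lt \<equiv> less_fun :: cantor \<Rightarrow> cantor \<Rightarrow> bool"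

lemma lt_total: "x \<noteq> z \<Longrightarrow> lt x z \<or> lt z x"
proof -
  assume "x \<noteq> z"
  then have ex: "\<exists>k. x k \<noteq> z k" by auto
  define k where "k = (LEAST k. x k \<noteq> z k)"
  have "x k \<noteq> z k" "\<And>j. j < k \<Longrightarrow> x j = z j"
    unfolding k_def using LeastI_ex[OF ex] not_less_Least by blast+
  then show ?thesis unfolding less_fun_def by (cases "x k") auto
qed

lemma lt_ycan: "lt (ycan a x) (ycan b z) \<longleftrightarrow> a < b \<or> a = b \<and> lt x z"
proof
  assume "lt (ycan a x) (ycan b z)"
  then obtain k where k: "ycan a x k < ycan b z k" "\<And>j. j < k \<Longrightarrow> ycan a x j = ycan b z j" using \<open>lt (ycan a x) (ycan b z)\<close> unfolding less_fun_def by blast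
  show "a < b \<or> a = b \<and> lt x z"
  proof (cases k)
    case 0
    then show ?thesis using k(1) by simp
  next
    case (Suc l)
    then have "a = b" using k(2)[of 0] by simp
    moreover have "x l < z l" "\<And>j. j < l \<Longrightarrow> x j = z j" using k Suc k(2)[of "Suc _"] by auto
    ultimately show ?thesis unfolding less_fun_def by blast
  qed
next
  assume "a < b \<or> a = b \<and> lt x z"
  then show "lt (ycan a x) (ycan b z)"
  proof
    assume "a < b"
    then show ?thesis unfolding less_fun_def by (intro exI[of _ 0]) simp
  next
    assume h: "a = b \<and> lt x z"
    then obtain k where "x k < z k" "\<And>j. j < k \<Longrightarrow> x j = z j" by (auto elim: less_funE)
    then show ?thesis using h unfolding less_fun_def
      by (intro exI[of _ "Suc k"]) (auto simp: less_Suc_eq_0_disj)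
  qed
qed

lemma lt_W [simp]: "lt (can.W w x) (can.W w z) \<longleftrightarrow> lt x z"
  by (induction w) (simp_all add: lt_ycan)

text \<open>
  What makes the elements of \<open>F\<close> increasing.
\<close>

lemma leaf_lt_sorted: "leaf P \<Longrightarrow> sorted_wrt (\<lambda>a b. \<forall>x z. lt (can.W a x) (can.W b z)) P"
proof (induction rule: leaf.induct)
  case (leaf_node P Q)
  then show ?case by (auto simp: sorted_wrt_append sorted_wrt_map lt_ycan)
qed simp

lemma F_like_mono:
  assumes "can.F_like h" "lt x z" shows "lt (h x) (h z)"
proof -
  obtain P Q where PQ: "leaf P" "leaf Q" "list_all2 (can.carries h) P Q" using assms(1) unfolding can.F_like_def by blast
  have len: "length P = length Q" using PQ(3) by (simp add: list_all2_lengthD)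
  obtain i x' where i: "i < length P" "x = can.W (P ! i) x'" using can.tiling_cover[OF can.leaf_tiling[OF PQ(1)]] .
  obtain j z' where j: "j < length P" "z = can.W (P ! j) z'" using can.tiling_cover[OF can.leaf_tiling[OF PQ(1)]] .
  have sP: "lt (can.W (P ! r) u) (can.W (P ! s) v)" if "r < s" "s < length P" for r s u v
    using sorted_wrt_nth_less[OF leaf_lt_sorted[OF PQ(1)] that] by blast
  have sQ: "lt (can.W (Q ! r) u) (can.W (Q ! s) v)" if "r < s" "s < length P" for r s u v
    using sorted_wrt_nth_less[OF leaf_lt_sorted[OF PQ(2)]] that len by auto
  have h: "h x = can.W (Q ! i) x'" "h z = can.W (Q ! j) z'"
    using i j PQ(3) by (auto simp: list_all2_conv_all_nth can.carries_def)
  consider "i < j" | "i = j" | "j < i" by linarith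
  then show ?thesis
  proof cases
    case 1
    then show ?thesis unfolding h using sQ j(1) by blast
  next
    case 2
    then show ?thesis unfolding h using assms(2) i j by simp
  next
    case 3
    then have "lt z x" using sP i j by blast
    then show ?thesis using assms(2) less_fun_asym by blast
  qed
qed

lemma zero_least: "x \<noteq> zero \<Longrightarrow> lt zero x"
  using lt_total[of x zero] unfolding less_fun_def by auto

lemma lt_zero_cone: "lt z x \<Longrightarrow> x \<in> range (can.W (replicate M False)) \<Longrightarrow> z \<in> range (can.W (replicate M False))"
proof -
  assume h: "lt z x" "x \<in> range (can.W (replicate M False))"
  obtain k where k: "z k < x k" "\<And>j. j < k \<Longrightarrow> z j = x j" using h(1) unfolding less_fun_def by blast
  have x: "\<forall>i<M. \<not> x i" using h(2) unfolding cone_iff by simp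
  then have "M \<le> k" using k(1) by (meson not_less less_bool_def)
  then show ?thesis unfolding cone_iff using x k(2) by simp
qed

abbreviation "ones \<equiv> (\<lambda>_. True) :: cantor"

lemma no_between: "\<not> (lt (can.W (s @ [False]) ones) z \<and> lt z (can.W (s @ [True]) zero))"
proof (induction s arbitrary: z)
  case Nil
  obtain t z' where z: "z = ycan t z'" using can.y_surj by blast
  have "\<not> lt ones z'" "\<not> lt z' zero" unfolding less_fun_def by auto
  then show ?case unfolding z by (cases t) (auto simp: lt_ycan)
next
  case (Cons a s)
  obtain t z' where z: "z = ycan t z'" using can.y_surj by blast
  show ?case unfolding z using Cons by (auto simp: lt_ycan)
qed

text \<open>
  The lexicographic order has jumps, namely between \<open>s0111...\<close> and \<open>s1000...\<close>. They characterize adjacency of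
  words, so maps that are increasing near a point preserve adjacency there.
\<close>

lemma gap_form:
  assumes "lt x z" "\<And>w. \<not> (lt x w \<and> lt w z)"
  obtains s where "x = can.W (s @ [False]) ones" "z = can.W (s @ [True]) zero"
proof -
  obtain k where k: "x k < z k" "\<And>j. j < k \<Longrightarrow> x j = z j" using assms(1) unfolding less_fun_def by blast
  define s where "s = wcut x k"
  have xk: "\<not> x k" "z k" using k(1) by auto
  have "x \<in> range (can.W (s @ [False]))" unfolding cone_iff s_def using xk by (auto simp: nth_append less_Suc_eq wcut_def)
  then obtain x' where x': "x = can.W (s @ [False]) x'" by blast
  have "z \<in> range (can.W (s @ [True]))" unfolding cone_iff s_def using xk k(2) by (auto simp: nth_append less_Suc_eq wcut_def)
  then obtain z' where z': "z = can.W (s @ [True]) z'" by blast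
  have "x' = ones"
  proof (rule ccontr)
    assume "x' \<noteq> ones"
    then have "lt x' ones" using lt_total[of x' ones] unfolding less_fun_def by auto
    then have "lt x (can.W (s @ [False]) ones)" unfolding x' by (simp add: lt_ycan)
    moreover have "lt (can.W (s @ [False]) ones) z" unfolding z' by (simp add: lt_ycan)
    ultimately show False using assms(2) by blast
  qed
  moreover have "z' = zero"
  proof (rule ccontr)
    assume "z' \<noteq> zero"
    then have "lt (can.W (s @ [True]) zero) z" unfolding z' using zero_least by (simp add: lt_ycan)
    moreover have "lt x (can.W (s @ [True]) zero)" unfolding x' by (simp add: lt_ycan)
    ultimately show False using assms(2) by blast
  qed
  ultimately show ?thesis using that x' z' by blast
qed

lemma const_word: "can.W u (\<lambda>_. t) = (\<lambda>_. t) \<longleftrightarrow> (\<exists>k. u = replicate k t)"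
proof
  assume h: "can.W u (\<lambda>_. t) = (\<lambda>_. t)"
  have "u = replicate (length u) t"
  proof (rule nth_equalityI)
    fix i assume "i < length u"
    then show "u ! i = replicate (length u) t ! i" using fun_cong[OF h, of i] unfolding can_W by simp
  qed simp
  then show "\<exists>k. u = replicate k t" by blast
qed (auto simp: can_W conc_def fun_eq_iff)

lemma tail_word: "can.W u (\<lambda>_. t) = can.W (s @ [\<not> t]) (\<lambda>_. t) \<Longrightarrow> \<exists>k. u = s @ (\<not> t) # replicate k t"
proof (induction u arbitrary: s)
  case Nil
  have "can.W (s @ [\<not> t]) (\<lambda>_. t) (length s) = (\<not> t)" unfolding can_W by (simp add: nth_append)
  then show ?case using Nil by (simp flip: Nil)
next
  case (Cons a u)
  show ?case
  proof (cases s)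
    case Nil
    then have "a = (\<not> t)" "can.W u (\<lambda>_. t) = (\<lambda>_. t)" using Cons(2) by auto
    then show ?thesis using const_word Nil by auto
  next
    case (Cons b s')
    then have "a = b" "can.W u (\<lambda>_. t) = can.W (s' @ [\<not> t]) (\<lambda>_. t)" using Cons.prems by auto
    then show ?thesis using Cons.IH Cons by auto
  qed
qed

lemma adj_of_gap:
  assumes "lt (can.W u ones) (can.W v zero)" "\<And>w. \<not> (lt (can.W u ones) w \<and> lt w (can.W v zero))"
  shows "adj u v"
proof -
  obtain s where s: "can.W u ones = can.W (s @ [False]) ones" "can.W v zero = can.W (s @ [True]) zero"
    using gap_form[OF assms] .
  obtain k where "u = s @ False # replicate k True" using tail_word[of u True s] s(1) by auto
  moreover obtain l where "v = s @ True # replicate l False" using tail_word[of v False s] s(2) by auto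
  ultimately show ?thesis unfolding adj_def by blast
qed

lemma adj_no_between:
  assumes "adj a b" shows "lt (can.W a ones) (can.W b zero)" "\<not> (lt (can.W a ones) w \<and> lt w (can.W b zero))"
proof -
  obtain s i j where ab: "a = s @ False # replicate i True" "b = s @ True # replicate j False"
    using assms unfolding adj_def by blast
  have r: "can.W (replicate k t) (\<lambda>_. t) = (\<lambda>_. t)" for k t using const_word by blast
  have "can.W a ones = can.W (s @ [False]) ones" "can.W b zero = can.W (s @ [True]) zero" unfolding ab by (simp_all add: r)
  then show "lt (can.W a ones) (can.W b zero)" "\<not> (lt (can.W a ones) w \<and> lt w (can.W b zero))"
    using no_between by (simp_all add: lt_ycan)
qed

section \<open>Cantor set homeomorphisms with shift-equivariant germs\<close>

abbreviation "Vsing \<equiv> sing ThompsonV"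

definition const_tail :: "cantor \<Rightarrow> bool" where "const_tail p \<longleftrightarrow> (\<exists>\<alpha> a. p = \<alpha> \<frown> [a]\<^sup>\<omega>)"

lemma iter_single: "[a]\<^sup>\<omega> = (\<lambda>_. a)" by (auto simp: iter_def)

lemma const_tail_iff: "const_tail p \<longleftrightarrow> (\<exists>\<alpha> a. p = can.W \<alpha> (\<lambda>_. a))"
  unfolding const_tail_def iter_single can_W ..

definition mono_at :: "(cantor \<Rightarrow> cantor) \<Rightarrow> cantor \<Rightarrow> bool" where
  "mono_at f p \<longleftrightarrow> (\<exists>U. open U \<and> p \<in> U \<and> monotone_on U less_fun less_fun f)"
definition L_at :: "(cantor \<Rightarrow> cantor) \<Rightarrow> cantor \<Rightarrow> bool" where
  "L_at f p \<longleftrightarrow> (\<exists>L L'. tail_L p L \<and> tail_L (f p) L' \<and> germ_eq p (L' \<circ> f) (f \<circ> L))"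
text \<open>
  The condition that \<open>VA\<close> imposes at singular points. An element of \<open>V\<close> satisfies it at every eventually constant point, so
  it may be required at all of these.
\<close>

definition V_regular :: "(cantor \<Rightarrow> cantor) \<Rightarrow> cantor \<Rightarrow> bool" where
  "V_regular f p \<longleftrightarrow> mono_at f p \<and> L_at f p"

lemma VA_unfold: "f \<in> VA \<longleftrightarrow> f \<in> Homeo \<and> finite (Vsing f) \<and> (\<forall>p\<in>Vsing f. const_tail p) \<and> (\<forall>p\<in>Vsing f. V_regular f p)"
  unfolding VA_def const_tail_def V_regular_def mono_at_def L_at_def by simp

lemma tail_L_const_tail: "tail_L p L \<Longrightarrow> const_tail p" unfolding tail_L_def const_tail_def by blast

lemma prefix_repl_nth: "prefix_repl \<alpha> \<beta> x i = (if i < length \<beta> then \<beta> ! i else x (length \<alpha> + (i - length \<beta>)))"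
  by (simp add: prefix_repl_def conc_def suffix_def)

lemma prefix_repl_tendsto: "filterlim (prefix_repl \<alpha> \<beta>) (nhds (prefix_repl \<alpha> \<beta> p)) (nhds p)"
proof -
  have "continuous_on UNIV (\<lambda>x. prefix_repl \<alpha> \<beta> x i)" for i
    unfolding prefix_repl_nth by (cases "i < length \<beta>") simp_all
  then have "continuous_on UNIV (prefix_repl \<alpha> \<beta>)" by (rule continuous_on_coordinatewise_then_product)
  then have "isCont (prefix_repl \<alpha> \<beta>) p" by (simp add: continuous_on_eq_continuous_at)
  then show ?thesis unfolding isCont_def tendsto_at_iff_tendsto_nhds .
qed

lemma tail_L_fix: assumes "tail_L p L" shows "L p = p"
proof -
  obtain \<alpha> a where p: "p = \<alpha> \<frown> [a]\<^sup>\<omega>" "L = prefix_repl (\<alpha> @ [a]) \<alpha>" using assms unfolding tail_L_def by blast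
  show ?thesis by (rule ext) (simp add: p prefix_repl_nth iter_single conc_def)
qed

lemma tail_L_tendsto: assumes "tail_L p L" shows "filterlim L (nhds p) (nhds p)"
proof -
  have "filterlim L (nhds (L p)) (nhds p)" using assms prefix_repl_tendsto unfolding tail_L_def by blast
  then show ?thesis by (simp only: tail_L_fix[OF assms])
qed

lemma tail_L_germ: assumes "tail_L p L" "tail_L p L'" shows "germ_eq p L L'"
proof -
  obtain \<alpha> a where p: "p = \<alpha> \<frown> [a]\<^sup>\<omega>" "L = prefix_repl (\<alpha> @ [a]) \<alpha>" using assms unfolding tail_L_def by blast
  obtain \<beta> b where q: "p = \<beta> \<frown> [b]\<^sup>\<omega>" "L' = prefix_repl (\<beta> @ [b]) \<beta>" using assms unfolding tail_L_def by blast
  have pa: "p i = (if i < length \<alpha> then \<alpha> ! i else a)" for i by (simp add: p(1) iter_single conc_def)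
  have pb: "p i = (if i < length \<beta> then \<beta> ! i else b)" for i by (simp add: q(1) iter_single conc_def)
  define N where "N = Suc (max (length \<alpha>) (length \<beta>))"
  show ?thesis
  proof (rule germ_eqI[OF open_cone])
    show "p \<in> range (can.W (wcut p N))" by (simp only: in_cone_wcut, simp)
    fix x assume "x \<in> range (can.W (wcut p N))"
    then have x: "\<And>i. i < N \<Longrightarrow> x i = p i" unfolding in_cone_wcut by blast
    show "L x = L' x"
    proof
      fix i
      have L: "L x i = (if i < length \<alpha> then p i else x (Suc i))" unfolding p(2) prefix_repl_nth pa by auto
      have L': "L' x i = (if i < length \<beta> then p i else x (Suc i))" unfolding q(2) prefix_repl_nth pb by auto
      have "x (Suc i) = p i" if "length \<alpha> \<le> i" "i < length \<beta>"
        using x[of "Suc i"] that pa[of i] pa[of "Suc i"] unfolding N_def by auto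
      moreover have "x (Suc i) = p i" if "length \<beta> \<le> i" "i < length \<alpha>"
        using x[of "Suc i"] that pb[of i] pb[of "Suc i"] unfolding N_def by auto
      ultimately show "L x i = L' x i" unfolding L L' by auto
    qed
  qed
qed

lemma mono_at_cong: assumes "germ_eq p f t" "mono_at t p" shows "mono_at f p"
proof -
  obtain U where U: "open U" "p \<in> U" "\<And>x. x \<in> U \<Longrightarrow> f x = t x" using germ_eqE[OF assms(1)] by blast
  obtain V where V: "open V" "p \<in> V" "monotone_on V less_fun less_fun t" using assms(2) unfolding mono_at_def by blast
  have "monotone_on (U \<inter> V) less_fun less_fun f" using U(3) V(3) unfolding monotone_on_def by simp
  then show ?thesis unfolding mono_at_def using U V by (intro exI[of _ "U \<inter> V"]) auto
qed

lemma L_at_cong: assumes "germ_eq p f t" "L_at t p" shows "L_at f p"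
proof -
  have e: "f p = t p" by (rule germ_eq_at[OF assms(1)])
  obtain L L' where L: "tail_L p L" "tail_L (t p) L'" "germ_eq p (L' \<circ> t) (t \<circ> L)" using assms(2) unfolding L_at_def by blast
  have "germ_eq p (L' \<circ> f) (L' \<circ> t)" by (rule germ_eq_left[OF assms(1)])
  moreover have "germ_eq p (t \<circ> L) (f \<circ> L)"
    by (rule germ_eq_right) (simp_all add: tail_L_fix[OF L(1)] germ_eq_sym[OF assms(1)] tail_L_tendsto[OF L(1)])
  ultimately have "germ_eq p (L' \<circ> f) (f \<circ> L)" using L(3) germ_eq_trans by blast
  then show ?thesis unfolding L_at_def e using L(1,2) by blast
qed

lemma V_regular_cong: "germ_eq p f t \<Longrightarrow> V_regular t p \<Longrightarrow> V_regular f p"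
  unfolding V_regular_def using mono_at_cong L_at_cong by blast

lemma V_regular_prefix:
  assumes "can.carries t w u" "p = can.W w (\<lambda>_. a)" shows "V_regular t p"
proof -
  have rt: "t (can.W w z) = can.W u z" for z using assms(1) unfolding can.carries_def by blast
  have "monotone_on (range (can.W w)) less_fun less_fun t"
    unfolding monotone_on_def by (auto simp: rt)
  then have 1: "mono_at t p" unfolding mono_at_def using open_cone[of w] assms(2) by blast
  have "tail_L p (prefix_repl (w @ [a]) w)" unfolding tail_L_def using assms(2) by (auto simp: can_W iter_single)
  moreover have "tail_L (t p) (prefix_repl (u @ [a]) u)" unfolding tail_L_def assms(2) rt by (auto simp: can_W iter_single)
  moreover have "germ_eq p (prefix_repl (u @ [a]) u \<circ> t) (t \<circ> prefix_repl (w @ [a]) w)"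
  proof (rule germ_eqI[OF open_cone])
    have "ycan a (\<lambda>_. a) = (\<lambda>_. a)"
    proof
      fix n show "ycan a (\<lambda>_. a) n = a" by (cases n) (simp_all add: ycan_def)
    qed
    then have "p = can.W (w @ [a]) (\<lambda>_. a)" unfolding assms(2) by simp
    then show "p \<in> range (can.W (w @ [a]))" by blast
    fix x assume "x \<in> range (can.W (w @ [a]))"
    then obtain z where "x = can.W (w @ [a]) z" by blast
    then show "(prefix_repl (u @ [a]) u \<circ> t) x = (t \<circ> prefix_repl (w @ [a]) w) x"
      using rt[of "[a] \<frown> z"] rt[of z] prefix_repl_conc[of "w @ [a]" w z] prefix_repl_conc[of "u @ [a]" u z]
      by (simp add: can_W)
  qed
  ultimately show ?thesis using 1 unfolding V_regular_def L_at_def by blast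
qed

lemma const_tail_wcut: "p = can.W \<alpha> (\<lambda>_. a) \<Longrightarrow> length \<alpha> \<le> n \<Longrightarrow> p = can.W (wcut p n) (\<lambda>_. a)"
  unfolding can_W by (rule ext) (auto simp: conc_def wcut_def)

lemma word_homeo_V_regular: assumes "t \<in> can.word_homeo" "const_tail p" shows "V_regular t p"
proof -
  obtain n where n: "\<And>w. n \<le> length w \<Longrightarrow> \<exists>u. can.carries t w u" using assms(1) unfolding can.word_homeo_def can.wordlike_def by blast
  obtain \<alpha> a where p: "p = can.W \<alpha> (\<lambda>_. a)" using assms(2) const_tail_iff by blast
  obtain u where "can.carries t (wcut p (length \<alpha> + n)) u" using n[of "wcut p (length \<alpha> + n)"] by auto
  then show ?thesis by (rule V_regular_prefix[OF _ const_tail_wcut[OF p]]) simp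
qed

lemma VA_iff: "f \<in> VA \<longleftrightarrow> f \<in> Homeo \<and> finite (Vsing f) \<and> (\<forall>p\<in>Vsing f. const_tail p) \<and> (\<forall>p. const_tail p \<longrightarrow> V_regular f p)"
proof
  assume f: "f \<in> VA"
  have "V_regular f p" if "const_tail p" for p
  proof (cases "p \<in> Vsing f")
    case True
    then show ?thesis using f unfolding VA_unfold by blast
  next
    case False
    then have "\<exists>t\<in>ThompsonV. germ_eq p f t" unfolding sing_def by blast
    then show ?thesis using V_regular_cong word_homeo_V_regular[OF _ that] unfolding ThompsonV_eq by blast
  qed
  then show "f \<in> Homeo \<and> finite (Vsing f) \<and> (\<forall>p\<in>Vsing f. const_tail p) \<and> (\<forall>p. const_tail p \<longrightarrow> V_regular f p)"
    using f unfolding VA_unfold by blast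
qed (auto simp: VA_unfold)

lemma VA_Homeo: "f \<in> VA \<Longrightarrow> f \<in> Homeo" by (simp add: VA_iff)

lemma word_homeo_VA: assumes "f \<in> can.word_homeo" shows "f \<in> VA"
  using assms sing_self[OF assms] can.word_homeo_Homeo unfolding VA_unfold ThompsonV_eq by auto

lemma V_regular_const_tail: "V_regular f p \<Longrightarrow> const_tail (f p)" "V_regular f p \<Longrightarrow> const_tail p"
  unfolding V_regular_def L_at_def using tail_L_const_tail by blast+

lemma V_regular_comp:
  assumes g: "V_regular g p" "g \<in> Homeo" and f: "V_regular f (g p)" shows "V_regular (f \<circ> g) p"
proof -
  obtain U where U: "open U" "p \<in> U" "monotone_on U less_fun less_fun g" using g unfolding V_regular_def mono_at_def by blast
  obtain V where V: "open V" "g p \<in> V" "monotone_on V less_fun less_fun f" using f unfolding V_regular_def mono_at_def by blast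
  have "open (U \<inter> g -` V)" using U V Homeo_open_vimage[OF g(2)] by blast
  moreover have "monotone_on (U \<inter> g -` V) less_fun less_fun (f \<circ> g)" using U(3) V(3) unfolding monotone_on_def by simp
  ultimately have 1: "mono_at (f \<circ> g) p" unfolding mono_at_def using U V by (intro exI[of _ "U \<inter> g -` V"]) auto
  obtain L L1 where L: "tail_L p L" "tail_L (g p) L1" "germ_eq p (L1 \<circ> g) (g \<circ> L)" using g unfolding V_regular_def L_at_def by blast
  obtain L1' L2 where L': "tail_L (g p) L1'" "tail_L (f (g p)) L2" "germ_eq (g p) (L2 \<circ> f) (f \<circ> L1')" using f unfolding V_regular_def L_at_def by blast
  note tg = Homeo_tendsto[OF g(2), of p]
  have a: "germ_eq p ((L2 \<circ> f) \<circ> g) ((f \<circ> L1') \<circ> g)" by (rule germ_eq_right[OF L'(3) tg])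
  have "germ_eq p (L1' \<circ> g) (L1 \<circ> g)" by (rule germ_eq_right[OF tail_L_germ[OF L'(1) L(2)] tg])
  then have b: "germ_eq p (f \<circ> (L1' \<circ> g)) (f \<circ> (L1 \<circ> g))" by (rule germ_eq_left)
  have c: "germ_eq p (f \<circ> (L1 \<circ> g)) (f \<circ> (g \<circ> L))" by (rule germ_eq_left[OF L(3)])
  have "germ_eq p (L2 \<circ> (f \<circ> g)) ((f \<circ> g) \<circ> L)"
    using germ_eq_trans[OF a[unfolded comp_assoc] germ_eq_trans[OF b c]] by (simp add: comp_assoc)
  then show ?thesis using 1 L(1) L'(2) unfolding V_regular_def L_at_def by auto
qed

lemma V_regular_inv: assumes f: "V_regular f p" "f \<in> Homeo" shows "V_regular (finv f) (f p)"
proof -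
  have b: "bij f" using f Homeo_bij by blast
  note op = Homeo_open_vimage[OF Homeo_inv[OF f(2)]]
  obtain U where U: "open U" "p \<in> U" "monotone_on U less_fun less_fun f" using f unfolding V_regular_def mono_at_def by blast
  have "monotone_on (finv f -` U) less_fun less_fun (finv f)"
    unfolding monotone_on_def
  proof (intro ballI impI)
    fix x z assume h: "x \<in> finv f -` U" "z \<in> finv f -` U" "lt x z"
    show "lt (finv f x) (finv f z)"
    proof (rule ccontr)
      assume "\<not> lt (finv f x) (finv f z)"
      then have "finv f x = finv f z \<or> lt (finv f z) (finv f x)" using lt_total by blast
      then have "x = z \<or> lt z x"
        using U(3) h(1,2) b unfolding monotone_on_def by (metis bij_simps(1) vimageE)
      then show False using h(3) less_fun_irrefl less_fun_asym by blast
    qed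
  qed
  then have 1: "mono_at (finv f) (f p)" unfolding mono_at_def using op[OF U(1)] U(2) b by (intro exI[of _ "finv f -` U"]) auto
  obtain L L' where L: "tail_L p L" "tail_L (f p) L'" "germ_eq p (L' \<circ> f) (f \<circ> L)" using f unfolding V_regular_def L_at_def by blast
  obtain V where V: "open V" "p \<in> V" "\<And>x. x \<in> V \<Longrightarrow> (L' \<circ> f) x = (f \<circ> L) x" using germ_eqE[OF L(3)] by blast
  have "germ_eq (f p) (L \<circ> finv f) (finv f \<circ> L')"
  proof (rule germ_eqI[OF op[OF V(1)]])
    show "f p \<in> finv f -` V" using V(2) b by simp
    fix z assume "z \<in> finv f -` V"
    then have "L' z = f (L (finv f z))" using V(3)[of "finv f z"] b by simp
    then show "(L \<circ> finv f) z = (finv f \<circ> L') z" using b by simp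
  qed
  moreover have "tail_L (finv f (f p)) L" using L(1) b by simp
  ultimately show ?thesis using 1 L(2) unfolding V_regular_def L_at_def by blast
qed

lemma VA_inv: assumes "f \<in> VA" shows "finv f \<in> VA"
proof -
  have fh: "f \<in> Homeo" and b: "bij f" using assms VA_Homeo Homeo_bij by auto
  have s: "Vsing (finv f) \<subseteq> f ` Vsing f" using can.sing_word_homeo_inv[OF fh] unfolding ThompsonV_eq .
  then have "finite (Vsing (finv f))" using assms finite_subset unfolding VA_iff by blast
  moreover have v: "V_regular (finv f) (f p)" if "p \<in> Vsing f" for p
    using assms that V_regular_inv fh unfolding VA_iff by blast
  ultimately show ?thesis using s Homeo_inv[OF fh] V_regular_const_tail(2) unfolding VA_unfold by blast
qed

lemma VA_const_tail: assumes "f \<in> VA" shows "const_tail (f p) \<longleftrightarrow> const_tail p"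
proof
  show "const_tail p \<Longrightarrow> const_tail (f p)" using assms V_regular_const_tail unfolding VA_iff by blast
  assume "const_tail (f p)"
  then have "const_tail (finv f (f p))" using VA_inv[OF assms] V_regular_const_tail unfolding VA_iff by blast
  then show "const_tail p" using Homeo_bij[OF VA_Homeo[OF assms]] by simp
qed

lemma VA_comp: assumes "f \<in> VA" "g \<in> VA" shows "f \<circ> g \<in> VA"
proof -
  have gh: "g \<in> Homeo" and fh: "f \<in> Homeo" using assms VA_Homeo by auto
  have s: "Vsing (f \<circ> g) \<subseteq> Vsing g \<union> g -` Vsing f" using can.sing_word_homeo_comp[OF gh] unfolding ThompsonV_eq .
  have "const_tail p" if "p \<in> Vsing (f \<circ> g)" for p
  proof -
    from s that have "p \<in> Vsing g \<or> g p \<in> Vsing f" by auto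
    then show ?thesis using assms VA_const_tail[OF assms(2)] unfolding VA_iff by blast
  qed
  moreover have "finite (Vsing (f \<circ> g))"
    using can.finite_sing_comp[OF gh, of f] assms unfolding VA_iff ThompsonV_eq by blast
  moreover have "V_regular (f \<circ> g) p" if "const_tail p" for p
    using V_regular_comp gh assms that V_regular_const_tail(1) unfolding VA_iff by blast
  ultimately show ?thesis using Homeo_comp[OF fh gh] unfolding VA_iff by blast
qed

lemma VA_id: "id \<in> VA" using word_homeo_VA can.word_homeo_id by blast

lemma const_tail_zero: "const_tail zero" unfolding const_tail_iff by (intro exI[of _ "[]"]) auto

lemma tail_L_zero:
  assumes "tail_L zero L" shows "\<exists>k. \<forall>z\<in>range (can.W (replicate k False)). L (ycan False z) = z"
proof -
  obtain \<alpha> a where p: "zero = \<alpha> \<frown> [a]\<^sup>\<omega>" "L = prefix_repl (\<alpha> @ [a]) \<alpha>" using assms unfolding tail_L_def by blast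
  have pa: "(if i < length \<alpha> then \<alpha> ! i else a) = False" for i
    using fun_cong[OF p(1), of i] by (simp add: iter_single conc_def)
  have al: "\<not> \<alpha> ! i" if "i < length \<alpha>" for i using pa[of i] that by simp
  have "L (ycan False z) = z" if "z \<in> range (can.W (replicate (length \<alpha>) False))" for z
  proof
    fix i
    have "\<not> z i" if "i < length \<alpha>" using \<open>z \<in> _\<close> that unfolding cone_iff by simp
    then show "L (ycan False z) i = z i" unfolding p(2) prefix_repl_nth using al by simp
  qed
  then show ?thesis by blast
qed

lemma VA_shrink:
  assumes g: "g \<in> Homeo" "g zero = zero"
  shows "\<exists>m. g ` range (can.W (replicate m False)) \<subseteq> range (can.W (replicate M False))"
proof -
  have "open (g -` range (can.W (replicate M False)))" by (rule Homeo_open_vimage[OF g(1) open_cone])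
  moreover have "zero \<in> g -` range (can.W (replicate M False))" using g(2) can.W_zeros_pt[of M] by (metis rangeI vimageI)
  ultimately obtain m where "range (can.W (replicate m False)) \<subseteq> g -` range (can.W (replicate M False))"
    using can.shrink by blast
  then show ?thesis by blast
qed

lemma VA_commute:
  assumes g: "g \<in> VA" "g zero = zero"
  shows "\<exists>m. \<forall>z\<in>range (can.W (replicate m False)). g (ycan False z) = ycan False (g z)"
proof -
  have gh: "g \<in> Homeo" using g VA_Homeo by blast
  obtain L L' where L: "tail_L zero L" "tail_L zero L'" "germ_eq zero (L' \<circ> g) (g \<circ> L)"
    using g const_tail_zero unfolding VA_iff V_regular_def L_at_def by metis
  obtain k where k: "\<And>z. z \<in> range (can.W (replicate k False)) \<Longrightarrow> L (ycan False z) = z" using tail_L_zero[OF L(1)] by blast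
  obtain k' where k': "\<And>z. z \<in> range (can.W (replicate k' False)) \<Longrightarrow> L' (ycan False z) = z" using tail_L_zero[OF L(2)] by blast
  obtain U where U: "open U" "zero \<in> U" "\<And>x. x \<in> U \<Longrightarrow> (L' \<circ> g) x = (g \<circ> L) x" using germ_eqE[OF L(3)] by blast
  obtain M where M: "range (can.W (replicate M False)) \<subseteq> U" using can.shrink U by blast
  obtain m1 where m1: "g ` range (can.W (replicate m1 False)) \<subseteq> range (can.W (replicate (Suc k') False))" using VA_shrink[OF gh g(2)] by blast
  have "g (ycan False z) = ycan False (g z)" if z: "z \<in> range (can.W (replicate (k + M + m1) False))" for z
  proof -
    have "ycan False z \<in> range (can.W (replicate (Suc (k + M + m1)) False))" using z by auto
    then have w: "ycan False z \<in> range (can.W (replicate M False))" "ycan False z \<in> range (can.W (replicate m1 False))"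
      using subsetD[OF can.zeros_antimono[of M "Suc (k + M + m1)"]] subsetD[OF can.zeros_antimono[of m1 "Suc (k + M + m1)"]]
      by (simp_all del: replicate_Suc)
    have "z \<in> range (can.W (replicate k False))" using z subsetD[OF can.zeros_antimono[of k "k + M + m1"]] by simp
    then have e: "L' (g (ycan False z)) = g z" using U(3)[of "ycan False z"] w(1) M k by auto
    have "g (ycan False z) \<in> range (can.W (replicate (Suc k') False))" using m1 w(2) by blast
    then obtain v where v: "g (ycan False z) = ycan False v" "v \<in> range (can.W (replicate k' False))" by auto
    then show ?thesis using e k'[OF v(2)] by simp
  qed
  then show ?thesis by blast
qed

text \<open>
  Near the base point \<open>g\<close> and its inverse are increasing, so \<open>g\<close> takes jumps of the order to jumps.
\<close>

lemma VA_adj: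
  assumes g: "g \<in> VA" "g zero = zero"
  shows "\<exists>m. \<forall>i j a b u v. m \<le> i \<longrightarrow> m \<le> j \<longrightarrow> adj (at_scale i a) (at_scale j b) \<longrightarrow>
       can.carries g (at_scale i a) u \<longrightarrow> can.carries g (at_scale j b) v \<longrightarrow> adj u v"
proof -
  have gh: "g \<in> Homeo" and bg: "bij g" using g VA_Homeo Homeo_bij by auto
  obtain U where U: "open U" "zero \<in> U" "monotone_on U less_fun less_fun g"
    using g const_tail_zero unfolding VA_iff V_regular_def mono_at_def by metis
  obtain M where M: "range (can.W (replicate M False)) \<subseteq> U" using can.shrink U by blast
  have "finv g zero = zero" using g(2) bg by (metis bij_simps(2))
  then obtain M2 where M2: "finv g ` range (can.W (replicate M2 False)) \<subseteq> range (can.W (replicate M False))"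
    using VA_shrink[OF Homeo_inv[OF gh]] by blast
  obtain m1 where m1: "g ` range (can.W (replicate m1 False)) \<subseteq> range (can.W (replicate M2 False))" using VA_shrink[OF gh g(2)] by blast
  have "adj u v" if ij: "max M m1 \<le> i" "max M m1 \<le> j" and ad: "adj (at_scale i a) (at_scale j b)"
    and r: "can.carries g (at_scale i a) u" "can.carries g (at_scale j b) v" for i j a b u v
  proof -
    define x z where "x = can.W (at_scale i a) ones" and "z = can.W (at_scale j b) zero"
    have gx: "g x = can.W u ones" "g z = can.W v zero" using r unfolding x_def z_def can.carries_def by blast+
    have xz: "x \<in> U" "z \<in> U" using M ij can.at_scale_in_zeros[of M] unfolding x_def z_def by auto
    have lt: "lt x z" unfolding x_def z_def by (rule adj_no_between[OF ad])
    have nb: "\<not> (lt x w \<and> lt w z)" for w unfolding x_def z_def by (rule adj_no_between[OF ad])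
    have "z \<in> range (can.W (replicate m1 False))" using ij can.at_scale_in_zeros[of m1] unfolding z_def by simp
    then have gz: "g z \<in> range (can.W (replicate M2 False))" using m1 by blast
    show ?thesis
    proof (rule adj_of_gap)
      show "lt (can.W u ones) (can.W v zero)" using U(3) xz lt unfolding monotone_on_def gx[symmetric] by blast
      show "\<not> (lt (can.W u ones) w \<and> lt w (can.W v zero))" for w
      proof
        assume h: "lt (can.W u ones) w \<and> lt w (can.W v zero)"
        then have "w \<in> range (can.W (replicate M2 False))" using lt_zero_cone[OF _ gz] unfolding gx by blast
        then have wU: "finv g w \<in> U" using M2 M by blast
        have w: "g (finv g w) = w" using bg by simp
        have "lt x (finv g w)"
        proof (rule ccontr)
          assume "\<not> lt x (finv g w)"
          then have "x = finv g w \<or> lt (finv g w) x" using lt_total by blast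
          then have "g x = w \<or> lt w (g x)" using U(3) wU xz(1) w unfolding monotone_on_def by metis
          then show False using h less_fun_asym less_fun_irrefl unfolding gx by blast
        qed
        moreover have "lt (finv g w) z"
        proof (rule ccontr)
          assume "\<not> lt (finv g w) z"
          then have "z = finv g w \<or> lt z (finv g w)" using lt_total by blast
          then have "g z = w \<or> lt (g z) w" using U(3) wU xz(2) w unfolding monotone_on_def by metis
          then show False using h less_fun_asym less_fun_irrefl unfolding gx by blast
        qed
        ultimately show False using nb by blast
      qed
    qed
  qed
  then show ?thesis by blast
qed

definition VA0 :: "(cantor \<Rightarrow> cantor) set" where
  "VA0 = {g \<in> VA. g zero = zero \<and> Vsing g \<subseteq> {zero} \<and> (\<forall>z. z \<notin> range (can.W [False]) \<longrightarrow> g z = z)}"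

text \<open>
  The map is increasing because any two points other than the base point are outside some cone \<open>0\<^sup>m\<close>,
  and there it agrees with an element of \<open>F\<close>; the base point itself is the least point and fixed.
\<close>

lemma spread_VA0: assumes h: "can.spread p q c d a" shows "a \<in> VA0"
proof -
  have ah: "a \<in> Homeo" and s: "Vsing a \<subseteq> {zero}"
    using can.spread_Homeo[OF can_cyc_word_homeo h] unfolding ThompsonV_eq by auto
  have a0: "a zero = zero" by (rule can.spread_pt[OF h])
  have ba: "bij a" by (rule can.spread_bij[OF h])
  have "monotone_on UNIV less_fun less_fun a"
    unfolding monotone_on_def
  proof (intro ballI impI)
    fix x z assume xz: "lt x z"
    have z0: "z \<noteq> zero" using xz unfolding less_fun_def by auto
    show "lt (a x) (a z)"
    proof (cases "x = zero")
      case True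
      have "a z \<noteq> zero" using a0 z0 ba by (metis bij_simps(2))
      then show ?thesis using True a0 zero_least by simp
    next
      case False
      obtain i u where i: "x = can.W (at_scale i []) u" using can.pt_or False by blast
      obtain j v where j: "z = can.W (at_scale j []) v" using can.pt_or z0 by blast
      obtain g where g: "can.F_like g" "\<And>z. z \<notin> range (can.W (replicate (Suc (max i j)) False)) \<Longrightarrow> a z = g z"
        using can.spread_approx[OF h] by blast
      have "x \<notin> range (can.W (replicate (Suc (max i j)) False))" "z \<notin> range (can.W (replicate (Suc (max i j)) False))"
        unfolding i j can.at_scale_in_zeros_iff by simp_all
      then have "a x = g x" "a z = g z" using g(2) by blast+
      then show ?thesis using F_like_mono[OF g(1) xz] by simp
    qed
  qed
  then have 1: "mono_at a zero" unfolding mono_at_def by blast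
  let ?L = "prefix_repl ([] @ [False]) []"
  have L: "?L (ycan False z) = z" for z unfolding ycan_def using prefix_repl_conc[of "[False]" "[]" z] by simp
  have tl: "tail_L zero ?L" unfolding tail_L_def by (intro exI[of _ "[]"] exI[of _ False]) (simp add: iter_single)
  have "germ_eq zero (?L \<circ> a) (a \<circ> ?L)"
  proof (rule germ_eqI[OF open_cone])
    show "zero \<in> range (can.W (replicate (Suc (p + q)) False))" using can.W_zeros_pt[of "Suc (p + q)"] by (metis rangeI)
    fix w assume "w \<in> range (can.W (replicate (Suc (p + q)) False))"
    then obtain z where z: "w = ycan False z" "z \<in> range (can.W (replicate (p + q) False))" by auto
    show "(?L \<circ> a) w = (a \<circ> ?L) w" unfolding z(1) comp_apply can.spread_commute[OF h z(2)] L ..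
  qed
  then have "L_at a zero" unfolding L_at_def a0 using tl by blast
  then have "a \<in> VA" unfolding VA_unfold using ah s finite_subset[OF s] const_tail_zero 1 by (auto simp: V_regular_def)
  then show ?thesis unfolding VA0_def using s a0 can.spread_off[OF h] by blast
qed

interpretation VA: dyad_group ycan zero VA VA0
proof
  show "bij f" if "f \<in> VA" for f using that VA_Homeo Homeo_bij by blast
  show "id \<in> VA" by (rule VA_id)
  show "f \<circ> g \<in> VA" if "f \<in> VA" "g \<in> VA" for f g using that by (rule VA_comp)
  show "finv f \<in> VA" if "f \<in> VA" for f using that by (rule VA_inv)
  show "VA0 \<subseteq> VA" unfolding VA0_def by blast
  show "id \<in> VA0" unfolding VA0_def using VA_id sing_self[of id can.word_homeo] can.word_homeo_id ThompsonV_eq by auto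
  show "f \<circ> g \<in> VA0" if fg: "f \<in> VA0" "g \<in> VA0" for f g
  proof -
    have gh: "g \<in> Homeo" using fg VA_Homeo unfolding VA0_def by blast
    have gp: "g zero = zero" using fg unfolding VA0_def by blast
    have "z = zero" if "g z = zero" for z using gp that Homeo_bij[OF gh] by (metis bij_simps(2))
    then have "g -` {zero} \<subseteq> {zero}" by blast
    then have "Vsing (f \<circ> g) \<subseteq> {zero}"
      using can.sing_word_homeo_comp[OF gh, of f] fg unfolding VA0_def ThompsonV_eq by blast
    then show ?thesis using fg VA_comp unfolding VA0_def by simp
  qed
  show "finv f \<in> VA0" if f: "f \<in> VA0" for f
  proof -
    have fh: "f \<in> Homeo" and b: "bij f" using f VA_Homeo Homeo_bij unfolding VA0_def by auto
    have "Vsing (finv f) \<subseteq> f ` Vsing f" using can.sing_word_homeo_inv[OF fh] unfolding ThompsonV_eq .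
    also have "\<dots> \<subseteq> {zero}" using f unfolding VA0_def by auto
    finally have "Vsing (finv f) \<subseteq> {zero}" .
    moreover have "finv f zero = zero" "\<And>z. z \<notin> range (can.W [False]) \<Longrightarrow> finv f z = z"
    proof -
      have 1: "f zero = zero" "\<And>z. z \<notin> range (can.W [False]) \<Longrightarrow> f z = z" using f unfolding VA0_def by blast+
      show "finv f zero = zero" using 1(1) b by (metis bij_simps(2))
      show "finv f z = z" if "z \<notin> range (can.W [False])" for z using 1(2)[OF that] b by (metis bij_simps(2))
    qed
    ultimately show ?thesis using f VA_inv unfolding VA0_def by blast
  qed
  show "f zero = zero" if "f \<in> VA0" for f using that unfolding VA0_def by blast
  show "f \<in> VA" if "cyc P" "cyc Q" "list_all2 (can.carries f) P Q" for P Q f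
    using can_cyc_word_homeo[OF that] word_homeo_VA by blast
  show "\<exists>w. f ` range (can.W w) \<inter> range (can.W w) = {}" if "f \<in> VA" "f \<noteq> id" for f
    using can.displacement VA_Homeo that by blast
  show "a \<in> VA0" if "can.spread p q c d a" for p q c d a using that by (rule spread_VA0)
  show "\<exists>m\<ge>m0. \<exists>n. \<forall>w. n \<le> length w \<longrightarrow> (\<exists>u. can.carries g (at_scale m w) u)" if "g \<in> VA" for g m0
  proof -
    have "finite (sing can.word_homeo g)" using that unfolding VA_iff ThompsonV_eq by blast
    from can.regular_scales[OF this] show ?thesis by (metis nle_le)
  qed
  show "\<exists>m. \<forall>z\<in>range (can.W (replicate m False)). g (ycan False z) = ycan False (g z)" if "g \<in> VA" "g zero = zero" for g
    using that by (rule VA_commute)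
  show "\<exists>m. \<forall>i j a b u v. m \<le> i \<longrightarrow> m \<le> j \<longrightarrow> adj (at_scale i a) (at_scale j b) \<longrightarrow>
       can.carries g (at_scale i a) u \<longrightarrow> can.carries g (at_scale j b) v \<longrightarrow> adj u v" if "g \<in> VA" "g zero = zero" for g
    using that by (rule VA_adj)
  show "\<exists>m. g ` range (can.W (replicate m False)) \<subseteq> range (can.W (replicate M False))" if "g \<in> VA" "g zero = zero" for g M
    using that VA_shrink VA_Homeo by blast
qed

section \<open>Simplicity on the Cantor set\<close>

abbreviation "normalVA \<equiv> normal_dyad_group ycan zero VA VA0"

text \<open>
  Reverses the lexicographic order, and interchanges the tails \<open>000...\<close> and \<open>111...\<close>.
\<close>

definition bitflip :: "cantor \<Rightarrow> cantor" where "bitflip x = (\<lambda>i. \<not> x i)"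

lemma bitflip_bitflip [simp]: "bitflip (bitflip x) = x" by (simp add: bitflip_def)

lemma bitflip_W: "bitflip (can.W w x) = can.W (map Not w) (bitflip x)"
  unfolding can_W bitflip_def by (auto simp: conc_def fun_eq_iff)

lemma bij_bitflip: "bij bitflip" by (rule o_bij[of bitflip]) auto

lemma bitflip_Homeo: "bitflip \<in> Homeo"
proof (rule Homeo_compactI[OF compact_cantor bij_bitflip])
  have "continuous_on UNIV (\<lambda>x :: cantor. \<not> x i)" for i
    by (rule continuous_on_compose2[of UNIV Not UNIV "\<lambda>x. x i"]) (auto intro: continuous_on_discrete)
  then show "continuous_on UNIV bitflip"
    unfolding bitflip_def by (intro continuous_on_coordinatewise_then_product)
qed

abbreviation bit_conj :: "(cantor \<Rightarrow> cantor) \<Rightarrow> cantor \<Rightarrow> cantor" where "bit_conj f \<equiv> bitflip \<circ> f \<circ> bitflip"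

lemma bit_conj_carries: assumes "can.carries f a u" shows "can.carries (bit_conj f) (map Not a) (map Not u)"
  unfolding can.carries_def
proof
  fix x
  have "map Not (map Not a) = a" by (simp add: map_idI)
  then show "bit_conj f (can.W (map Not a) x) = can.W (map Not u) x"
    using assms by (simp add: can.carries_def bitflip_W)
qed

lemma bit_conj_word_homeo: assumes "f \<in> can.word_homeo" shows "bit_conj f \<in> can.word_homeo"
proof -
  obtain n where n: "\<And>w. n \<le> length w \<Longrightarrow> \<exists>u. can.carries f w u" using assms unfolding can.word_homeo_def can.wordlike_def by blast
  have "\<exists>u. can.carries (bit_conj f) w u" if "n \<le> length w" for w
  proof -
    obtain u where "can.carries f (map Not w) u" using n[of "map Not w"] \<open>n \<le> length w\<close> by auto
    from bit_conj_carries[OF this] show ?thesis by (auto simp: comp_def)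
  qed
  moreover have "bit_conj f \<in> Homeo" using assms can.word_homeo_Homeo by (intro Homeo_comp bitflip_Homeo) blast
  ultimately show ?thesis unfolding can.word_homeo_def can.wordlike_def by blast
qed

lemma bit_conj_sing: "Vsing (bit_conj f) \<subseteq> bitflip ` Vsing f"
proof
  fix p assume p: "p \<in> Vsing (bit_conj f)"
  have "bitflip p \<in> Vsing f"
  proof (rule ccontr)
    assume "bitflip p \<notin> Vsing f"
    then obtain t where t: "t \<in> ThompsonV" "germ_eq (bitflip p) f t" unfolding sing_def by blast
    have "germ_eq p (f \<circ> bitflip) (t \<circ> bitflip)" by (rule germ_eq_right[OF t(2) Homeo_tendsto[OF bitflip_Homeo]])
    then have "germ_eq p (bitflip \<circ> (f \<circ> bitflip)) (bitflip \<circ> (t \<circ> bitflip))" by (rule germ_eq_left)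
    then show False using p bit_conj_word_homeo t(1) unfolding sing_def ThompsonV_eq by (auto simp: comp_assoc)
  qed
  then show "p \<in> bitflip ` Vsing f" by (rule image_eqI[rotated]) simp
qed

lemma lt_bitflip: "lt (bitflip x) (bitflip z) \<longleftrightarrow> lt z x"
  unfolding less_fun_def bitflip_def by auto

lemma tail_L_bitflip: assumes "tail_L p L" shows "tail_L (bitflip p) (bit_conj L)"
proof -
  obtain \<alpha> a where p: "p = \<alpha> \<frown> [a]\<^sup>\<omega>" "L = prefix_repl (\<alpha> @ [a]) \<alpha>" using assms unfolding tail_L_def by blast
  have "bitflip p = map Not \<alpha> \<frown> [\<not> a]\<^sup>\<omega>" unfolding p(1) iter_single by (auto simp: bitflip_def conc_def)
  moreover have "bit_conj L = prefix_repl (map Not \<alpha> @ [\<not> a]) (map Not \<alpha>)"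
    unfolding p(2) by (intro ext) (simp add: bitflip_def prefix_repl_nth)
  ultimately show ?thesis unfolding tail_L_def by blast
qed

lemma V_regular_bitflip: assumes "V_regular f (bitflip p)" shows "V_regular (bit_conj f) p"
proof -
  obtain U where U: "open U" "bitflip p \<in> U" "monotone_on U less_fun less_fun f" using assms unfolding V_regular_def mono_at_def by blast
  have "monotone_on (bitflip -` U) less_fun less_fun (bit_conj f)"
    using U(3) unfolding monotone_on_def by (auto simp: lt_bitflip)
  then have 1: "mono_at (bit_conj f) p" unfolding mono_at_def
    using Homeo_open_vimage[OF bitflip_Homeo U(1)] U(2) by (intro exI[of _ "bitflip -` U"]) auto
  obtain L L' where L: "tail_L (bitflip p) L" "tail_L (f (bitflip p)) L'" "germ_eq (bitflip p) (L' \<circ> f) (f \<circ> L)"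
    using assms unfolding V_regular_def L_at_def by blast
  have "germ_eq p ((L' \<circ> f) \<circ> bitflip) ((f \<circ> L) \<circ> bitflip)" by (rule germ_eq_right[OF L(3) Homeo_tendsto[OF bitflip_Homeo]])
  then have "germ_eq p (bitflip \<circ> ((L' \<circ> f) \<circ> bitflip)) (bitflip \<circ> ((f \<circ> L) \<circ> bitflip))" by (rule germ_eq_left)
  moreover have "bitflip \<circ> ((L' \<circ> f) \<circ> bitflip) = bit_conj L' \<circ> bit_conj f" "bitflip \<circ> ((f \<circ> L) \<circ> bitflip) = bit_conj f \<circ> bit_conj L" by (auto simp: fun_eq_iff)
  ultimately have "germ_eq p (bit_conj L' \<circ> bit_conj f) (bit_conj f \<circ> bit_conj L)" by simp
  moreover have "tail_L p (bit_conj L)" "tail_L (bit_conj f p) (bit_conj L')" using tail_L_bitflip[OF L(1)] tail_L_bitflip[OF L(2)] by simp_all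
  ultimately show ?thesis using 1 unfolding V_regular_def L_at_def by blast
qed

lemma const_tail_bitflip: assumes "const_tail p" shows "const_tail (bitflip p)"
proof -
  obtain \<alpha> a where "p = can.W \<alpha> (\<lambda>_. a)" using assms const_tail_iff by blast
  then have "bitflip p = can.W (map Not \<alpha>) (\<lambda>_. \<not> a)" by (simp add: bitflip_W) (simp add: bitflip_def)
  then show ?thesis unfolding const_tail_iff by blast
qed

lemma bit_conj_VA: assumes "f \<in> VA" shows "bit_conj f \<in> VA"
  unfolding VA_iff
proof (intro conjI allI ballI impI)
  show "bit_conj f \<in> Homeo" using assms VA_Homeo by (intro Homeo_comp bitflip_Homeo)
  have "finite (bitflip ` Vsing f)" using assms unfolding VA_iff by blast
  then show "finite (Vsing (bit_conj f))" by (rule finite_subset[OF bit_conj_sing])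
  show "const_tail p" if pv: "p \<in> Vsing (bit_conj f)" for p
  proof -
    obtain p' where "p' \<in> Vsing f" "p = bitflip p'" using bit_conj_sing pv by blast
    then show ?thesis using assms const_tail_bitflip unfolding VA_iff by blast
  qed
  show "V_regular (bit_conj f) p" if "const_tail p" for p
    using V_regular_bitflip const_tail_bitflip[OF that] assms unfolding VA_iff by blast
qed

lemma normalVA_bit_conj: "normalVA N \<Longrightarrow> normalVA (bit_conj ` N)"
  by (rule normal_dyad_group.conjugate_normal) (use bit_conj_VA in auto)

text \<open>
  A point with tail \<open>000...\<close> is the least point of its small cones, and one with tail \<open>111...\<close> the
  greatest. A locally increasing homeomorphism cannot map the former to the latter.
\<close>

lemma VA_zero_tail:
  assumes g: "g \<in> VA" and p: "p = can.W \<alpha> zero" shows "\<exists>\<beta>. g p = can.W \<beta> zero"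
proof -
  have gh: "g \<in> Homeo" and bg: "bij g" using g VA_Homeo Homeo_bij by auto
  have "const_tail p" using p const_tail_iff by blast
  then have v: "V_regular g p" using g unfolding VA_iff by blast
  obtain \<beta> b where b: "g p = can.W \<beta> (\<lambda>_. b)" using V_regular_const_tail(1)[OF v] const_tail_iff by blast
  show ?thesis
  proof (cases b)
    case True
    obtain U where U: "open U" "p \<in> U" "monotone_on U less_fun less_fun g" using v unfolding V_regular_def mono_at_def by blast
    have "open (finv g -` (U \<inter> range (can.W \<alpha>)))"
      using Homeo_open_vimage[OF Homeo_inv[OF gh]] U(1) open_cone by blast
    moreover have "g p \<in> finv g -` (U \<inter> range (can.W \<alpha>))" using bg U(2) p by auto
    ultimately obtain k where k: "range (can.W (wcut (g p) k)) \<subseteq> finv g -` (U \<inter> range (can.W \<alpha>))" using cone_basis by blast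
    define n where "n = length \<beta> + k"
    have gp: "g p = can.W (wcut (g p) n) ones" using const_tail_wcut[of "g p" \<beta> True n] b True unfolding n_def by simp
    define z where "z = can.W (wcut (g p) n) zero"
    have "lt zero ones" unfolding less_fun_def by auto
    then have lz: "lt z (g p)" unfolding z_def by (subst (2) gp) simp
    have "z \<in> range (can.W (wcut (g p) k))" using cone_wcut_mono[of k n "g p"] unfolding z_def n_def by auto
    then have w: "finv g z \<in> U" "finv g z \<in> range (can.W \<alpha>)" using k by auto
    then obtain \<psi> where \<psi>: "finv g z = can.W \<alpha> \<psi>" by blast
    have "\<psi> \<noteq> zero"
    proof
      assume "\<psi> = zero"
      then have "z = g p" using \<psi> p bg by (metis bij_simps(1))
      then show False using lz less_fun_irrefl by auto
    qed
    then have "lt p (finv g z)" unfolding \<psi> p using zero_least by simp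
    then have "lt (g p) (g (finv g z))" using U w(1) unfolding monotone_on_def by blast
    then have "lt (g p) z" using bg by simp
    then show ?thesis using lz less_fun_asym by blast
  next
    case False
    then show ?thesis using b by auto
  qed
qed

lemma normalVA_perm:
  assumes "normalVA N" shows "perm_dyad_group ycan zero VA VA0 N"
proof -
  interpret n: normal_dyad_group ycan zero VA VA0 N by (rule assms)
  show ?thesis by unfold_locales (use can_tiling_word_homeo word_homeo_VA in blast)
qed

lemma word_homeo_normalVA: assumes N: "normalVA N" and f: "f \<in> can.word_homeo" shows "f \<in> N"
proof -
  interpret n: perm_dyad_group ycan zero VA VA0 N by (rule normalVA_perm[OF N])
  have b: "bij f" "can.wordlike f" using f can.word_homeo_Homeo Homeo_bij unfolding can.word_homeo_def by auto
  obtain k Q where "can.tiling Q" "list_all2 (can.carries f) (unif k) Q" using can.wordlike_list[OF b] .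
  then show ?thesis using n.tiling_N can.leaf_tiling leaf_unif by blast
qed

text \<open>
  Move \<open>p\<close> and its image to the base point by elements of \<open>V\<close>. After multiplication with \<open>k \<in> N\<close>
  the result is a prefix replacement on a neighbourhood of the base point, hence regular there.
\<close>

lemma remove_zero_singularity:
  assumes N: "normalVA N" and g: "g \<in> VA" "p \<in> Vsing g" "p = can.W \<alpha> zero"
  shows "\<exists>h\<in>VA. card (Vsing h) < card (Vsing g) \<and> (h \<in> N \<longrightarrow> g \<in> N)"
proof -
  interpret n: normal_dyad_group ycan zero VA VA0 N by (rule N)
  have fin: "finite (Vsing g)" using g(1) unfolding VA_iff by blast
  obtain \<beta> where \<beta>: "g p = can.W \<beta> zero" using VA_zero_tail[OF g(1,3)] by blast
  have z1: "can.W (w @ [False]) zero = can.W w zero" for w by (simp add: can.pt_fix)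
  obtain t where t: "t \<in> can.word_homeo" "can.carries t [False] (\<alpha> @ [False])"
    using can.word_transitive_list[of "[False]" "\<alpha> @ [False]"] can_cyc_word_homeo by blast
  obtain s where s: "s \<in> can.word_homeo" "can.carries s (\<beta> @ [False]) [False]"
    using can.word_transitive_list[of "\<beta> @ [False]" "[False]"] can_cyc_word_homeo by blast
  have tp: "t zero = p" using t(2) z1[of "[]"] z1[of \<alpha>] g(3) unfolding can.carries_def by (metis append_Nil can.W.simps(1))
  have sp: "s (g p) = zero" using s(2) z1[of "[]"] z1[of \<beta>] \<beta> unfolding can.carries_def by (metis append_Nil can.W.simps(1))
  have tsN: "t \<in> N" "s \<in> N" using word_homeo_normalVA[OF N] t(1) s(1) by auto
  have tsV: "t \<in> VA" "s \<in> VA" using word_homeo_VA t(1) s(1) by auto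
  have bt: "bij t" "bij s" using tsV VA.G_bij by auto
  define g1 where "g1 = s \<circ> (g \<circ> t)"
  have g1: "g1 \<in> VA" "g1 zero = zero" unfolding g1_def using VA_comp tsV g(1) tp sp by auto
  have gth: "g \<circ> t \<in> Homeo" "t \<in> Homeo" "g1 \<in> Homeo" using VA_Homeo VA_comp tsV g(1) g1 by blast+
  have s0: "sing can.word_homeo s = {}" "sing can.word_homeo t = {}" using sing_self t(1) s(1) by auto
  have "Vsing g1 \<subseteq> Vsing (g \<circ> t) \<union> (g \<circ> t) -` Vsing s" "Vsing (g \<circ> t) \<subseteq> Vsing t \<union> t -` Vsing g"
    unfolding g1_def ThompsonV_eq using can.sing_word_homeo_comp gth by blast+
  then have sg1: "Vsing g1 \<subseteq> t -` Vsing g" using s0 unfolding ThompsonV_eq by auto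
  obtain k a b where k: "k \<in> N" "k \<in> VA0" "can.carries (k \<circ> g1) (replicate a False) (replicate b False)"
    using n.end_reduction_prefix[OF g1] by blast
  define h where "h = k \<circ> g1"
  have hV: "h \<in> VA" unfolding h_def using VA_comp k(1) n.N_sub g1 by blast
  have "z = zero" if "g1 z = zero" for z using g1(2) that VA.G_bij[OF g1(1)] by (metis bij_simps(2))
  then have "Vsing h \<subseteq> Vsing g1 \<union> {zero}"
    using can.sing_word_homeo_comp[OF gth(3), of k] k(2) unfolding h_def VA0_def ThompsonV_eq by blast
  moreover have "zero \<notin> Vsing h"
  proof -
    have "replicate a False @ [False] \<noteq> []" "replicate b False @ [False] \<noteq> []" by simp_all
    from can.word_transitive_list[OF this] obtain r where
      r: "r \<in> can.word_homeo" "can.carries r (replicate a False @ [False]) (replicate b False @ [False])"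
      using can_cyc_word_homeo by blast
    have "germ_eq zero h r"
    proof (rule germ_eqI[OF open_cone])
      show "zero \<in> range (can.W (replicate a False @ [False]))"
        using can.W_zeros_pt[of "Suc a"] by (metis rangeI replicate_Suc replicate_append_same)
      fix x assume "x \<in> range (can.W (replicate a False @ [False]))"
      then obtain z where "x = can.W (replicate a False @ [False]) z" by blast
      then show "h x = r x" using can.carries_append[OF k(3), of "[False]"] r(2) unfolding h_def can.carries_def by simp
    qed
    then show ?thesis using r(1) unfolding sing_def ThompsonV_eq by blast
  qed
  ultimately have sh: "Vsing h \<subseteq> t -` Vsing g - {zero}" using sg1 by blast
  have "Vsing h \<subseteq> finv t ` (Vsing g - {p})"
  proof
    fix z assume "z \<in> Vsing h"
    then have z: "t z \<in> Vsing g" "z \<noteq> zero" using sh by auto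
    have "t z \<noteq> p" using z(2) tp bt(1) by (metis bij_simps(2))
    then show "z \<in> finv t ` (Vsing g - {p})" using z(1) bt(1) by (intro image_eqI[of _ _ "t z"]) auto
  qed
  then have "card (Vsing h) \<le> card (Vsing g - {p})"
    using fin by (meson card_image_le card_mono finite_Diff finite_imageI le_trans)
  also have "\<dots> < card (Vsing g)" using fin g(2) by (meson card_Diff1_less)
  finally have "card (Vsing h) < card (Vsing g)" .
  moreover have "g \<in> N" if "h \<in> N"
  proof -
    have "finv s \<circ> (finv k \<circ> h) \<circ> finv t \<in> N" by (intro n.N_comp n.N_inv that k(1) tsN)
    moreover have "bij k" using k(1) n.N_sub VA.G_bij by blast
    then have "finv s \<circ> (finv k \<circ> h) \<circ> finv t = g" unfolding h_def g1_def using bt by (auto simp: fun_eq_iff)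
    ultimately show ?thesis by simp
  qed
  ultimately show ?thesis using hV by blast
qed

text \<open>
  Induction on the number of singular points. The exchange of letters reduces singular points with tail \<open>111...\<close> to those
  with tail \<open>000...\<close>, for the conjugate of \<open>N\<close>.
\<close>

theorem normalVA_full: assumes N: "normalVA N" shows "VA \<subseteq> N"
proof -
  interpret n: normal_dyad_group ycan zero VA VA0 N by (rule N)
  have vv: "bit_conj (bit_conj f) = f" for f by (auto simp: fun_eq_iff)
  have "g \<in> VA \<Longrightarrow> g \<in> N" for g
  proof (induction "card (Vsing g)" arbitrary: g rule: less_induct)
    case less
    have fin: "finite (Vsing g)" using less(2) unfolding VA_iff by blast
    show ?case
    proof (cases "Vsing g = {}")
      case True
      then have "g \<in> can.word_homeo" using can.nonsing_wordlike[of g] VA_Homeo[OF less(2)] unfolding can.word_homeo_def ThompsonV_eq by blast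
      then show ?thesis by (rule word_homeo_normalVA[OF N])
    next
      case False
      then obtain p where p: "p \<in> Vsing g" by blast
      then obtain \<alpha> a where a: "p = can.W \<alpha> (\<lambda>_. a)" using less(2) const_tail_iff unfolding VA_iff by blast
      show ?thesis
      proof (cases a)
        case False
        then have "p = can.W \<alpha> zero" using a by simp
        from remove_zero_singularity[OF N less(2) p this] obtain h where
          h: "h \<in> VA" "card (Vsing h) < card (Vsing g)" "h \<in> N \<longrightarrow> g \<in> N" by blast
        then show ?thesis using less(1)[OF h(2) h(1)] by blast
      next
        case True
        have gv: "bit_conj g \<in> VA" by (rule bit_conj_VA[OF less(2)])
        have "p \<in> Vsing (bit_conj (bit_conj g))" using p vv[of g] by simp
        then have "p \<in> bitflip ` Vsing (bit_conj g)" using bit_conj_sing[of "bit_conj g"] by blast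
        then have cp: "bitflip p \<in> Vsing (bit_conj g)" by auto
        have "bitflip p = can.W (map Not \<alpha>) zero" using a True by (simp add: bitflip_W) (simp add: bitflip_def)
        from remove_zero_singularity[OF normalVA_bit_conj[OF N] gv cp this] obtain h where
          h: "h \<in> VA" "card (Vsing h) < card (Vsing (bit_conj g))" "h \<in> bit_conj ` N \<longrightarrow> bit_conj g \<in> bit_conj ` N" by blast
        have c: "card (Vsing (bit_conj f)) \<le> card (Vsing f)" if "f \<in> VA" for f
          using that bit_conj_sing[of f] unfolding VA_iff by (meson card_image_le card_mono finite_imageI le_trans)
        have "card (Vsing (bit_conj h)) < card (Vsing g)" using c[OF h(1)] c[OF less(2)] h(2) by simp
        then have "bit_conj h \<in> N" using less(1) bit_conj_VA[OF h(1)] by blast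
        then have "bit_conj (bit_conj h) \<in> bit_conj ` N" by blast
        then have "bit_conj g \<in> bit_conj ` N" using h(3) unfolding vv by blast
        then obtain f where f: "f \<in> N" "bit_conj g = bit_conj f" by blast
        then have "bit_conj (bit_conj g) = bit_conj (bit_conj f)" by simp
        then have "g = f" unfolding vv .
        then show ?thesis using f(1) by simp
      qed
    qed
  qed
  then show ?thesis by blast
qed

theorem VA_simple: "is_simple_group (comp_group VA)"
proof (rule simple_comp_groupI)
  show "id \<in> VA" by (rule VA_id)
  show "f \<circ> g \<in> VA" if "f \<in> VA" "g \<in> VA" for f g using that by (rule VA_comp)
  show "bij f" if "f \<in> VA" for f using that by (rule VA.G_bij)
  show "finv f \<in> VA" if "f \<in> VA" for f using that by (rule VA_inv)
  obtain f where f: "f \<in> VA" "can.carries f [False] [True]" using VA.word_transitive by blast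
  then have "f \<noteq> id" unfolding can.carries_def by (auto dest: spec[of _ zero])
  then show "\<exists>f\<in>VA. f \<noteq> id" using f(1) by blast
next
  fix N assume "N \<subseteq> VA" "id \<in> N" "\<And>f g. f \<in> N \<Longrightarrow> g \<in> N \<Longrightarrow> f \<circ> g \<in> N"
    "\<And>f. f \<in> N \<Longrightarrow> finv f \<in> N" "\<And>f g. g \<in> VA \<Longrightarrow> f \<in> N \<Longrightarrow> g \<circ> f \<circ> finv g \<in> N" "\<exists>f\<in>N. f \<noteq> id"
  then have "normalVA N" by unfold_locales
  then show "VA \<subseteq> N" by (rule normalVA_full)
qed

theorem theorem4p4:
  shows "is_simple_group (comp_group TA) \<and> is_simple_group (comp_group VA)"
  using TA_simple VA_simple ..

end
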